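(* For every positive integer $n$ define $$A(n):=\left(\frac{2}{\pi}\right)^4\int_0^\infty\left\{[\pi I_0(t)]^2-[K_0(t)]^2\right\}I_0(t)[K_0(t)]^5\,(2t)^{2n-1}\,dt .$$ Then $A(n)$ is a positive integer for every integer $n>1$. Furthermore, for every integer $n\geq 1$, $$A(n+1)=\frac{1}{2^{4(n-1)}}\sum_{m=1}^{n}\sum_{\ell=1}^{m}\sum_{k=1}^{\ell}\frac{[(2n-2m)!]^3}{[(n-m)!]^4}\,\frac{[(2m-2\ell)!]^3}{[(m-\ell)!]^4}\,\frac{[(2\ell-2k)!]^3}{[(\ell-k)!]^4}\,\frac{[(2k-2)!]^3}{[(k-1)!]^4}.$$
   Context: $I_0$ and $K_0$ are the modified Bessel functions of order zero, given for $t>0$ by $I_0(t)=\frac1\pi\int_0^\pi e^{t\cos\theta}\,d\theta$ and $K_0(t)=\int_0^\infty e^{-t\cosh u}\,du$. *)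

theory Defs
  imports "HOL-Analysis.Analysis"
begin

definition bessel_I0 :: "real \<Rightarrow> real" where
  "bessel_I0 t = (1 / pi) * (LBINT \<theta>:{0..pi}. exp (t * cos \<theta>))"

(* Meaningful only for t > 0: for t \<le> 0 the integrand is not integrable and the value is 0. *)
definition bessel_K0 :: "real \<Rightarrow> real" where
  "bessel_K0 t = (LBINT u:{0<..}. exp (- t * cosh u))"

(* Meaningful only for n > 0. The integrand is then integrable: it is O(t^(2n-1) |ln t|^7) at 0
   and decays like exp (- 2 t), up to powers of t, at infinity. *)
definition bessel_A :: "nat \<Rightarrow> real" where
  "bessel_A n = (2 / pi) ^ 4 *
     (LBINT t:{0<..}. ((pi * bessel_I0 t)\<^sup>2 - (bessel_K0 t)\<^sup>2) *
        bessel_I0 t * bessel_K0 t ^ 5 * (2 * t) ^ (2 * n - 1))"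

end

theory Submission
  imports Defs "HOL-Complex_Analysis.Complex_Analysis" "HOL-Probability.Distributions"
begin

text \<open>
  Write \<open>F(z) = (K\<^sub>0(z) (K\<^sub>0(z) + \<i> \<pi> I\<^sub>0(z)))\<^sup>4\<close>. On the positive real axis the imaginary part of
  \<open>F(t) t\<^bsup>2n-1\<^esup>\<close> is \<open>-4 \<pi>\<close> times the integrand of \<open>A(n)\<close>, up to a power of \<open>2\<close>. The second factor is
  \<open>K\<^sub>0(exp (- \<i> \<pi>) z)\<close>, so \<open>F\<close> is real on the positive imaginary axis, and on the closed first quadrant the
  exponentials cancel and \<open>F\<close> has an asymptotic expansion in powers of \<open>1/z\<close> with real coefficients.
  Cauchy's theorem for the quadrant therefore expresses the integral by the coefficient of \<open>1/z\<close> in the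
  expansion of \<open>F(z) z\<^bsup>2n-1\<^esup>\<close>, whose contribution to the arc is a quarter turn of the logarithm, all other
  terms being even powers of \<open>z\<close> after integration and hence real at both ends.

  The expansion is that of \<open>(\<i> \<pi> I\<^sub>0(z) K\<^sub>0(z))\<^sup>4\<close>. Its coefficients satisfy a linear third order
  equation, which integrates to a nonlinear second order equation for the square of the series
  of \<open>2 z I\<^sub>0(z) K\<^sub>0(z)\<close>; the latter is a recursion with integer coefficients in the variable \<open>1/(2z)\<^sup>2\<close>.
\<close>

unbundle no vec_syntax and fps_syntax

section \<open>Power series coefficients\<close>

text \<open>All analytic information is drawn from one representation: \<open>K0(z)\<close> is
  \<open>2 exp (-z)\<close> times the integral of \<open>exp (- z x^2) / sqrt (2 + x^2)\<close> over
  the half-line. The obstacle is that this integral is not absolutely convergent on the imaginary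
  axis and diverges for arguments of negative real part, while both factors of \<open>F\<close> are
  needed on the closed quadrant. Turning the ray to a direction \<open>p\<close> replaces
  \<open>z\<close> by \<open>z p^2\<close>. The directions \<open>cis (- pi / 8)\<close> and
  \<open>cis (3 * pi / 8)\<close> have opposite squares, so both factors become Gaussian transforms
  at the same argument \<open>z p^2\<close>, whose real part is comparable to \<open>|z|\<close> up
  to and including the imaginary axis. Turning the second ray further, towards the imaginary
  direction, lays it along the branch cut of the square root; this is where \<open>I0\<close>
  arises.

  On the arithmetic side, the series of \<open>2 z I0 K0\<close> in \<open>X = 1/(2z)^2\<close>
  begins with \<open>1 + X/2\<close>, so it is not integral itself; its square is, and the fourth
  power inherits this. Positivity is read off from the fourfold Cauchy product, all of whose terms
  are positive.\<close>

text \<open>\<open>2 t I\<^sub>0(t) K\<^sub>0(t)\<close> has the asymptotic series \<open>\<Sum> bessel_coeff j / (64 t\<^sup>2)\<^sup>j\<close> at infinity.\<close>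
definition bessel_coeff :: "nat \<Rightarrow> 'a::field_char_0" where
  "bessel_coeff j = fact (2 * j) ^ 3 / fact j ^ 4"

lemma fact_double_Suc:
  "(fact (2 * Suc j) :: 'a::field_char_0) = 2 * (2 * of_nat j + 1) * (of_nat j + 1) * fact (2 * j)"
  by (simp add: algebra_simps)

lemma bessel_coeff_0 [simp]: "bessel_coeff 0 = 1"
  by (simp add: bessel_coeff_def)

lemma bessel_coeff_Suc:
  "of_nat (Suc j) * bessel_coeff (Suc j) = 8 * (2 * of_nat j + 1) ^ 3 * (bessel_coeff j :: 'a::field_char_0)"
proof -
  define x y f h where "x = 2 * (of_nat j :: 'a) + 1" and "y = (of_nat j :: 'a) + 1"
    and "f = (fact (2 * j) :: 'a)" and "h = (fact j :: 'a)"
  have nz: "y \<noteq> 0" "h \<noteq> 0"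
    unfolding y_def h_def by (metis of_nat_Suc of_nat_eq_0_iff nat.distinct(1) add.commute) simp
  have e: "fact (2 * Suc j) = 2 * x * y * f" "fact (Suc j) = y * h" "of_nat (Suc j) = y"
    unfolding fact_double_Suc by (simp_all add: x_def y_def f_def h_def add_ac)
  have "y * ((2 * x * y * f) ^ 3 / (y * h) ^ 4) = 8 * x ^ 3 * (f ^ 3 / h ^ 4)"
    using nz by (simp add: power_mult_distrib divide_simps) (simp add: eval_nat_numeral)
  then show ?thesis
    unfolding bessel_coeff_def e by (simp only: x_def f_def h_def)
qed

text \<open>Integrality only up to index \<open>n\<close>, because the induction that proves it for
  the squared series knows just these coefficients at each stage.\<close>

definition fps_Ints :: "nat \<Rightarrow> real fps set" where
  "fps_Ints n = {f. \<forall>i\<le>n. f $ i \<in> \<int>}"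

lemma fps_Ints_mult: "f \<in> fps_Ints n \<Longrightarrow> g \<in> fps_Ints n \<Longrightarrow> f * g \<in> fps_Ints n"
  by (auto simp: fps_Ints_def fps_mult_nth intro!: Ints_sum Ints_mult)

text \<open>The constant term 1 makes the recursion for the inverse free of division.\<close>

lemma fps_Ints_inverse:
  assumes "f \<in> fps_Ints n" "f $ 0 = 1"
  shows "inverse f \<in> fps_Ints n"
proof -
  have "i \<le> n \<longrightarrow> inverse f $ i \<in> \<int>" for i
  proof (induction i rule: less_induct)
    case (less i)
    show ?case
    proof (cases i)
      case 0
      then show ?thesis using assms by simp
    next
      case (Suc k)
      have "inverse f $ i = - (\<Sum>j = 1..i. f $ j * inverse f $ (i - j))"
        using assms Suc by (simp add: fps_inverse_def)
      moreover have "(\<Sum>j = 1..i. f $ j * inverse f $ (i - j)) \<in> \<int>" if "i \<le> n"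
        using assms less that by (intro Ints_sum Ints_mult) (auto simp: fps_Ints_def)
      ultimately show ?thesis by simp
    qed
  qed
  then show ?thesis by (auto simp: fps_Ints_def)
qed

section \<open>Integrality of the squared series\<close>

text \<open>The scaling by \<open>16\<^sup>j\<close> corresponds to the variable \<open>1 / (2 t)\<^sup>2\<close>.\<close>
definition bessel_fps :: "real fps" where
  "bessel_fps = Abs_fps (\<lambda>j. bessel_coeff j / 16 ^ j)"

text \<open>With \<open>E = X d/dX\<close> the right-hand side is \<open>(2 E + 1)^3 G\<close>,
  which encodes the factor \<open>(2 j + 1)^3\<close> of the coefficient recursion. Rewriting powers
  of \<open>E\<close> by \<open>X^k d^k/dX^k\<close> produces the constants 8, 36 and 26.\<close>

lemma bessel_fps_ode:
  defines "G \<equiv> bessel_fps"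
  shows "2 * fps_deriv G = 8 * fps_X ^ 3 * fps_deriv (fps_deriv (fps_deriv G))
     + 36 * fps_X ^ 2 * fps_deriv (fps_deriv G) + 26 * fps_X * fps_deriv G + G"
proof (rule fps_ext)
  fix j
  have rec: "2 * (real j + 1) * G $ Suc j = (2 * real j + 1) ^ 3 * G $ j"
    using bessel_coeff_Suc[of j, where 'a = real]
    by (simp add: G_def bessel_fps_def divide_simps) (simp add: algebra_simps)
  have "(8 * fps_X ^ 3 * fps_deriv (fps_deriv (fps_deriv G)) + 36 * fps_X ^ 2 * fps_deriv (fps_deriv G)
     + 26 * fps_X * fps_deriv G + G) $ j = (2 * real j + 1) ^ 3 * G $ j"
  proof -
    \<comment> \<open>The indices below 3 are separated because multiplication by
      \<open>fps_X ^ 3\<close> shifts the index by 3; writing \<open>j = k + 3\<close> removes the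
      truncated subtraction.\<close>
    consider "j = 0" | "j = 1" | "j = 2" | k where "j = k + 3"
      by (metis add.commute add_2_eq_Suc le_Suc_ex nat_le_linear not_less_eq_eq numeral_3_eq_3 One_nat_def Suc_1 le_0_eq le_SucE)
    then show ?thesis
      by cases (simp_all add: mult.assoc fps_X_power_mult_nth numeral_fps_const fps_X_mult_nth
         numeral_2_eq_2 numeral_3_eq_3 algebra_simps)
  qed
  with rec show "(2 * fps_deriv G) $ j = (8 * fps_X ^ 3 * fps_deriv (fps_deriv (fps_deriv G))
     + 36 * fps_X ^ 2 * fps_deriv (fps_deriv G) + 26 * fps_X * fps_deriv G + G) $ j"
    by (simp add: numeral_fps_const algebra_simps)
qed

text \<open>The difference of the two sides has derivative \<open>G\<close> times the linear equation.\<close>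
lemma bessel_fps_nonlinear_ode:
  defines "G \<equiv> bessel_fps"
  shows "G\<^sup>2 = 1 + fps_X * (8 * fps_X\<^sup>2 * G * fps_deriv (fps_deriv G) + 12 * fps_X * G * fps_deriv G
     - 4 * fps_X\<^sup>2 * (fps_deriv G)\<^sup>2 + G\<^sup>2)"
proof -
  define N where "N = G\<^sup>2 - fps_X * (8 * fps_X\<^sup>2 * G * fps_deriv (fps_deriv G) + 12 * fps_X * G * fps_deriv G
     - 4 * fps_X\<^sup>2 * (fps_deriv G)\<^sup>2 + G\<^sup>2)"
  have "fps_deriv N = G * (2 * fps_deriv G - (8 * fps_X ^ 3 * fps_deriv (fps_deriv (fps_deriv G))
     + 36 * fps_X ^ 2 * fps_deriv (fps_deriv G) + 26 * fps_X * fps_deriv G + G))"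
    unfolding N_def by (simp add: power2_eq_square power3_eq_cube algebra_simps)
  also have "\<dots> = 0"
    using bessel_fps_ode unfolding G_def by simp
  finally have "N = fps_const (N $ 0)"
    by (simp add: fps_deriv_eq_0_iff)
  moreover have "N $ 0 = 1"
    by (simp add: N_def G_def bessel_fps_def power2_eq_square)
  ultimately have "N = 1" by simp
  then show ?thesis
    unfolding N_def by (simp add: algebra_simps)
qed

text \<open>In terms of \<open>P = G\<^sup>2\<close> and \<open>E = X d/dX\<close> the nonlinear equation reads
  \<open>P = 1 + X (4 E\<^sup>2P + 2 E P - 3 (E P)\<^sup>2 / P + P)\<close>, which determines each coefficient of \<open>P\<close>
  as an integer polynomial in the previous ones.\<close>
lemma bessel_fps_square_Ints: "bessel_fps\<^sup>2 \<in> fps_Ints n"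
proof (induction n)
  case 0
  show ?case by (simp add: fps_Ints_def bessel_fps_def power2_eq_square)
next
  case (Suc n)
  define G where "G = bessel_fps"
  define P where "P = G\<^sup>2"
  have G0: "G $ 0 = 1" by (simp add: G_def bessel_fps_def)
  then have P0: "P $ 0 = 1" by (simp add: P_def power2_eq_square)
  \<comment> \<open>\<open>R\<close> is \<open>(E P)^2 / P\<close>. As \<open>P = G^2\<close>, it
    equals \<open>(2 E G)^2\<close>, which is how the term \<open>(fps_deriv G)\<^sup>2\<close> is
    expressed by \<open>P\<close> alone; the division is harmless since \<open>P\<close> has
    constant term 1.\<close>
  define R where "R = (fps_X * fps_deriv P) * (fps_X * fps_deriv P) * inverse P"
  have "inverse P * P = 1" using P0 by (simp add: inverse_mult_eq_1)
  then have PG: "inverse P * G\<^sup>2 = 1" by (simp add: P_def)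
  have "R = (inverse P * G\<^sup>2) * (4 * fps_X\<^sup>2 * (fps_deriv G)\<^sup>2)"
    unfolding R_def by (simp add: P_def power2_eq_square algebra_simps)
  then have R: "R = 4 * fps_X\<^sup>2 * (fps_deriv G)\<^sup>2"
    unfolding PG by simp
  have P: "P = 1 + fps_X * (4 * (fps_X * fps_deriv (fps_X * fps_deriv P)) + 2 * (fps_X * fps_deriv P) - 3 * R + P)"
    unfolding R using bessel_fps_nonlinear_ode unfolding P_def G_def
    by (simp add: power2_eq_square algebra_simps)
  have IH: "P \<in> fps_Ints n" using Suc by (simp add: P_def G_def)
  have E: "fps_X * fps_deriv P \<in> fps_Ints n"
    using IH by (auto simp: fps_Ints_def fps_X_mult_nth intro!: Ints_mult)
  have "R \<in> fps_Ints n"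
    unfolding R_def by (intro fps_Ints_mult fps_Ints_inverse E IH P0)
  \<comment> \<open>The factor \<open>fps_X\<close> in front of the bracket lowers the index:
    coefficient \<open>Suc n\<close> of \<open>P\<close> is coefficient \<open>n\<close> of the
    bracket, which the induction hypothesis reaches.\<close>
  then have "P $ Suc n \<in> \<int>"
    using IH E by (subst P) (auto simp: fps_Ints_def fps_X_mult_nth numeral_fps_const
        intro!: Ints_mult Ints_add Ints_diff)
  with IH show ?case
    unfolding P_def G_def by (auto simp: fps_Ints_def le_Suc_eq)
qed

lemma bessel_fps_power4_nth_Ints: "(bessel_fps ^ 4) $ n \<in> \<int>"
proof -
  have "bessel_fps ^ 4 = bessel_fps\<^sup>2 * bessel_fps\<^sup>2" by (simp flip: power_add)
  then show ?thesis
    using fps_Ints_mult[OF bessel_fps_square_Ints bessel_fps_square_Ints, of n] by (simp add: fps_Ints_def)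
qed

section \<open>Hankel's series for \<open>K0\<close> and the product of its two branches\<close>

text \<open>The asymptotic series of \<open>sqrt (2 t / \<pi>) exp t K\<^sub>0(t)\<close> is \<open>\<Sum> (-1)\<^sup>j hankel_coeff j / t\<^sup>j\<close>.\<close>
definition hankel_coeff :: "nat \<Rightarrow> 'a::field_char_0" where
  "hankel_coeff j = fact (2 * j) ^ 2 / (32 ^ j * fact j ^ 3)"

lemma hankel_coeff_0 [simp]: "hankel_coeff 0 = 1"
  by (simp add: hankel_coeff_def)

lemma hankel_coeff_Suc:
  "8 * of_nat (Suc j) * hankel_coeff (Suc j) = (2 * of_nat j + 1) ^ 2 * (hankel_coeff j :: 'a::field_char_0)"
proof -
  define x y f h where "x = 2 * (of_nat j :: 'a) + 1" and "y = (of_nat j :: 'a) + 1"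
    and "f = (fact (2 * j) :: 'a)" and "h = (fact j :: 'a)"
  have nz: "y \<noteq> 0" "h \<noteq> 0"
    unfolding y_def h_def by (metis of_nat_Suc of_nat_eq_0_iff nat.distinct(1) add.commute) simp
  have e: "fact (2 * Suc j) = 2 * x * y * f" "fact (Suc j) = y * h" "of_nat (Suc j) = y"
    unfolding fact_double_Suc by (simp_all add: x_def y_def f_def h_def add_ac)
  have "8 * y * ((2 * x * y * f) ^ 2 / (32 ^ Suc j * (y * h) ^ 3)) = x ^ 2 * (f ^ 2 / (32 ^ j * h ^ 3))"
    using nz by (simp add: power_mult_distrib divide_simps) (simp add: eval_nat_numeral)
  then show ?thesis
    unfolding hankel_coeff_def e by (simp only: x_def f_def h_def)
qed

text \<open>In the variable \<open>1/z\<close>, the value \<open>c = -1\<close> belongs to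
  \<open>K0\<close> at \<open>z\<close> and \<open>c = 1\<close> to the continuation to
  \<open>-z\<close>.\<close>

definition hankel_fps :: "'a::field_char_0 \<Rightarrow> 'a fps" where
  "hankel_fps c = Abs_fps (\<lambda>j. c ^ j * hankel_coeff j)"

text \<open>The bracket is \<open>(2 E + 1)^2 A\<close> with \<open>E = X d/dX\<close>, matching the
  factor \<open>(2 j + 1)^2\<close> in \<open>hankel_coeff_Suc\<close>.\<close>

lemma hankel_fps_ode:
  fixes c :: "'a::field_char_0"
  defines "A \<equiv> hankel_fps c"
  shows "8 * fps_deriv A = fps_const c *
    (4 * fps_X\<^sup>2 * fps_deriv (fps_deriv A) + 8 * fps_X * fps_deriv A + A)"
proof (rule fps_ext)
  fix j
  have rec: "8 * (of_nat j + 1) * A $ Suc j = c * (2 * of_nat j + 1) ^ 2 * A $ j"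
    using arg_cong[OF hankel_coeff_Suc[of j, where 'a = 'a], of "\<lambda>x. c ^ Suc j * x"]
    by (simp add: A_def hankel_fps_def algebra_simps)
  have "(4 * fps_X\<^sup>2 * fps_deriv (fps_deriv A) + 8 * fps_X * fps_deriv A + A) $ j = (2 * of_nat j + 1) ^ 2 * A $ j"
  proof -
    consider "j = 0" | "j = 1" | k where "j = k + 2"
      by (metis One_nat_def Suc_1 add.commute le_Suc_ex less_2_cases not_less)
    then show ?thesis
      by cases (simp_all add: mult.assoc fps_X_power_mult_nth numeral_fps_const
         numeral_2_eq_2 algebra_simps)
  qed
  moreover have "(8 * fps_deriv A) $ j = 8 * (of_nat j + 1) * A $ Suc j"
    by (simp add: numeral_fps_const algebra_simps)
  ultimately show "(8 * fps_deriv A) $ j = (fps_const c * (4 * fps_X\<^sup>2 * fps_deriv (fps_deriv A) + 8 * fps_X * fps_deriv A + A)) $ j"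
    using rec by (simp only: fps_mult_left_const_nth mult.assoc)
qed

text \<open>A product of solutions of two second order equations: besides \<open>C = A B\<close>,
  the derivatives only involve \<open>W = A' B - A B'\<close> and \<open>S = A' B'\<close>.
  Relations 1 to 3 express \<open>C''\<close>, \<open>W'\<close> and \<open>S'\<close>; together
  with the derivative of relation 1 they allow \<open>W\<close> and \<open>S\<close> to be
  eliminated. The result reads \<open>X (E + 1)^3 C = 4 C'\<close>.\<close>

lemma hankel_fps_product_ode:
  fixes C :: "'a::field_char_0 fps"
  defines "C \<equiv> hankel_fps (-1) * hankel_fps 1"
  shows "fps_X * (fps_X ^ 3 * fps_deriv (fps_deriv (fps_deriv C)) + 6 * fps_X\<^sup>2 * fps_deriv (fps_deriv C)
    + 7 * fps_X * fps_deriv C + C) = 4 * fps_deriv C"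
proof -
  let ?D = "fps_deriv :: 'a fps \<Rightarrow> 'a fps"
  define A :: "'a fps" where "A = hankel_fps (-1)"
  define B :: "'a fps" where "B = hankel_fps 1"
  define a1 a2 b1 b2 where "a1 = ?D A" "a2 = ?D a1" "b1 = ?D B" "b2 = ?D b1"
  note defs = this
  define X :: "'a fps" where "X = fps_X"
  have dX: "?D X = 1" by (simp add: X_def)
  have A: "4 * X\<^sup>2 * a2 = - 8 * X * a1 - A - 8 * a1"
  proof -
    have "8 * a1 = - (4 * X\<^sup>2 * a2 + 8 * X * a1 + A)"
      using hankel_fps_ode[of "-1 :: 'a"] unfolding defs A_def X_def
      by (simp flip: fps_const_neg)
    then show ?thesis by algebra
  qed
  have B: "4 * X\<^sup>2 * b2 = - 8 * X * b1 - B + 8 * b1"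
  proof -
    have "8 * b1 = 4 * X\<^sup>2 * b2 + 8 * X * b1 + B"
      using hankel_fps_ode[of "1 :: 'a"] unfolding defs B_def X_def by simp
    then show ?thesis by algebra
  qed
  have C: "C = A * B" "?D C = a1 * B + A * b1"
    "?D (?D C) = a2 * B + 2 * a1 * b1 + A * b2"
    by (simp_all add: C_def A_def[symmetric] B_def[symmetric] defs algebra_simps)
  define W S where "W = a1 * B - A * b1" and "S = a1 * b1"
  have dS: "?D S = a2 * b1 + a1 * b2" and dW: "?D W = a2 * B - A * b2"
    by (simp_all add: S_def W_def defs algebra_simps)
  have 1: "4 * X\<^sup>2 * ?D (?D C) + 8 * X * ?D C + 2 * C + 8 * W - 8 * X\<^sup>2 * S = 0"
  proof -
    have "4 * X\<^sup>2 * ?D (?D C) = (4 * X\<^sup>2 * a2) * B + 8 * X\<^sup>2 * S + A * (4 * X\<^sup>2 * b2)"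
      unfolding C(3) S_def by (simp add: algebra_simps)
    then show ?thesis unfolding A B C(2) W_def S_def by (simp add: C(1) algebra_simps)
  qed
  have 2: "4 * X\<^sup>2 * ?D W + 8 * X * W + 8 * ?D C = 0"
  proof -
    have "4 * X\<^sup>2 * ?D W = (4 * X\<^sup>2 * a2) * B - A * (4 * X\<^sup>2 * b2)"
      unfolding dW by (simp add: algebra_simps)
    then show ?thesis unfolding A B C(2) W_def by (simp add: algebra_simps)
  qed
  have 3: "4 * X\<^sup>2 * ?D S + 16 * X * S + ?D C = 0"
  proof -
    have "4 * X\<^sup>2 * ?D S = (4 * X\<^sup>2 * a2) * b1 + a1 * (4 * X\<^sup>2 * b2)"
      unfolding dS by (simp add: algebra_simps)
    then show ?thesis unfolding A B C(2) S_def by (simp add: algebra_simps)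
  qed
  have "?D (4 * X\<^sup>2 * ?D (?D C) + 8 * X * ?D C + 2 * C + 8 * W - 8 * X\<^sup>2 * S) = 0"
    unfolding 1 by simp
  then have 4: "4 * X\<^sup>2 * ?D (?D (?D C)) + 16 * X * ?D (?D C) + 10 * ?D C + 8 * ?D W - 16 * X * S - 8 * X\<^sup>2 * ?D S = 0"
    by (simp add: power2_eq_square dX algebra_simps)
  define c1 c2 c3 w1 s1 where "c1 = ?D C" "c2 = ?D c1" "c3 = ?D c2" "w1 = ?D W" "s1 = ?D S"
  note c = this
  \<comment> \<open>The elimination yields \<open>X\<close> times the wanted equation;
    \<open>X\<close> is then cancelled in the domain of power series.\<close>
  have "X * (4 * (X * (X ^ 3 * c3 + 6 * X\<^sup>2 * c2 + 7 * X * c1 + C) - 4 * c1)) = 0"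
    using 1 2 3 4 unfolding c[symmetric] by algebra
  then have "4 * (X * (X ^ 3 * c3 + 6 * X\<^sup>2 * c2 + 7 * X * c1 + C) - 4 * c1) = 0"
    by (metis X_def fps_X_neq_zero mult_eq_0_iff)
  then show ?thesis unfolding c X_def by (simp add: numeral_fps_const)
qed

lemma fps_nth_compose_X2:
  fixes f :: "'a::field_char_0 fps"
  shows "(f oo fps_X\<^sup>2) $ (2 * j) = f $ j" "odd k \<Longrightarrow> (f oo fps_X\<^sup>2) $ k = 0"
proof -
  have X: "((fps_X\<^sup>2) ^ i :: 'a fps) $ k = (if k = 2 * i then 1 else 0)" for i k
    by (subst power_mult[symmetric]) (simp add: fps_X_power_iff)
  show "(f oo fps_X\<^sup>2) $ (2 * j) = f $ j"
    by (simp add: fps_compose_nth X if_distrib cong: if_cong)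
  assume "odd k"
  then have "k \<noteq> 2 * i" for i by auto
  then show "(f oo fps_X\<^sup>2) $ k = 0"
    by (simp add: fps_compose_nth X)
qed

text \<open>The equation for the product gives a recursion from \<open>C $ k\<close> to
  \<open>C $ (k + 2)\<close>. Since \<open>C $ 1 = 0\<close>, all odd coefficients vanish, and the
  even ones obey the recursion of \<open>bessel_coeff\<close> rescaled by
  \<open>64 ^ j\<close>.\<close>

lemma hankel_fps_product:
  "hankel_fps (-1) * hankel_fps 1 = (Abs_fps (\<lambda>j. bessel_coeff j / 64 ^ j) oo fps_X\<^sup>2 :: 'a::field_char_0 fps)"
proof -
  define C :: "'a fps" where "C = hankel_fps (-1) * hankel_fps 1"
  have C0: "C $ 0 = 1" by (simp add: C_def hankel_fps_def)
  have rec: "(fps_X * (fps_X ^ 3 * fps_deriv (fps_deriv (fps_deriv C)) + 6 * fps_X\<^sup>2 * fps_deriv (fps_deriv C)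
    + 7 * fps_X * fps_deriv C + C)) $ k = (4 * fps_deriv C) $ k" for k
    using hankel_fps_product_ode[where 'a = 'a] unfolding C_def by simp
  have C1: "C $ 1 = 0"
    using rec[of 0] by (simp add: numeral_fps_const)
  have C2: "4 * (of_nat k + 2) * C $ (k + 2) = (of_nat k + 1) ^ 3 * C $ k" for k
  proof -
    consider "k = 0" | "k = 1" | "k = 2" | m where "k = m + 3"
      by (metis add.commute add_2_eq_Suc le_Suc_ex nat_le_linear not_less_eq_eq numeral_3_eq_3 One_nat_def Suc_1 le_0_eq le_SucE)
    then have "(fps_X ^ 3 * fps_deriv (fps_deriv (fps_deriv C)) + 6 * fps_X\<^sup>2 * fps_deriv (fps_deriv C)
        + 7 * fps_X * fps_deriv C + C) $ k = (of_nat k + 1) ^ 3 * C $ k"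
      by cases (simp_all add: mult.assoc fps_X_power_mult_nth numeral_fps_const
         numeral_2_eq_2 numeral_3_eq_3 algebra_simps)
    moreover have "(4 * fps_deriv C) $ Suc k = 4 * (of_nat k + 2) * C $ (k + 2)"
      by (simp add: numeral_fps_const algebra_simps)
    ultimately show ?thesis
      using rec[of "Suc k"] by (simp only: fps_X_mult_nth) simp
  qed
  have "C $ (2 * j) = bessel_coeff j / 64 ^ j \<and> C $ Suc (2 * j) = 0" for j
  proof (induction j)
    case (Suc j)
    have nz: "(of_nat j + 1 :: 'a) \<noteq> 0"
      by (metis of_nat_Suc of_nat_eq_0_iff nat.distinct(1) add.commute)
    have "4 * (of_nat (Suc (2 * j)) + 2) = (of_nat (8 * j + 12) :: 'a)"
      by (simp add: algebra_simps)
    then have "of_nat (8 * j + 12) * C $ Suc (2 * Suc j) = 0"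
      using C2[of "Suc (2 * j)"] Suc by (simp add: add.commute)
    then have "C $ Suc (2 * Suc j) = 0"
      by (metis mult_eq_0_iff of_nat_eq_0_iff add_is_0 zero_neq_numeral)
    moreover have "8 * ((of_nat j + 1) * C $ (2 * Suc j)) = (2 * of_nat j + 1) ^ 3 * bessel_coeff j / 64 ^ j"
      using C2[of "2 * j"] Suc by (simp add: algebra_simps)
    moreover have "\<dots> = 8 * ((of_nat j + 1) * (bessel_coeff (Suc j) / 64 ^ Suc j))"
      using bessel_coeff_Suc[of j, where 'a = 'a] by (simp add: add_ac)
    ultimately have "8 * ((of_nat j + 1) * C $ (2 * Suc j)) = 8 * ((of_nat j + 1) * (bessel_coeff (Suc j) / 64 ^ Suc j))"
      and "C $ Suc (2 * Suc j) = 0" by simp_all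
    then show ?case using nz by (simp only: mult_cancel_left zero_neq_numeral) simp
  qed (use C0 C1 in auto)
  note C = this
  show ?thesis
    unfolding C_def[symmetric]
  proof (rule fps_ext)
    fix k
    show "C $ k = (Abs_fps (\<lambda>j. bessel_coeff j / 64 ^ j) oo fps_X\<^sup>2) $ k"
    proof (cases "even k")
      case True
      then obtain j where "k = 2 * j" by blast
      then show ?thesis using C[of j] by (simp add: fps_nth_compose_X2)
    next
      case False
      then obtain j where "k = Suc (2 * j)" using oddE by (metis Suc_eq_plus1)
      then show ?thesis using C[of j] False by (simp add: fps_nth_compose_X2)
    qed
  qed
qed

section \<open>Gaussian transforms\<close>

text \<open>The integral of \<open>exp (- x^2) * x ^ (2 * k)\<close> over the half-line, that is,
  half of \<open>Gamma (k + 1/2)\<close>.\<close>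

definition gauss_moment :: "nat \<Rightarrow> real" where
  "gauss_moment k = sqrt pi / 2 * (fact (2 * k) / (4 ^ k * fact k))"

lemma has_bochner_integral_gauss_moment:
  assumes r: "r > 0"
  shows "has_bochner_integral lborel (\<lambda>x. indicator {0..} x *\<^sub>R (exp (- (r * x\<^sup>2)) * x ^ (2 * k)))
    (gauss_moment k / (sqrt r * r ^ k))"
proof -
  define f :: "real \<Rightarrow> real" where "f = (\<lambda>x. indicator {0..} x *\<^sub>R (exp (- x\<^sup>2) * x ^ (2 * k)))"
  have "has_bochner_integral lborel f (gauss_moment k)"
    using gaussian_moment_even_pos[of k] by (simp add: f_def gauss_moment_def power_mult)
  then have "has_bochner_integral lborel (\<lambda>x. f (0 + sqrt r * x)) (gauss_moment k /\<^sub>R \<bar>sqrt r\<bar>)"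
    using r by (subst (asm) lborel_has_bochner_integral_real_affine_iff[of "sqrt r" _ _ 0]) auto
  then have "has_bochner_integral lborel (\<lambda>x. (1 / r ^ k) * f (0 + sqrt r * x)) ((1 / r ^ k) * (gauss_moment k /\<^sub>R \<bar>sqrt r\<bar>))"
    by (rule has_bochner_integral_mult_right)
  also have "(\<lambda>x. (1 / r ^ k) * f (0 + sqrt r * x)) = (\<lambda>x. indicator {0..} x *\<^sub>R (exp (- (r * x\<^sup>2)) * x ^ (2 * k)))"
    using r by (auto simp: fun_eq_iff indicator_def power_mult_distrib power_mult zero_le_mult_iff f_def)
  also have "(1 / r ^ k) * (gauss_moment k /\<^sub>R \<bar>sqrt r\<bar>) = gauss_moment k / (sqrt r * r ^ k)"
    using r by (simp add: divide_inverse)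
  finally show ?thesis .
qed

lemma set_integrable_gauss_moment:
  "r > 0 \<Longrightarrow> set_integrable lborel {0..} (\<lambda>x::real. exp (- (r * x\<^sup>2)) * x ^ (2 * k))"
  unfolding set_integrable_def by (rule integrable.intros[OF has_bochner_integral_gauss_moment])

lemma set_integral_gauss_moment:
  "r > 0 \<Longrightarrow> (LBINT x:{0..}. exp (- (r * x\<^sup>2)) * x ^ (2 * k)) = gauss_moment k / (sqrt r * r ^ k)"
  unfolding set_lebesgue_integral_def
  by (rule has_bochner_integral_integral_eq[OF has_bochner_integral_gauss_moment])

definition gauss_transform :: "(real \<Rightarrow> complex) \<Rightarrow> complex \<Rightarrow> complex" where
  "gauss_transform \<phi> s = (LBINT x:{0..}. exp (- (s * (of_real x)\<^sup>2)) * \<phi> x)"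

lemma norm_exp_gauss: "norm (exp (- (s * (of_real x)\<^sup>2)) :: complex) = exp (- (Re s * x\<^sup>2))"
  by (simp add: norm_exp_eq_Re power2_eq_square)

text \<open>The majorant is an even power so that the same hypothesis covers the bounded kernel
  (\<open>k = 0\<close>) and its Taylor remainder (\<open>k = Suc n\<close>).\<close>

lemma gauss_transform_integrable:
  assumes "set_borel_measurable lborel {0..} \<phi>" and "\<And>x. x \<ge> 0 \<Longrightarrow> norm (\<phi> x) \<le> B * x ^ (2 * k)" and "Re s > 0"
  shows "set_integrable lborel {0..} (\<lambda>x. exp (- (s * (of_real x)\<^sup>2)) * \<phi> x)"
proof (rule set_integrable_bound[OF set_integrable_mult_right[of B, OF set_integrable_gauss_moment[OF assms(3), of k]]])
  have "(\<lambda>x. exp (- (s * (of_real x)\<^sup>2)) * (indicator {0..} x *\<^sub>R \<phi> x)) \<in> borel_measurable lborel"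
    using assms(1) unfolding set_borel_measurable_def by measurable
  then show "set_borel_measurable lborel {0..} (\<lambda>x. exp (- (s * (of_real x)\<^sup>2)) * \<phi> x)"
    unfolding set_borel_measurable_def by (simp add: mult_scaleR_right)
  show "AE x in lborel. x \<in> {0..} \<longrightarrow>
     norm (exp (- (s * (of_real x)\<^sup>2)) * \<phi> x) \<le> norm (B * (exp (- (Re s * x\<^sup>2)) * x ^ (2 * k)))"
  proof (intro AE_I2 impI)
    fix x :: real assume "x \<in> {0..}"
    then have "norm (exp (- (s * (of_real x)\<^sup>2)) * \<phi> x) \<le> exp (- (Re s * x\<^sup>2)) * (B * x ^ (2 * k))"
      unfolding norm_mult norm_exp_gauss by (intro mult_left_mono assms(2)) auto
    then show "norm (exp (- (s * (of_real x)\<^sup>2)) * \<phi> x) \<le> norm (B * (exp (- (Re s * x\<^sup>2)) * x ^ (2 * k)))"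
      by (simp add: mult_ac)
  qed
qed

lemma gauss_transform_bound:
  assumes "set_borel_measurable lborel {0..} \<phi>" and b: "\<And>x. x \<ge> 0 \<Longrightarrow> norm (\<phi> x) \<le> B * x ^ (2 * k)" and "Re s > 0"
  shows "norm (gauss_transform \<phi> s) \<le> B * (gauss_moment k / (sqrt (Re s) * Re s ^ k))"
proof -
  have "norm (gauss_transform \<phi> s) \<le> (LBINT x:{0..}. norm (exp (- (s * (of_real x)\<^sup>2)) * \<phi> x))"
    unfolding gauss_transform_def
    by (rule set_integral_norm_bound[OF gauss_transform_integrable[OF assms]])
  also have "\<dots> \<le> (LBINT x:{0..}. B * (exp (- (Re s * x\<^sup>2)) * x ^ (2 * k)))"
  proof (rule set_integral_mono)
    show "set_integrable lborel {0..} (\<lambda>x. norm (exp (- (s * (of_real x)\<^sup>2)) * \<phi> x))"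
      by (rule set_integrable_norm[OF gauss_transform_integrable[OF assms]])
    show "set_integrable lborel {0..} (\<lambda>x. B * (exp (- (Re s * x\<^sup>2)) * x ^ (2 * k)))"
      by (rule set_integrable_mult_right[OF set_integrable_gauss_moment[OF assms(3)]])
    fix x :: real assume "x \<in> {0..}"
    then have "exp (- (Re s * x\<^sup>2)) * norm (\<phi> x) \<le> exp (- (Re s * x\<^sup>2)) * (B * x ^ (2 * k))"
      by (intro mult_left_mono b) auto
    then show "norm (exp (- (s * (of_real x)\<^sup>2)) * \<phi> x) \<le> B * (exp (- (Re s * x\<^sup>2)) * x ^ (2 * k))"
      unfolding norm_mult norm_exp_gauss by (simp add: mult_ac)
  qed
  also have "\<dots> = B * (gauss_moment k / (sqrt (Re s) * Re s ^ k))"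
    by (simp add: set_integral_gauss_moment[OF assms(3)])
  finally show ?thesis .
qed

lemma tendsto_set_integral_Icc:
  fixes f :: "real \<Rightarrow> 'a::{banach, second_countable_topology}"
  assumes "set_integrable lborel {0..} f"
  shows "(\<lambda>n. LBINT x:{0..real n}. f x) \<longlonglongrightarrow> (LBINT x:{0..}. f x)"
proof -
  have un: "(\<Union>n. {0..real n}) = {0..}"
    by (auto simp: real_arch_simple)
  have "(\<lambda>n. LBINT x:{0..real n}. f x) \<longlonglongrightarrow> (LBINT x:(\<Union>n. {0..real n}). f x)"
    by (rule set_integral_cont_up) (use assms un in \<open>auto simp: incseq_def\<close>)
  then show ?thesis unfolding un .
qed

text \<open>The integrals over \<open>[0, n]\<close> are holomorphic by differentiation under the
  integral sign. On the disc of radius \<open>Re s / 2\<close> about \<open>s\<close> the real part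
  stays above \<open>Re s / 2\<close>, so the tails have a common Gaussian majorant and the
  convergence is locally uniform.\<close>

lemma gauss_transform_holomorphic:
  assumes cont: "continuous_on {0..} \<phi>" and b: "\<And>x. x \<ge> 0 \<Longrightarrow> norm (\<phi> x) \<le> B * x ^ (2 * k)"
  shows "gauss_transform \<phi> holomorphic_on {s. Re s > 0}"
proof (rule holomorphic_uniform_sequence)
  show op: "open {s. Re s > 0}" by (rule open_halfspace_Re_gt)
  define F where "F = (\<lambda>s x. exp (- (s * (of_real x)\<^sup>2)) * \<phi> x)"
  have meas: "set_borel_measurable lborel {0..} \<phi>"
    using borel_measurable_continuous_on_indicator[OF _ cont] by (simp add: set_borel_measurable_def)
  have contF: "continuous_on (cbox 0 (real n)) (F s)" for s n
    unfolding F_def by (intro continuous_intros continuous_on_subset[OF cont]) auto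
  show "(\<lambda>s. integral (cbox 0 (real n)) (F s)) holomorphic_on {s. Re s > 0}" for n
  proof (rule leibniz_rule_holomorphic)
    show "((\<lambda>s. F s x) has_field_derivative (- ((of_real x)\<^sup>2) * exp (- (s * (of_real x)\<^sup>2)) * \<phi> x)) (at s within {s. Re s > 0})" for s x
      unfolding F_def by (auto intro!: derivative_eq_intros)
    show "F s integrable_on cbox 0 (real n)" for s
      by (rule integrable_continuous[OF contF])
    have "continuous_on ({s. 0 < Re s} \<times> cbox 0 (real n)) (\<lambda>p. \<phi> (snd p))"
      by (rule continuous_on_compose2[OF cont]) (auto intro!: continuous_intros)
    then show "continuous_on ({s. 0 < Re s} \<times> cbox 0 (real n)) (\<lambda>(s, x). - ((of_real x)\<^sup>2) * exp (- (s * (of_real x)\<^sup>2)) * \<phi> x)"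
      unfolding case_prod_unfold by (intro continuous_intros) auto
    show "convex {s. 0 < Re s}" by (rule convex_halfspace_Re_gt)
  qed
  show "\<exists>d>0. cball s d \<subseteq> {s. 0 < Re s} \<and>
      uniform_limit (cball s d) (\<lambda>n s. integral (cbox 0 (real n)) (F s)) (gauss_transform \<phi>) sequentially"
    if "s \<in> {s. 0 < Re s}" for s
  proof -
    define r where "r = Re s / 2"
    have r: "r > 0" using that by (simp add: r_def)
    have *: "Re z \<ge> r" if "z \<in> cball s r" for z
    proof -
      have "\<bar>Re (s - z)\<bar> \<le> r" using that abs_Re_le_cmod[of "s - z"] by (auto simp: dist_norm)
      then have "Re s - Re z \<le> r" by simp
      then show ?thesis by (simp add: r_def field_simps)
    qed
    let ?g = "\<lambda>x. B * (exp (- (r * x\<^sup>2)) * x ^ (2 * k))"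
    have gi: "set_integrable lborel {0..} ?g"
      by (rule set_integrable_mult_right[OF set_integrable_gauss_moment[OF r]])
    have dec: "(LBINT x:{0..}. ?g x) = (LBINT x:{0..real n}. ?g x) + (LBINT x:{real n<..}. ?g x)" for n
      using set_integral_Un[of "{0..real n}" "{real n<..}" lborel ?g] 
        set_integrable_subset[OF gi, of "{0..real n}"] set_integrable_subset[OF gi, of "{real n<..}"]
      by (simp add: ivl_disj_un_one(7) ivl_disj_int subset_iff)
    have "(\<lambda>n. LBINT x:{0..real n}. ?g x) \<longlonglongrightarrow> (LBINT x:{0..}. ?g x)"
      by (rule tendsto_set_integral_Icc[OF gi])
    then have "(\<lambda>n. (LBINT x:{0..}. ?g x) - (LBINT x:{0..real n}. ?g x)) \<longlonglongrightarrow> (LBINT x:{0..}. ?g x) - (LBINT x:{0..}. ?g x)"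
      by (intro tendsto_intros)
    moreover have "(LBINT x:{real n<..}. ?g x) = (LBINT x:{0..}. ?g x) - (LBINT x:{0..real n}. ?g x)" for n
      using dec[of n] by linarith
    ultimately have lim: "(\<lambda>n. LBINT x:{real n<..}. ?g x) \<longlonglongrightarrow> 0"
      by (simp only: diff_self)
    have bd: "norm (integral (cbox 0 (real n)) (F z) - gauss_transform \<phi> z) \<le> (LBINT x:{real n<..}. ?g x)"
      if z: "z \<in> cball s r" for n z
    proof -
      have Rz: "Re z > 0" using *[OF z] r by simp
      have Fi: "set_integrable lborel {0..} (F z)"
        unfolding F_def by (rule gauss_transform_integrable[OF meas b Rz])
      then have Fi2: "set_integrable lborel {0..real n} (F z)" "set_integrable lborel {real n<..} (F z)"
        by (auto intro: set_integrable_subset)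
      have "gauss_transform \<phi> z = (LBINT x:{0..real n}. F z x) + (LBINT x:{real n<..}. F z x)"
        using set_integral_Un[of "{0..real n}" "{real n<..}" lborel "F z"] Fi2
        by (simp add: ivl_disj_un_one(7) ivl_disj_int gauss_transform_def F_def)
      moreover have "integral (cbox 0 (real n)) (F z) = (LBINT x:{0..real n}. F z x)"
        using set_borel_integral_eq_integral(2)[OF Fi2(1)] by simp
      ultimately have "norm (integral (cbox 0 (real n)) (F z) - gauss_transform \<phi> z) = norm (LBINT x:{real n<..}. F z x)"
        by simp
      also have "\<dots> \<le> (LBINT x:{real n<..}. norm (F z x))"
        by (rule set_integral_norm_bound[OF Fi2(2)])
      also have "\<dots> \<le> (LBINT x:{real n<..}. ?g x)"
      proof (rule set_integral_mono)
        show "set_integrable lborel {real n<..} (\<lambda>x. norm (F z x))"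
          by (rule set_integrable_norm[OF Fi2(2)])
        show "set_integrable lborel {real n<..} ?g"
          using gi by (rule set_integrable_subset) auto
        fix x assume "x \<in> {real n<..}"
        then have x: "x \<ge> 0" by simp
        have "exp (- (Re z * x\<^sup>2)) * norm (\<phi> x) \<le> exp (- (r * x\<^sup>2)) * (B * x ^ (2 * k))"
          using *[OF z] by (intro mult_mono b x) (auto intro: mult_right_mono)
        then show "norm (F z x) \<le> ?g x"
          unfolding F_def norm_mult norm_exp_gauss by (simp add: mult_ac)
      qed
      finally show ?thesis .
    qed
    have "uniform_limit (cball s r) (\<lambda>n s. integral (cbox 0 (real n)) (F s)) (gauss_transform \<phi>) sequentially"
    proof (rule uniform_limitI)
      fix e :: real assume "e > 0"
      with lim have "\<forall>\<^sub>F n in sequentially. (LBINT x:{real n<..}. ?g x) < e"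
        by (rule order_tendstoD)
      then show "\<forall>\<^sub>F n in sequentially. \<forall>x\<in>cball s r. dist (integral (cbox 0 (real n)) (F x)) (gauss_transform \<phi> x) < e"
      proof eventually_elim
        case (elim n)
        show ?case
          unfolding dist_norm by (intro ballI le_less_trans[OF bd elim])
      qed
    qed
    then show ?thesis using r * by (intro exI[of _ r]) force
  qed
qed

text \<open>For real \<open>s\<close> this is a scaling of the Gaussian moment; both sides are
  holomorphic on the right half-plane, so the identity theorem carries it over.\<close>

lemma gauss_transform_monom:
  assumes "Re s > 0"
  shows "gauss_transform (\<lambda>x. of_real x ^ (2 * k)) s = of_real (gauss_moment k) / (csqrt s * s ^ k)"
proof -
  let ?H = "{s. Re s > 0}"
  have 1: "gauss_transform (\<lambda>x. of_real x ^ (2 * k)) (of_real r) = of_real (gauss_moment k) / (csqrt (of_real r) * of_real r ^ k)"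
    if "r > 0" for r
  proof -
    have "gauss_transform (\<lambda>x. of_real x ^ (2 * k)) (of_real r) = (LBINT x:{0..}. complex_of_real (exp (- (r * x\<^sup>2)) * x ^ (2 * k)))"
      unfolding gauss_transform_def by (simp flip: exp_of_real)
    also have "\<dots> = of_real (LBINT x:{0..}. exp (- (r * x\<^sup>2)) * x ^ (2 * k))"
      by (rule set_integral_complex_of_real)
    finally show ?thesis using that by (simp add: set_integral_gauss_moment csqrt_of_real_nonneg)
  qed
  have hol: "gauss_transform (\<lambda>x. of_real x ^ (2 * k)) holomorphic_on ?H"
    by (rule gauss_transform_holomorphic[where B = 1 and k = k]) (auto intro!: continuous_intros simp: norm_power)
  let ?f = "\<lambda>s. gauss_transform (\<lambda>x. of_real x ^ (2 * k)) s - of_real (gauss_moment k) / (csqrt s * s ^ k)"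
  have "?f s = 0"
  proof (rule analytic_continuation[of ?f ?H "of_real ` {0<..}" 1])
    show "?f holomorphic_on ?H"
      by (intro holomorphic_intros hol) (auto simp: complex_nonpos_Reals_iff)
    have "(1::real) islimpt {0<..}"
      by (rule interior_limit_point) (simp add: interior_open)
    then have "of_real 1 islimpt (of_real ` {0<..} :: complex set)"
      by (rule islimpt_isCont_image) (auto simp: eventually_at_filter)
    then show "1 islimpt (of_real ` {0<..} :: complex set)" by simp
    show "connected ?H" by (intro convex_connected convex_halfspace_Re_gt)
  qed (use assms 1 in \<open>auto simp: open_halfspace_Re_gt\<close>)
  then show ?thesis by simp
qed

section \<open>The Hankel integral\<close>

text \<open>For \<open>|p| = 1\<close> the number \<open>2 exp (-z) p hankel_int (p\<^sup>2) (z p\<^sup>2)\<close> is the integral of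
  \<open>2 exp (- z (1 + \<eta>\<^sup>2)) / sqrt (2 + \<eta>\<^sup>2)\<close> over the ray of direction \<open>p\<close>; for \<open>p = 1\<close> it is \<open>K\<^sub>0(z)\<close>.\<close>
definition hankel_int :: "complex \<Rightarrow> complex \<Rightarrow> complex" where
  "hankel_int c = gauss_transform (\<lambda>x. 1 / csqrt (2 + c * (of_real x)\<^sup>2))"

text \<open>For \<open>|c| = 1\<close> this is the absolute value of \<open>cos (arg c / 2)\<close>,
  the best constant in \<open>norm_ray_ge\<close>, with equality at \<open>y = 2\<close>.\<close>

definition ray_const :: "complex \<Rightarrow> real" where
  "ray_const c = sqrt ((1 + Re c) / 2)"

lemma ray_const_pos: "Re c > -1 \<Longrightarrow> ray_const c > 0"
  by (simp add: ray_const_def)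

lemma norm_ray_ge:
  assumes c: "norm c = 1" and y: "y \<ge> 0"
  shows "ray_const c * (2 + y) \<le> norm (2 + c * of_real y)"
proof -
  have cc: "(Re c)\<^sup>2 + (Im c)\<^sup>2 = 1" using c by (simp add: cmod_def)
  have bds: "\<bar>Re c\<bar> \<le> 1" using abs_Re_le_cmod[of c] c by simp
  \<comment> \<open>With \<open>k = (1 + Re c) / 2\<close> the two squares to be compared are
    \<open>k (2 - y)^2 + 8 k y\<close> and \<open>(2 - y)^2 + 8 k y\<close>, and
    \<open>k \<le> 1\<close>.\<close>
  have "(ray_const c * (2 + y))\<^sup>2 = (1 + Re c) / 2 * (2 - y)\<^sup>2 + 4 * y * (1 + Re c)"
    using bds by (simp add: ray_const_def power_mult_distrib) (simp add: power2_eq_square field_simps)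
  also have "\<dots> \<le> 1 * (2 - y)\<^sup>2 + 4 * y * (1 + Re c)"
    using bds y by (intro add_mono mult_right_mono) auto
  also have "\<dots> = 4 + 4 * y * Re c + y\<^sup>2 * ((Re c)\<^sup>2 + (Im c)\<^sup>2)"
    unfolding cc by (simp add: power2_eq_square algebra_simps)
  also have "\<dots> = (norm (2 + c * of_real y))\<^sup>2"
    unfolding cmod_power2 by (simp add: power2_eq_square algebra_simps)
  finally show ?thesis by (rule power2_le_imp_le) simp
qed

lemma ray_notin_nonpos_Reals:
  assumes c: "norm c = 1" "Re c > -1" and y: "y \<ge> 0"
  shows "2 + c * of_real y \<notin> \<real>\<^sub>\<le>\<^sub>0"
proof
  assume a: "2 + c * of_real y \<in> \<real>\<^sub>\<le>\<^sub>0"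
  then have "Im c * y = 0" "2 + Re c * y \<le> 0" by (auto simp: complex_nonpos_Reals_iff)
  then have "Re c < 0" using y by (smt (verit) mult_nonneg_nonneg)
  moreover have "Im c = 0" using \<open>Im c * y = 0\<close> \<open>2 + Re c * y \<le> 0\<close> by auto
  ultimately show False using c by (auto simp: cmod_def)
qed

lemma hankel_kernel_continuous:
  assumes "norm c = 1" "Re c > -1"
  shows "continuous_on {0..} (\<lambda>x. 1 / csqrt (2 + c * (of_real x)\<^sup>2))"
proof -
  have 1: "2 + c * (of_real x)\<^sup>2 \<notin> \<real>\<^sub>\<le>\<^sub>0" for x :: real
    using ray_notin_nonpos_Reals[OF assms, of "x\<^sup>2"] by simp
  then have "2 + c * (of_real x)\<^sup>2 \<noteq> 0" for x :: real
    by (metis nonpos_Reals_zero_I)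
  then have "csqrt (2 + c * (of_real x)\<^sup>2) \<noteq> 0" for x :: real by simp
  moreover have "continuous_on {0..} (\<lambda>x. csqrt (2 + c * (of_real x)\<^sup>2))"
    by (rule continuous_on_compose2[OF continuous_on_csqrt]) (use 1 in \<open>auto intro!: continuous_intros\<close>)
  ultimately show ?thesis by (intro continuous_intros) auto
qed

lemma hankel_kernel_measurable:
  assumes "norm c = 1" "Re c > -1"
  shows "set_borel_measurable lborel {0..} (\<lambda>x. 1 / csqrt (2 + c * (of_real x)\<^sup>2))"
  using borel_measurable_continuous_on_indicator[OF _ hankel_kernel_continuous[OF assms]]
  by (simp add: set_borel_measurable_def)

lemma norm_csqrt: "norm (csqrt z) = sqrt (norm z)"
  by (metis norm_power power2_csqrt real_sqrt_unique norm_ge_zero)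

lemma hankel_kernel_bound:
  assumes "norm c = 1" "Re c > -1"
  shows "norm (1 / csqrt (2 + c * (of_real x)\<^sup>2)) \<le> 1 / sqrt (ray_const c) * (1 / sqrt (2 + x\<^sup>2))"
proof -
  have p: "0 < ray_const c * (2 + x\<^sup>2)"
    by (intro mult_pos_pos ray_const_pos assms add_pos_nonneg) auto
  have "norm (1 / csqrt (2 + c * (of_real x)\<^sup>2)) = 1 / sqrt (norm (2 + c * (of_real x)\<^sup>2))"
    by (simp add: norm_divide norm_csqrt)
  also have "\<dots> \<le> 1 / sqrt (ray_const c * (2 + x\<^sup>2))"
    using norm_ray_ge[OF assms(1), of "x\<^sup>2"] p
    by (intro divide_left_mono mult_pos_pos) (auto intro: less_le_trans)
  finally show ?thesis by (simp add: real_sqrt_mult)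
qed

text \<open>The factor \<open>x ^ (2 * 0)\<close> puts the bound into the form required by the
  lemmas on \<open>gauss_transform\<close>.\<close>

lemma hankel_kernel_bounded:
  assumes "norm c = 1" "Re c > -1"
  shows "norm (1 / csqrt (2 + c * (of_real x)\<^sup>2)) \<le> 1 / sqrt (ray_const c) * x ^ (2 * 0)"
proof -
  have "1 \<le> sqrt (2 + x\<^sup>2)"
    by (rule real_le_rsqrt) (use zero_le_power2[of x] in simp)
  then have "1 / sqrt (2 + x\<^sup>2) \<le> 1 / 1" by (intro frac_le) auto
  then have "1 / sqrt (ray_const c) * (1 / sqrt (2 + x\<^sup>2)) \<le> 1 / sqrt (ray_const c) * 1"
    using ray_const_pos[OF assms(2)] by (intro mult_left_mono) auto
  with hankel_kernel_bound[OF assms, of x] show ?thesis by simp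
qed

lemma hankel_int_holomorphic:
  assumes "norm c = 1" "Re c > -1"
  shows "hankel_int c holomorphic_on {s. Re s > 0}"
  unfolding hankel_int_def
  by (rule gauss_transform_holomorphic[OF hankel_kernel_continuous[OF assms] hankel_kernel_bounded[OF assms]])

lemma hankel_int_integrable:
  assumes "norm c = 1" "Re c > -1" "Re s > 0"
  shows "set_integrable lborel {0..} (\<lambda>x. exp (- (s * (of_real x)\<^sup>2)) * (1 / csqrt (2 + c * (of_real x)\<^sup>2)))"
  by (rule gauss_transform_integrable[OF hankel_kernel_measurable hankel_kernel_bounded]) (use assms in auto)

text \<open>The integral is at most \<open>T + O(r\<^bsup>-1/2\<^esup> / T)\<close> for every cut-off \<open>T\<close>; take \<open>T = r\<^bsup>-1/4\<^esup>\<close>.\<close>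
lemma hankel_int_bound_small:
  assumes c: "norm c = 1" "Re c > -1"
  shows "\<exists>C. \<forall>s. Re s > 0 \<longrightarrow> norm (hankel_int c s) \<le> C / sqrt (sqrt (Re s))"
proof (intro exI allI impI)
  fix s assume r: "Re s > 0"
  define r T where "r = Re s" and "T = 1 / sqrt (sqrt r)"
  have pos: "r > 0" "T > 0" using r by (auto simp: r_def T_def)
  define B where "B = 1 / sqrt (ray_const c)"
  have B: "B > 0" using ray_const_pos[OF c(2)] by (simp add: B_def)
  let ?F = "\<lambda>x. exp (- (s * (of_real x)\<^sup>2)) * (1 / csqrt (2 + c * (of_real x)\<^sup>2))"
  let ?g = "\<lambda>x. B * indicator {0..T} x + B / T * (exp (- (r * x\<^sup>2)) * x ^ (2 * 0))"
  have int1: "set_integrable lborel {0..} (\<lambda>x. B * indicator {0..T} x :: real)"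
    unfolding set_integrable_def
  proof (rule Bochner_Integration.integrable_bound)
    show "integrable lborel (\<lambda>x. B * indicator {0..T} x :: real)"
      by (intro integrable_mult_right integrable_real_indicator) (auto simp: emeasure_lborel_Icc_eq)
  qed (auto simp: abs_mult indicator_def)
  have int2: "set_integrable lborel {0..} (\<lambda>x. B / T * (exp (- (r * x\<^sup>2)) * x ^ (2 * 0)))"
    by (rule set_integrable_mult_right[OF set_integrable_gauss_moment[OF pos(1)]])
  have "norm (hankel_int c s) \<le> (LBINT x:{0..}. norm (?F x))"
    unfolding hankel_int_def gauss_transform_def
    by (rule set_integral_norm_bound[OF hankel_int_integrable[OF c r]])
  also have "\<dots> \<le> (LBINT x:{0..}. ?g x)"
  proof (rule set_integral_mono)
    show "set_integrable lborel {0..} (\<lambda>x. norm (?F x))"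
      by (rule set_integrable_norm[OF hankel_int_integrable[OF c r]])
    show "set_integrable lborel {0..} ?g"
      by (rule set_integral_add(1)[OF int1 int2])
    fix x :: real assume x: "x \<in> {0..}"
    have "norm (?F x) \<le> exp (- (r * x\<^sup>2)) * (B * (1 / sqrt (2 + x\<^sup>2)))"
      unfolding norm_mult norm_exp_gauss r_def B_def
      by (intro mult_left_mono hankel_kernel_bound c) auto
    also have "\<dots> \<le> ?g x"
    proof (cases "x \<le> T")
      case True
      have "1 \<le> sqrt (2 + x\<^sup>2)"
        by (rule real_le_rsqrt) (use zero_le_power2[of x] in simp)
      then have "1 / sqrt (2 + x\<^sup>2) \<le> 1 / 1" by (intro frac_le) auto
      then have "exp (- (r * x\<^sup>2)) * (B * (1 / sqrt (2 + x\<^sup>2))) \<le> 1 * (B * 1)"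
        using pos B by (intro mult_mono) auto
      then show ?thesis using True x pos B by (simp add: indicator_def add_increasing2)
    next
      case False
      have "T \<le> sqrt (2 + x\<^sup>2)"
        using False x by (intro real_le_rsqrt) (smt (verit) pos(2) power_mono)
      then have "1 / sqrt (2 + x\<^sup>2) \<le> 1 / T"
        using pos by (intro divide_left_mono mult_pos_pos) (auto intro: add_pos_nonneg)
      then have "exp (- (r * x\<^sup>2)) * (B * (1 / sqrt (2 + x\<^sup>2))) \<le> exp (- (r * x\<^sup>2)) * (B * (1 / T))"
        using B by (intro mult_left_mono) auto
      then show ?thesis using False by (simp add: mult_ac)
    qed
    finally show "norm (?F x) \<le> ?g x" .
  qed
  also have "\<dots> = (LBINT x:{0..}. B * indicator {0..T} x) + (LBINT x:{0..}. B / T * (exp (- (r * x\<^sup>2)) * x ^ (2 * 0)))"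
    by (rule set_integral_add(2)[OF int1 int2])
  also have "(LBINT x:{0..}. B * indicator {0..T} x) = B * T"
  proof -
    have "(LBINT x:{0..}. B * indicator {0..T} x) = (LBINT x. B * indicator {0..T} x)"
      unfolding set_lebesgue_integral_def by (intro Bochner_Integration.integral_cong) (auto simp: indicator_def)
    then show ?thesis using pos by simp
  qed
  also have "(LBINT x:{0..}. B / T * (exp (- (r * x\<^sup>2)) * x ^ (2 * 0))) = B / T * (gauss_moment 0 / sqrt r)"
    using set_integral_gauss_moment[OF pos(1), of 0] by simp
  also have "B * T + B / T * (gauss_moment 0 / sqrt r) = (B * (1 + gauss_moment 0)) / sqrt (sqrt r)"
    using pos unfolding T_def by (simp add: field_simps flip: real_sqrt_mult)
  finally show "norm (hankel_int c s) \<le> (1 / sqrt (ray_const c) * (1 + gauss_moment 0)) / sqrt (sqrt (Re s))"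
    by (simp add: B_def r_def)
qed

section \<open>Watson's lemma for the Hankel integral\<close>

text \<open>The \<open>j\<close>-th derivative of \<open>1 / sqrt (2 + z)\<close>.\<close>
definition csqrt_deriv :: "nat \<Rightarrow> complex \<Rightarrow> complex" where
  "csqrt_deriv j z = (-1) ^ j * fact (2 * j) / (4 ^ j * fact j) / (csqrt (2 + z) * (2 + z) ^ j)"

lemma has_field_derivative_csqrt_deriv:
  assumes z: "2 + z \<notin> \<real>\<^sub>\<le>\<^sub>0"
  shows "(csqrt_deriv j has_field_derivative csqrt_deriv (Suc j) z) (at z within S)"
proof -
  have nz: "2 + z \<noteq> 0" using z by (metis nonpos_Reals_zero_I)
  define w v where "w = 2 + z" and "v = csqrt w"
  have v: "v \<noteq> 0" "w = v\<^sup>2" "w \<noteq> 0" using nz by (auto simp: v_def w_def)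
  \<comment> \<open>\<open>q\<close> is the product \<open>(-1/2) (-3/2) ... (-(j - 1/2))\<close>,
    so passing to \<open>Suc j\<close> multiplies it by \<open>-(j + 1/2)\<close>.\<close>
  define q :: complex where "q = (-1) ^ j * fact (2 * j) / (4 ^ j * fact j)"
  have q: "(-1) ^ Suc j * fact (2 * Suc j) / (4 ^ Suc j * fact (Suc j)) = - (of_nat j + 1 / 2) * q"
  proof -
    have "(of_nat j + 1 :: complex) \<noteq> 0" by (metis of_nat_Suc of_nat_eq_0_iff nat.distinct(1) add.commute)
    moreover have "(of_nat (4 + j * 4) :: complex) \<noteq> 0" by (simp only: of_nat_eq_0_iff)
    ultimately show ?thesis unfolding fact_double_Suc fact_Suc q_def
      by (simp add: divide_simps) (simp add: algebra_simps)
  qed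
  have "((\<lambda>z. q / (csqrt (2 + z) * (2 + z) ^ j)) has_field_derivative
      - (q * (1 / (2 * v) * w ^ j + v * (of_nat j * w ^ (j - 1)))) / (v * w ^ j * (v * w ^ j))) (at z within S)"
    using z v unfolding v_def w_def
    by (auto intro!: derivative_eq_intros simp: field_simps)
  also have "- (q * (1 / (2 * v) * w ^ j + v * (of_nat j * w ^ (j - 1)))) / (v * w ^ j * (v * w ^ j))
      = - (of_nat j + 1 / 2) * q / (v * w ^ Suc j)"
  proof -
    have "1 / (2 * v) * w ^ j + v * (of_nat j * w ^ (j - 1)) = (of_nat j + 1 / 2) * w ^ j / v"
      using v(1,3) by (cases j) (simp_all add: divide_simps v(2), simp add: algebra_simps power2_eq_square)
    then show ?thesis using v(1,3)
      by (simp add: divide_simps) (simp add: v(2) algebra_simps power2_eq_square)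
  qed
  finally show ?thesis
    unfolding csqrt_deriv_def q_def[symmetric] q v_def w_def .
qed

text \<open>Taylor's formula for \<open>1 / sqrt (2 + z)\<close> along the ray
  \<open>z = c y\<close> with \<open>y = x^2\<close>. On that ray \<open>norm (2 + z)\<close> is at
  least \<open>2 * ray_const c\<close>, which bounds the derivative in the remainder
  uniformly.\<close>

lemma hankel_kernel_expansion:
  assumes c: "norm c = 1" "Re c > -1"
  shows "\<exists>B. \<forall>x. norm (1 / csqrt (2 + c * (of_real x)\<^sup>2) -
    (\<Sum>j\<le>n. csqrt_deriv j 0 * c ^ j / fact j * of_real x ^ (2 * j))) \<le> B * x ^ (2 * Suc n)"
proof -
  define S where "S = (\<lambda>y. c * of_real y) ` {0..}"
  define B where "B = norm ((-1) ^ Suc n * fact (2 * Suc n) / (4 ^ Suc n * fact (Suc n)) :: complex) /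
    (sqrt (ray_const c * 2) * (ray_const c * 2) ^ Suc n)"
  have r: "ray_const c > 0" by (rule ray_const_pos[OF c(2)])
  have S: "convex S" unfolding S_def
    by (rule convex_linear_image) (auto intro!: linearI simp: algebra_simps scaleR_conv_of_real)
  have "norm (csqrt_deriv 0 (c * of_real y) - (\<Sum>j\<le>n. csqrt_deriv j 0 * (c * of_real y - 0) ^ j / fact j))
     \<le> B * norm (c * of_real y - 0) ^ Suc n / fact n" if y: "y \<ge> 0" for y
  proof (rule complex_Taylor[OF S])
    fix i z assume "z \<in> S"
    then obtain u where u: "u \<ge> 0" "z = c * of_real u" by (auto simp: S_def)
    show "(csqrt_deriv i has_field_derivative csqrt_deriv (Suc i) z) (at z within S)"
      unfolding u by (intro has_field_derivative_csqrt_deriv ray_notin_nonpos_Reals c u)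
  next
    fix z assume "z \<in> S"
    then obtain u where u: "u \<ge> 0" "z = c * of_real u" by (auto simp: S_def)
    have "ray_const c * 2 \<le> ray_const c * (2 + u)" using r u by (intro mult_left_mono) auto
    also have "\<dots> \<le> norm (2 + z)" unfolding u by (rule norm_ray_ge[OF c(1) u(1)])
    finally have le: "sqrt (ray_const c * 2) * (ray_const c * 2) ^ Suc n \<le> sqrt (norm (2 + z)) * norm (2 + z) ^ Suc n"
      using r by (intro mult_mono power_mono) auto
    have p: "0 < sqrt (ray_const c * 2) * (ray_const c * 2) ^ Suc n"
      using r by simp
    have eq: "norm (csqrt_deriv (Suc n) z) = norm ((-1) ^ Suc n * fact (2 * Suc n) / (4 ^ Suc n * fact (Suc n)) :: complex) /
       (sqrt (norm (2 + z)) * norm (2 + z) ^ Suc n)"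
      by (simp only: csqrt_deriv_def norm_divide norm_mult norm_csqrt norm_power)
    show "norm (csqrt_deriv (Suc n) z) \<le> B"
      unfolding B_def eq by (rule divide_left_mono[OF le norm_ge_zero mult_pos_pos[OF less_le_trans[OF p le] p]])
  next
    show "0 \<in> S" by (auto simp: S_def intro!: image_eqI[of _ _ 0])
    show "c * of_real y \<in> S" using y by (auto simp: S_def)
  qed
  note T = this
  have "norm (1 / csqrt (2 + c * (of_real x)\<^sup>2) -
    (\<Sum>j\<le>n. csqrt_deriv j 0 * c ^ j / fact j * of_real x ^ (2 * j))) \<le> (B / fact n) * x ^ (2 * Suc n)" for x
  proof -
    have 1: "csqrt_deriv 0 (c * of_real (x\<^sup>2)) = 1 / csqrt (2 + c * (of_real x)\<^sup>2)"
      by (simp add: csqrt_deriv_def)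
    have 2: "csqrt_deriv j 0 * (c * of_real (x\<^sup>2) - 0) ^ j / fact j = csqrt_deriv j 0 * c ^ j / fact j * of_real x ^ (2 * j)" for j
      by (simp add: power_mult_distrib power_mult)
    have 3: "norm (c * of_real (x\<^sup>2) - 0) ^ Suc n = x ^ (2 * Suc n)"
      unfolding diff_zero norm_mult c(1) norm_of_real power_mult by simp
    show ?thesis
      using T[of "x\<^sup>2"] unfolding 1 2 3 by simp
  qed
  then show ?thesis by blast
qed

text \<open>Integrating the Taylor polynomial of the kernel termwise gives the explicit sum. The
  remainder, of order \<open>x ^ (2 * Suc n)\<close>, integrates to a Gaussian moment, hence the
  extra power \<open>Re s ^ Suc n\<close>.\<close>

lemma hankel_int_expansion:
  assumes c: "norm c = 1" "Re c > -1"
  shows "\<exists>B. \<forall>s. Re s > 0 \<longrightarrow> norm (hankel_int c s -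
    of_real (sqrt pi / 2 / sqrt 2) / csqrt s * (\<Sum>j\<le>n. (-1) ^ j * hankel_coeff j * (c / s) ^ j))
     \<le> B / (sqrt (Re s) * Re s ^ Suc n)"
proof -
  define a where "a j = csqrt_deriv j 0 * c ^ j / fact j" for j
  define \<phi> where "\<phi> = (\<lambda>x. 1 / csqrt (2 + c * (complex_of_real x)\<^sup>2))"
  define \<psi> where "\<psi> = (\<lambda>x. \<Sum>j\<le>n. a j * complex_of_real x ^ (2 * j))"
  obtain B where B: "\<And>x. norm (\<phi> x - \<psi> x) \<le> B * x ^ (2 * Suc n)"
    using hankel_kernel_expansion[OF c, of n] unfolding a_def \<phi>_def \<psi>_def by blast
  have cont: "continuous_on {0..} (\<lambda>x. \<phi> x - \<psi> x)"
    unfolding \<phi>_def \<psi>_def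
    by (intro continuous_on_diff hankel_kernel_continuous[OF c] continuous_on_sum) (intro continuous_intros)
  have meas: "set_borel_measurable lborel {0..} (\<lambda>x. \<phi> x - \<psi> x)"
    using borel_measurable_continuous_on_indicator[OF _ cont] by (simp add: set_borel_measurable_def)
  have "norm (hankel_int c s -
    of_real (sqrt pi / 2 / sqrt 2) / csqrt s * (\<Sum>j\<le>n. (-1) ^ j * hankel_coeff j * (c / s) ^ j))
     \<le> (B * gauss_moment (Suc n)) / (sqrt (Re s) * Re s ^ Suc n)" if s: "Re s > 0" for s
  proof -
    have i: "set_integrable lborel {0..} (\<lambda>x. exp (- (s * (of_real x)\<^sup>2)) * of_real x ^ (2 * j))" for j
    proof (rule gauss_transform_integrable[where B = 1 and k = j])
      show "set_borel_measurable lborel {0..} (\<lambda>x. complex_of_real x ^ (2 * j))"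
        unfolding set_borel_measurable_def by measurable
    qed (use s in \<open>auto simp: norm_power\<close>)
    then have i': "set_integrable lborel {0..} (\<lambda>x. a j * (exp (- (s * (of_real x)\<^sup>2)) * of_real x ^ (2 * j)))" for j
      by (intro set_integrable_mult_right)
    have e: "exp (- (s * (of_real x)\<^sup>2)) * \<psi> x = (\<Sum>j\<le>n. a j * (exp (- (s * (of_real x)\<^sup>2)) * of_real x ^ (2 * j)))" for x
      unfolding \<psi>_def sum_distrib_left by (simp add: mult_ac)
    have "set_integrable lborel {0..} (\<lambda>x. exp (- (s * (of_real x)\<^sup>2)) * \<psi> x)"
      unfolding e using i' unfolding set_integrable_def scaleR_sum_right by (intro Bochner_Integration.integrable_sum) auto
    moreover have "set_integrable lborel {0..} (\<lambda>x. exp (- (s * (of_real x)\<^sup>2)) * \<phi> x)"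
      unfolding \<phi>_def by (rule hankel_int_integrable[OF c s])
    ultimately have "gauss_transform (\<lambda>x. \<phi> x - \<psi> x) s = gauss_transform \<phi> s - gauss_transform \<psi> s"
      unfolding gauss_transform_def right_diff_distrib by (intro set_integral_diff(2))
    moreover have "gauss_transform \<psi> s = (\<Sum>j\<le>n. a j * gauss_transform (\<lambda>x. of_real x ^ (2 * j)) s)"
    proof -
      have "gauss_transform \<psi> s = (\<Sum>j\<le>n. LBINT x:{0..}. a j * (exp (- (s * (of_real x)\<^sup>2)) * of_real x ^ (2 * j)))"
        unfolding gauss_transform_def e set_lebesgue_integral_def scaleR_sum_right
        by (rule Bochner_Integration.integral_sum) (use i' in \<open>simp add: set_integrable_def\<close>)
      then show ?thesis unfolding gauss_transform_def by (simp only: set_integral_mult_right)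
    qed
    moreover have "a j * gauss_transform (\<lambda>x. of_real x ^ (2 * j)) s = 
        of_real (sqrt pi / 2 / sqrt 2) / csqrt s * ((-1) ^ j * hankel_coeff j * (c / s) ^ j)" for j
    proof -
      \<comment> \<open>The \<open>32 ^ j\<close> in \<open>hankel_coeff\<close> is composed of
        \<open>2 ^ j\<close> from \<open>(2 + z) ^ j\<close> at 0, one \<open>4 ^ j\<close> from the
        Taylor coefficient and one from the Gaussian moment. \<open>gen\<close> is the comparison
        with all these quantities treated as opaque symbols.\<close>
      have p32: "(32 :: complex) ^ j = 2 ^ j * 4 ^ j * 4 ^ j" by (simp flip: power_mult_distrib)
      have s2: "csqrt 2 = of_real (sqrt 2)" using csqrt_of_real_nonneg[of 2] by simp
      have gm: "of_real (gauss_moment j) = of_real (sqrt pi) / 2 * ((fact (2 * j) :: complex) / (4 ^ j * fact j))"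
        by (simp add: gauss_moment_def)
      have sp: "(of_real (sqrt pi / 2 / sqrt 2) :: complex) = of_real (sqrt pi) / 2 / of_real (sqrt 2)" by simp
      have gen: "E * F / (P4 * h) / (r2 * P2) * d / h * (rp / 2 * (F / (P4 * h)) / (v * w)) =
          rp / 2 / r2 / v * (E * (F\<^sup>2 / (P2 * P4 * P4 * h ^ 3)) * (d / w))" for E F P4 h r2 P2 d rp v w :: complex
        by (simp add: power2_eq_square power3_eq_cube mult_ac)
      show ?thesis
        unfolding gauss_transform_monom[OF s] a_def csqrt_deriv_def s2 hankel_coeff_def p32 gm sp power_divide add_0_right
        by (rule gen)
    qed
    ultimately have "hankel_int c s - of_real (sqrt pi / 2 / sqrt 2) / csqrt s * (\<Sum>j\<le>n. (-1) ^ j * hankel_coeff j * (c / s) ^ j)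
       = gauss_transform (\<lambda>x. \<phi> x - \<psi> x) s"
      unfolding hankel_int_def \<phi>_def sum_distrib_left by simp
    then show ?thesis using gauss_transform_bound[OF meas B s] by simp
  qed
  then show ?thesis by blast
qed

section \<open>Rotation of the ray of integration\<close>

lemma unit_square_Re_gt:
  assumes "norm p = 1" "Re p > 0"
  shows "norm (p\<^sup>2) = 1" "Re (p\<^sup>2) > -1"
proof -
  have "(Re p)\<^sup>2 + (Im p)\<^sup>2 = 1" using assms by (simp add: cmod_def)
  moreover have "(Re p)\<^sup>2 > 0" using assms by simp
  ultimately show "Re (p\<^sup>2) > -1" by (simp add: power2_eq_square)
qed (use assms in \<open>simp add: norm_power\<close>)

lemma hankel_kernel_halfplane:
  assumes "Re \<eta> > 0 \<or> \<eta> = 0"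
  shows "2 + \<eta>\<^sup>2 \<notin> \<real>\<^sub>\<le>\<^sub>0"
proof
  assume "2 + \<eta>\<^sup>2 \<in> \<real>\<^sub>\<le>\<^sub>0"
  then have *: "2 + ((Re \<eta>)\<^sup>2 - (Im \<eta>)\<^sup>2) \<le> 0" "Re \<eta> * Im \<eta> = 0"
    by (auto simp: complex_nonpos_Reals_iff power2_eq_square)
  then have "Im \<eta> = 0" using assms by auto
  then show False using * zero_le_power2[of "Re \<eta>"] by simp
qed

text \<open>Both factors of \<open>2 + \<eta>^2\<close>, with zeros at the branch points
  \<open>\<plusminus> \<i> sqrt 2\<close>, have real part \<open>Re \<eta>\<close>.\<close>

lemma norm_hankel_kernel_halfplane:
  assumes "Re \<eta> > 0"
  shows "norm (1 / csqrt (2 + \<eta>\<^sup>2)) \<le> 1 / Re \<eta>"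
proof -
  have "2 + \<eta>\<^sup>2 = (\<eta> - \<i> * of_real (sqrt 2)) * (\<eta> + \<i> * of_real (sqrt 2))"
    by (simp add: algebra_simps power2_eq_square flip: of_real_mult)
  then have "norm (2 + \<eta>\<^sup>2) = norm (\<eta> - \<i> * of_real (sqrt 2)) * norm (\<eta> + \<i> * of_real (sqrt 2))"
    by (simp only: norm_mult)
  also have "\<dots> \<ge> Re \<eta> * Re \<eta>"
    using assms complex_Re_le_cmod[of "\<eta> - \<i> * of_real (sqrt 2)"] complex_Re_le_cmod[of "\<eta> + \<i> * of_real (sqrt 2)"]
    by (intro mult_mono) auto
  finally have "Re \<eta> \<le> sqrt (norm (2 + \<eta>\<^sup>2))"
    by (intro real_le_rsqrt) (simp add: power2_eq_square)
  then show ?thesis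
    using assms by (simp add: norm_divide norm_csqrt frac_le)
qed

text \<open>Decay of the Gaussian on the chord between the two rays. In the expanded square the
  mixed term is nonnegative by the assumption on \<open>z * p * q\<close>, and
  \<open>(1 - u)^2 + u^2 \<ge> 1/2\<close>.\<close>

lemma Gauss_chord_ge:
  assumes "0 \<le> u" "u \<le> 1" "m \<le> Re (z * p\<^sup>2)" "m \<le> Re (z * q\<^sup>2)" "Re (z * p * q) \<ge> 0" "m \<ge> 0"
  shows "Re (z * ((1 - of_real u) * p + of_real u * q)\<^sup>2) \<ge> m / 2"
proof -
  have "z * ((1 - of_real u) * p + of_real u * q)\<^sup>2
      = of_real ((1 - u)\<^sup>2) * (z * p\<^sup>2) + of_real (u\<^sup>2) * (z * q\<^sup>2) + of_real (2 * u * (1 - u)) * (z * p * q)"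
    by (simp add: power2_eq_square algebra_simps)
  then have "Re (z * ((1 - of_real u) * p + of_real u * q)\<^sup>2)
      = (1 - u)\<^sup>2 * Re (z * p\<^sup>2) + u\<^sup>2 * Re (z * q\<^sup>2) + (2 * u * (1 - u)) * Re (z * p * q)"
    by (simp only: plus_complex.sel Re_complex_of_real Im_complex_of_real times_complex.sel)
  also have "\<dots> \<ge> (1 - u)\<^sup>2 * m + u\<^sup>2 * m + 0"
    using assms by (intro add_mono mult_left_mono mult_nonneg_nonneg) auto
  finally have "Re (z * ((1 - of_real u) * p + of_real u * q)\<^sup>2) \<ge> ((1 - u)\<^sup>2 + u\<^sup>2) * m"
    by (simp add: algebra_simps)
  moreover have "(1 - u)\<^sup>2 + u\<^sup>2 \<ge> 1 / 2"
    using zero_le_power2[of "u - 1 / 2"] by (simp add: power2_eq_square algebra_simps)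
  then have "((1 - u)\<^sup>2 + u\<^sup>2) * m \<ge> 1 / 2 * m"
    using assms by (intro mult_right_mono) auto
  ultimately show ?thesis by simp
qed

text \<open>Both sides are integrals of the same function of \<open>\<eta> = x p\<close> or
  \<open>\<eta> = x q\<close>. A primitive \<open>G\<close> turns them into limits of
  \<open>G (R p) - G 0\<close> and \<open>G (R q) - G 0\<close>, and the chord from
  \<open>R p\<close> to \<open>R q\<close> contributes a vanishing difference.\<close>

lemma hankel_int_rotate:
  assumes p: "norm p = 1" "Re p > 0" "Re (z * p\<^sup>2) > 0"
    and q: "norm q = 1" "Re q > 0" "Re (z * q\<^sup>2) > 0"
    and pq: "Re (z * p * q) \<ge> 0"
  shows "p * hankel_int (p\<^sup>2) (z * p\<^sup>2) = q * hankel_int (q\<^sup>2) (z * q\<^sup>2)"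
proof -
  \<comment> \<open>The rays start at 0, a boundary point of the half-plane. Adding just this point
    keeps the set convex and away from the branch points, and the derivative of \<open>G\<close> is
    taken within \<open>S\<close>.\<close>
  define S where "S = insert 0 {\<eta>. Re \<eta> > 0}"
  define g where "g = (\<lambda>\<eta>. exp (- (z * \<eta>\<^sup>2)) * (1 / csqrt (2 + \<eta>\<^sup>2)))"
  have nS: "2 + \<eta>\<^sup>2 \<notin> \<real>\<^sub>\<le>\<^sub>0" if "\<eta> \<in> S" for \<eta>
    using that by (intro hankel_kernel_halfplane) (auto simp: S_def)
  then have nS': "2 + \<eta>\<^sup>2 \<noteq> 0" if "\<eta> \<in> S" for \<eta>
    using that by (metis nonpos_Reals_zero_I)
  have hol: "g holomorphic_on S"
    unfolding g_def using nS nS' by (intro holomorphic_intros) auto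
  have cont: "continuous_on S g"
    by (rule holomorphic_on_imp_continuous_on[OF hol])
  have "convex S"
  proof (rule convexI)
    fix x y :: complex and u v :: real assume *: "x \<in> S" "y \<in> S" "0 \<le> u" "0 \<le> v" "u + v = 1"
    have "Re x \<ge> 0" "Re y \<ge> 0" using * by (auto simp: S_def)
    then have Re: "u * Re x \<ge> 0" "v * Re y \<ge> 0" using * by auto
    show "u *\<^sub>R x + v *\<^sub>R y \<in> S"
    proof (cases "u * Re x > 0 \<or> v * Re y > 0")
      case True
      then show ?thesis using Re by (auto simp: S_def)
    next
      case False
      then have "u * Re x = 0" "v * Re y = 0" using Re by auto
      then have "u *\<^sub>R x = 0" "v *\<^sub>R y = 0" using *(1,2) by (auto simp: S_def)
      then show ?thesis by (simp only: S_def add_0_left insertI1)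
    qed
  qed
  obtain G where G: "\<And>\<eta>. \<eta> \<in> S \<Longrightarrow> (G has_field_derivative g \<eta>) (at \<eta> within S)"
  proof (rule holomorphic_convex_primitive[OF \<open>convex S\<close> finite.emptyI cont])
    show "g field_differentiable at x" if "x \<in> interior S - {}" for x
      using that holomorphic_on_subset[OF hol interior_subset]
      by (auto intro: holomorphic_on_imp_differentiable_at[OF _ open_interior])
  qed blast
  have ray: "(\<lambda>n. G (of_real (real n) * w) - G 0) \<longlonglongrightarrow> w * hankel_int (w\<^sup>2) (z * w\<^sup>2)"
    if w: "norm w = 1" "Re w > 0" "Re (z * w\<^sup>2) > 0" for w
  proof -
    let ?f = "\<lambda>x. exp (- ((z * w\<^sup>2) * (of_real x)\<^sup>2)) * (1 / csqrt (2 + w\<^sup>2 * (of_real x)\<^sup>2))"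
    have fg: "?f x = g (of_real x * w)" for x
      by (simp add: g_def power_mult_distrib mult_ac)
    have int: "set_integrable lborel {0..} ?f"
      using unit_square_Re_gt[OF w(1,2)] w(3) by (intro hankel_int_integrable)
    have inS: "of_real x * w \<in> S" if "x \<ge> 0" for x
      using that w(2) by (cases "x = 0") (auto simp: S_def)
    have "(LBINT x:{0..real n}. w * ?f x) = G (of_real (real n) * w) - G (of_real 0 * w)" for n
      unfolding set_lebesgue_integral_def
    proof (rule integral_FTC_Icc)
      fix x assume x: "0 \<le> x" "x \<le> real n"
      have "((\<lambda>x. of_real x * w) has_vector_derivative w) (at x within {0..real n})"
        by (auto intro!: derivative_eq_intros)
      moreover have "(G has_field_derivative g (of_real x * w)) (at (of_real x * w) within (\<lambda>x. of_real x * w) ` {0..real n})"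
        by (rule has_field_derivative_subset[OF G]) (use x in \<open>auto intro: inS\<close>)
      ultimately show "((\<lambda>x. G (of_real x * w)) has_vector_derivative w * ?f x) (at x within {0..real n})"
        unfolding fg using field_vector_diff_chain_within[of "\<lambda>x. of_real x * w" w x _ G] by (simp add: o_def)
    next
      have "continuous_on {0..real n} (\<lambda>x. g (of_real x * w))"
        by (rule continuous_on_compose2[OF cont]) (auto intro!: continuous_intros inS)
      then show "continuous_on {0..real n} (\<lambda>x. w * ?f x)"
        unfolding fg by (intro continuous_intros)
    qed simp
    moreover have "(\<lambda>n. LBINT x:{0..real n}. w * ?f x) \<longlonglongrightarrow> (LBINT x:{0..}. w * ?f x)"
      by (intro tendsto_set_integral_Icc set_integrable_mult_right int)
    moreover have "(LBINT x:{0..}. w * ?f x) = w * hankel_int (w\<^sup>2) (z * w\<^sup>2)"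
      unfolding hankel_int_def gauss_transform_def by (rule set_integral_mult_right)
    ultimately show ?thesis by simp
  qed
  define m \<kappa> where "m = min (Re (z * p\<^sup>2)) (Re (z * q\<^sup>2))" and "\<kappa> = min (Re p) (Re q)"
  have m: "m > 0" "\<kappa> > 0" using p q by (auto simp: m_def \<kappa>_def)
  have chord: "norm (G (of_real R * p) - G (of_real R * q)) \<le> norm (p - q) / \<kappa> * exp (- (m / 2 * R\<^sup>2))"
    if R: "R > 0" for R
  proof -
    have "norm (G (of_real R * p) - G (of_real R * q)) \<le> (exp (- (m / 2 * R\<^sup>2)) * (1 / (R * \<kappa>))) * norm (of_real R * p - of_real R * q)"
    proof (rule field_differentiable_bound[OF convex_closed_segment[of "of_real R * p" "of_real R * q"]])
      fix \<eta> assume "\<eta> \<in> closed_segment (of_real R * p) (of_real R * q)"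
      then obtain u where u: "0 \<le> u" "u \<le> 1" "\<eta> = of_real R * ((1 - of_real u) * p + of_real u * q)"
        by (auto simp: closed_segment_def scaleR_conv_of_real algebra_simps)
      have "(1 - u) * \<kappa> + u * \<kappa> \<le> (1 - u) * Re p + u * Re q"
        using u by (intro add_mono mult_left_mono) (auto simp: \<kappa>_def)
      then have "R * \<kappa> \<le> R * ((1 - u) * Re p + u * Re q)"
        using R by (intro mult_left_mono) (auto simp: algebra_simps)
      then have Re: "R * \<kappa> \<le> Re \<eta>" unfolding u by simp
      have pos: "R * \<kappa> > 0" using R m by simp
      then have "Re \<eta> > 0" using Re by linarith
      then have "closed_segment (of_real R * p) (of_real R * q) \<subseteq> S"
        using p q R unfolding S_def
        by (intro subset_insertI2 closed_segment_subset convex_halfspace_Re_gt) auto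
      then show "(G has_field_derivative g \<eta>) (at \<eta> within closed_segment (of_real R * p) (of_real R * q))"
        using \<open>\<eta> \<in> closed_segment _ _\<close> by (intro has_field_derivative_subset[OF G]) auto
      have "m / 2 \<le> Re (z * ((1 - of_real u) * p + of_real u * q)\<^sup>2)"
        using u pq m by (intro Gauss_chord_ge) (auto simp: m_def)
      then have "R\<^sup>2 * (m / 2) \<le> R\<^sup>2 * Re (z * ((1 - of_real u) * p + of_real u * q)\<^sup>2)"
        by (intro mult_left_mono) auto
      also have "\<dots> = Re (of_real (R\<^sup>2) * (z * ((1 - of_real u) * p + of_real u * q)\<^sup>2))"
        by (simp only: Re_complex_of_real Im_complex_of_real times_complex.sel(1))
      also have "of_real (R\<^sup>2) * (z * ((1 - of_real u) * p + of_real u * q)\<^sup>2) = z * \<eta>\<^sup>2"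
        unfolding u by (simp add: power_mult_distrib mult_ac)
      finally have "norm (exp (- (z * \<eta>\<^sup>2))) \<le> exp (- (m / 2 * R\<^sup>2))"
        by (simp add: norm_exp_eq_Re mult_ac del: Re_complex_of_real times_complex.sel)
      moreover have "norm (1 / csqrt (2 + \<eta>\<^sup>2)) \<le> 1 / (R * \<kappa>)"
        by (rule order_trans[OF norm_hankel_kernel_halfplane[OF \<open>Re \<eta> > 0\<close>]]) (use Re pos in \<open>simp add: frac_le\<close>)
      ultimately show "norm (g \<eta>) \<le> exp (- (m / 2 * R\<^sup>2)) * (1 / (R * \<kappa>))"
        unfolding g_def norm_mult by (intro mult_mono) auto
    qed auto
    also have "norm (of_real R * p - of_real R * q) = R * norm (p - q)"
      using R by (simp add: norm_mult flip: right_diff_distrib)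
    finally show ?thesis using R by (simp add: mult_ac)
  qed
  have "(\<lambda>n. norm (p - q) / \<kappa> * exp (- (m / 2 * (real n)\<^sup>2))) \<longlonglongrightarrow> 0"
  proof -
    have "filterlim (\<lambda>n. m / 2 * (real n)\<^sup>2) at_top sequentially"
      using m by real_asymp
    then have "(\<lambda>n. exp (- (m / 2 * (real n)\<^sup>2))) \<longlonglongrightarrow> 0"
      by (intro filterlim_compose[OF exp_at_bot]) (simp add: filterlim_uminus_at_bot)
    then show ?thesis by (rule tendsto_mult_right_zero)
  qed
  then have A: "(\<lambda>n. G (of_real (real n) * p) - G (of_real (real n) * q)) \<longlonglongrightarrow> 0"
  proof (rule Lim_null_comparison[rotated])
    show "\<forall>\<^sub>F n in sequentially. norm (G (of_real (real n) * p) - G (of_real (real n) * q))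
       \<le> norm (p - q) / \<kappa> * exp (- (m / 2 * (real n)\<^sup>2))"
      using eventually_gt_at_top[of 0]
    proof eventually_elim
      case (elim n)
      then show ?case by (intro chord) simp
    qed
  qed
  have "(\<lambda>n. (G (of_real (real n) * p) - G 0) - (G (of_real (real n) * q) - G 0)) \<longlonglongrightarrow>
      p * hankel_int (p\<^sup>2) (z * p\<^sup>2) - q * hankel_int (q\<^sup>2) (z * q\<^sup>2)"
    by (intro tendsto_diff ray p q)
  then have B: "(\<lambda>n. G (of_real (real n) * p) - G (of_real (real n) * q)) \<longlonglongrightarrow>
      p * hankel_int (p\<^sup>2) (z * p\<^sup>2) - q * hankel_int (q\<^sup>2) (z * q\<^sup>2)"
    by (simp only: diff_diff_eq2 diff_add_cancel)
  from LIMSEQ_unique[OF A B] show ?thesis by simp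
qed

section \<open>Identification with the Bessel functions\<close>

lemma cosh_ge_quarter_square: "x\<^sup>2 / 4 \<le> cosh (x::real)"
proof -
  have "1 + \<bar>x\<bar> + \<bar>x\<bar>\<^sup>2 / 2 \<le> exp \<bar>x\<bar>" by (rule exp_lower_Taylor_quadratic) simp
  then have "x\<^sup>2 / 4 \<le> exp \<bar>x\<bar> / 2" using abs_ge_zero[of x] by (simp only: power2_abs)
  also have "\<dots> \<le> cosh \<bar>x\<bar>" by (simp add: cosh_field_def)
  finally show ?thesis by simp
qed

lemma set_integrable_exp_cosh:
  assumes r: "r > 0"
  shows "set_integrable lborel {0<..} (\<lambda>u::real. exp (- (r * cosh u)))"
proof (rule set_integrable_bound)
  show "set_integrable lborel {0<..} (\<lambda>u::real. exp (- (r / 4 * u\<^sup>2)))"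
    by (rule set_integrable_subset[of _ "{0..}"]) (use set_integrable_gauss_moment[of "r / 4" 0] r in auto)
  show "AE u in lborel. u \<in> {0<..} \<longrightarrow> norm (exp (- (r * cosh u))) \<le> norm (exp (- (r / 4 * u\<^sup>2)))"
  proof (intro AE_I2 impI)
    fix u :: real
    have "r * (u\<^sup>2 / 4) \<le> r * cosh u" using r by (intro mult_left_mono cosh_ge_quarter_square) auto
    then show "norm (exp (- (r * cosh u))) \<le> norm (exp (- (r / 4 * u\<^sup>2)))" by simp
  qed
  show "set_borel_measurable lborel {0<..} (\<lambda>u. exp (- (r * cosh u)))"
    unfolding set_borel_measurable_def
    using borel_measurable_continuous_on_indicator[of "{0<..}" "\<lambda>u::real. exp (- (r * cosh u))"]
    by (simp add: continuous_intros)
qed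

lemma einterval_0_PInf: "einterval 0 \<infinity> = {0<..}"
  by (auto simp: einterval_def)

lemma tendsto_at_left_PInf_ereal:
  assumes "filterlim g at_top at_top"
  shows "((ereal \<circ> g \<circ> real_of_ereal) \<longlongrightarrow> \<infinity>) (at_left \<infinity>)"
  using assms unfolding tendsto_PInfty_eq_at_top[symmetric] at_left_PInf o_def
  by (simp add: filterlim_filtermap)

lemma tendsto_at_right_ereal:
  assumes "isCont g a"
  shows "((ereal \<circ> g \<circ> real_of_ereal) \<longlongrightarrow> ereal (g a)) (at_right (ereal a))"
  unfolding at_right_ereal filterlim_filtermap o_def real_of_ereal.simps
  using assms by (intro tendsto_intros) (auto simp: isCont_def filterlim_at_split)

lemma tendsto_at_right_0_ereal:
  "isCont g 0 \<Longrightarrow> ((ereal \<circ> g \<circ> real_of_ereal) \<longlongrightarrow> ereal (g 0)) (at_right 0)"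
  using tendsto_at_right_ereal[of 0 g] unfolding zero_ereal_def[symmetric] .

lemma tendsto_at_left_ereal:
  assumes "isCont g a"
  shows "((ereal \<circ> g \<circ> real_of_ereal) \<longlongrightarrow> ereal (g a)) (at_left (ereal a))"
  unfolding at_left_ereal filterlim_filtermap o_def real_of_ereal.simps
  using assms by (intro tendsto_intros) (auto simp: isCont_def filterlim_at_split)

lemma interval_integral_substitution:
  fixes f g g' :: "real \<Rightarrow> real" and a b A B :: ereal
  assumes "a < b"
  and "\<And>x. a < ereal x \<Longrightarrow> ereal x < b \<Longrightarrow> DERIV g x :> g' x"
  and "\<And>x. a < ereal x \<Longrightarrow> ereal x < b \<Longrightarrow> isCont f (g x)"
  and "\<And>x. a < ereal x \<Longrightarrow> ereal x < b \<Longrightarrow> isCont g' x"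
  and "\<And>x. a < ereal x \<Longrightarrow> ereal x < b \<Longrightarrow> 0 \<le> f (g x)"
  and "\<And>x. a \<le> ereal x \<Longrightarrow> ereal x \<le> b \<Longrightarrow> 0 \<le> g' x"
  and "((ereal \<circ> g \<circ> real_of_ereal) \<longlongrightarrow> A) (at_right a)"
  and "((ereal \<circ> g \<circ> real_of_ereal) \<longlongrightarrow> B) (at_left b)"
  and "set_integrable lborel (einterval a b) (\<lambda>x. f (g x) * g' x)"
  shows "set_integrable lborel (einterval A B) f \<and>
    (LBINT x=A..B. f x) = (LBINT x=a..b. (f (g x) * g' x))"
  by (intro conjI interval_integral_substitution_nonneg[where f = f and g = g and g' = g' and a = a and b = b and A = A and B = B, OF assms])

text \<open>Substitution \<open>x = sqrt 2 * sinh (u / 2)\<close>: then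
  \<open>1 + x^2 = cosh u\<close>, and the root cancels against the derivative up to
  \<open>1/2\<close>.\<close>

lemma K0_sinh_substitution:
  assumes r: "r > 0"
  shows "(LBINT x:{0<..}. exp (- (r * x\<^sup>2)) / sqrt (2 + x\<^sup>2)) = exp r / 2 * bessel_K0 r"
proof -
  let ?f = "\<lambda>x::real. exp (- (r * x\<^sup>2)) / sqrt (2 + x\<^sup>2)"
  let ?g = "\<lambda>u::real. sqrt 2 * sinh (u / 2)"
  let ?g' = "\<lambda>u::real. sqrt 2 * cosh (u / 2) / 2"
  have pos: "2 + x\<^sup>2 > 0" for x :: real by (intro add_pos_nonneg) auto
  have fg: "?f (?g u) * ?g' u = exp r / 2 * exp (- (r * cosh u))" for u
  proof -
    have 1: "cosh u = 1 + 2 * (sinh (u / 2))\<^sup>2"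
      using cosh_double[of "u / 2"] by (simp add: cosh_square_eq)
    have "2 + (?g u)\<^sup>2 = (sqrt 2 * cosh (u / 2))\<^sup>2"
      by (simp add: power_mult_distrib cosh_square_eq)
    then have "sqrt (2 + (?g u)\<^sup>2) = sqrt 2 * cosh (u / 2)" by simp
    moreover have "exp (- (r * (?g u)\<^sup>2)) = exp r * exp (- (r * cosh u))"
      unfolding 1 by (simp add: power_mult_distrib algebra_simps flip: exp_add)
    ultimately show ?thesis by simp
  qed
  have int: "set_integrable lborel (einterval 0 \<infinity>) (\<lambda>u. ?f (?g u) * ?g' u)"
    unfolding fg einterval_0_PInf by (intro set_integrable_mult_right set_integrable_exp_cosh r)
  have "set_integrable lborel (einterval 0 \<infinity>) ?f \<and>
      (LBINT x=0..\<infinity>. ?f x) = (LBINT u=0..\<infinity>. ?f (?g u) * ?g' u)"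
  proof (rule interval_integral_substitution)
    show "set_integrable lborel (einterval 0 \<infinity>) (\<lambda>u. ?f (?g u) * ?g' u)" by (rule int)
    show "DERIV ?g u :> ?g' u" for u by (auto intro!: derivative_eq_intros)
    show "isCont ?f (?g u)" for u
      using pos[of "?g u"] by (intro continuous_intros) auto
    show "isCont ?g' u" for u by (intro continuous_intros) auto
    show "0 \<le> ?f (?g u)" for u by simp
    show "0 \<le> ?g' u" for u by simp
    show "((ereal \<circ> ?g \<circ> real_of_ereal) \<longlongrightarrow> 0) (at_right 0)"
    proof -
      have "DERIV ?g 0 :> ?g' 0" by (auto intro!: derivative_eq_intros)
      note tendsto_at_right_0_ereal[OF DERIV_isCont[OF this]]
      also have "ereal (?g 0) = 0" by simp
      finally show ?thesis .
    qed
    show "((ereal \<circ> ?g \<circ> real_of_ereal) \<longlongrightarrow> \<infinity>) (at_left \<infinity>)"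
      by (rule tendsto_at_left_PInf_ereal) real_asymp
  qed simp_all
  then have "(LBINT x:{0<..}. ?f x) = (LBINT u:{0<..}. exp r / 2 * exp (- (r * cosh u)))"
    unfolding fg interval_lebesgue_integral_def einterval_0_PInf by simp
  also have "\<dots> = exp r / 2 * bessel_K0 r"
    unfolding bessel_K0_def mult_minus_left by (simp only: set_integral_mult_right)
  finally show ?thesis .
qed

text \<open>The part of the cut beyond the branch point: \<open>x = sqrt 2 * cosh (u / 2)\<close>
  makes \<open>x^2 - 1 = cosh u\<close>, whence the prefactor \<open>exp (- r)\<close>.\<close>

lemma K0_cosh_substitution:
  assumes r: "r > 0"
  shows "set_integrable lborel {sqrt 2<..} (\<lambda>x. exp (- (r * x\<^sup>2)) / sqrt (x\<^sup>2 - 2))"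
    and "(LBINT x:{sqrt 2<..}. exp (- (r * x\<^sup>2)) / sqrt (x\<^sup>2 - 2)) = exp (- r) / 2 * bessel_K0 r"
proof -
  let ?f = "\<lambda>x::real. exp (- (r * x\<^sup>2)) / sqrt (x\<^sup>2 - 2)"
  let ?g = "\<lambda>u::real. sqrt 2 * cosh (u / 2)"
  let ?g' = "\<lambda>u::real. sqrt 2 * sinh (u / 2) / 2"
  have rt: "sqrt ((?g u)\<^sup>2 - 2) = sqrt 2 * sinh (u / 2)" if "u > 0" for u
  proof -
    have "(?g u)\<^sup>2 - 2 = (sqrt 2 * sinh (u / 2))\<^sup>2"
      by (simp add: power_mult_distrib cosh_square_eq)
    then show ?thesis using that by simp
  qed
  have fg: "?f (?g u) * ?g' u = exp (- r) / 2 * exp (- (r * cosh u))" if u: "u > 0" for u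
  proof -
    have 1: "cosh u = 2 * (cosh (u / 2))\<^sup>2 - 1"
      using cosh_double[of "u / 2"] by (simp add: sinh_square_eq)
    have "exp (- (r * (?g u)\<^sup>2)) = exp (- r) * exp (- (r * cosh u))"
      unfolding 1 by (simp add: power_mult_distrib algebra_simps flip: exp_add)
    then show ?thesis using rt[OF u] u by simp
  qed
  have ei: "einterval (ereal (sqrt 2)) \<infinity> = {sqrt 2<..}" by (auto simp: einterval_def)
  have int: "set_integrable lborel (einterval 0 \<infinity>) (\<lambda>u. ?f (?g u) * ?g' u)"
  proof -
    have "set_integrable lborel {0<..} (\<lambda>u. exp (- r) / 2 * exp (- (r * cosh u)))"
      by (intro set_integrable_mult_right set_integrable_exp_cosh r)
    moreover have "set_integrable lborel {0<..} (\<lambda>u. ?f (?g u) * ?g' u) = set_integrable lborel {0<..} (\<lambda>u. exp (- r) / 2 * exp (- (r * cosh u)))"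
      by (rule set_integrable_cong[OF refl refl]) (intro fg, simp only: greaterThan_iff)
    ultimately show ?thesis unfolding einterval_0_PInf by (simp only:)
  qed
  have sub: "set_integrable lborel (einterval (ereal (sqrt 2)) \<infinity>) ?f \<and>
      (LBINT x=ereal (sqrt 2)..\<infinity>. ?f x) = (LBINT u=0..\<infinity>. ?f (?g u) * ?g' u)"
  proof (rule interval_integral_substitution)
    show "set_integrable lborel (einterval 0 \<infinity>) (\<lambda>u. ?f (?g u) * ?g' u)" by (rule int)
    show "DERIV ?g u :> ?g' u" for u by (auto intro!: derivative_eq_intros)
    show "isCont ?f (?g u)" if "0 < ereal u" for u
    proof -
      have "sqrt ((?g u)\<^sup>2 - 2) \<noteq> 0" using rt[of u] that by simp
      then show ?thesis by (intro continuous_intros) auto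
    qed
    show "isCont ?g' u" for u by (intro continuous_intros) auto
    show "0 \<le> ?f (?g u)" if "0 < ereal u" for u using rt[of u] that by simp
    show "0 \<le> ?g' u" if "0 \<le> ereal u" for u using that by simp
    show "((ereal \<circ> ?g \<circ> real_of_ereal) \<longlongrightarrow> ereal (sqrt 2)) (at_right 0)"
    proof -
      have "DERIV ?g 0 :> ?g' 0" by (auto intro!: derivative_eq_intros)
      note tendsto_at_right_0_ereal[OF DERIV_isCont[OF this]]
      also have "ereal (?g 0) = ereal (sqrt 2)" by simp
      finally show ?thesis .
    qed
    show "((ereal \<circ> ?g \<circ> real_of_ereal) \<longlongrightarrow> \<infinity>) (at_left \<infinity>)"
      by (rule tendsto_at_left_PInf_ereal) real_asymp
  qed simp_all
  from conjunct1[OF sub] show "set_integrable lborel {sqrt 2<..} ?f" unfolding ei .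
  have "(LBINT x:{sqrt 2<..}. ?f x) = (LBINT u:{0<..}. ?f (?g u) * ?g' u)"
    using conjunct2[OF sub] unfolding interval_lebesgue_integral_def einterval_0_PInf ei
    by (simp only: ereal_less_eq(1) ereal_infty_less_eq if_True)
  also have "\<dots> = (LBINT u:{0<..}. exp (- r) / 2 * exp (- (r * cosh u)))"
    by (rule set_lebesgue_integral_cong) (simp, intro allI impI fg, simp only: greaterThan_iff)
  also have "\<dots> = exp (- r) / 2 * bessel_K0 r"
    unfolding bessel_K0_def mult_minus_left by (simp only: set_integral_mult_right)
  finally show "(LBINT x:{sqrt 2<..}. ?f x) = exp (- r) / 2 * bessel_K0 r" .
qed

text \<open>The part of the cut before the branch point: \<open>x = sqrt 2 * sin (u / 2)\<close>
  makes \<open>1 - x^2 = cos u\<close>, with \<open>u\<close> running from 0 to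
  \<open>pi\<close>.\<close>

lemma I0_sin_substitution:
  shows "set_integrable lborel {0<..<sqrt 2} (\<lambda>x. exp (- (r * x\<^sup>2)) / sqrt (2 - x\<^sup>2))"
    and "(LBINT x:{0<..<sqrt 2}. exp (- (r * x\<^sup>2)) / sqrt (2 - x\<^sup>2)) = pi * exp (- r) / 2 * bessel_I0 r"
proof -
  let ?f = "\<lambda>x::real. exp (- (r * x\<^sup>2)) / sqrt (2 - x\<^sup>2)"
  let ?g = "\<lambda>u::real. sqrt 2 * sin (u / 2)"
  let ?g' = "\<lambda>u::real. sqrt 2 * cos (u / 2) / 2"
  have cp: "cos (u / 2) > 0" if "0 < u" "u < pi" for u
    using that by (intro cos_gt_zero_pi) auto
  have rt: "sqrt (2 - (?g u)\<^sup>2) = sqrt 2 * cos (u / 2)" if "0 < u" "u < pi" for u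
  proof -
    have "2 - (?g u)\<^sup>2 = (sqrt 2 * cos (u / 2))\<^sup>2"
      by (simp add: power_mult_distrib cos_squared_eq)
    then show ?thesis using cp[OF that] by simp
  qed
  have fg: "?f (?g u) * ?g' u = exp (- r) / 2 * exp (r * cos u)" if u: "0 < u" "u < pi" for u
  proof -
    have 1: "cos u = 1 - 2 * (sin (u / 2))\<^sup>2"
      using cos_double_sin[of "u / 2"] by simp
    have "exp (- (r * (?g u)\<^sup>2)) = exp (- r) * exp (r * cos u)"
      unfolding 1 by (simp add: power_mult_distrib algebra_simps flip: exp_add)
    then show ?thesis using rt[OF u] cp[OF u] by simp
  qed
  have ei: "einterval (ereal 0) (ereal (sqrt 2)) = {0<..<sqrt 2}" "einterval (ereal 0) (ereal pi) = {0<..<pi}"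
    by (auto simp: einterval_def)
  have cont: "continuous_on {0..pi} (\<lambda>u. exp (r * cos u))" by (intro continuous_intros)
  have int: "set_integrable lborel (einterval (ereal 0) (ereal pi)) (\<lambda>u. ?f (?g u) * ?g' u)"
  proof -
    have "set_integrable lborel {0..pi} (\<lambda>u. exp (- r) / 2 * exp (r * cos u))"
      by (intro set_integrable_mult_right borel_integrable_atLeastAtMost'[OF cont])
    then have "set_integrable lborel {0<..<pi} (\<lambda>u. exp (- r) / 2 * exp (r * cos u))"
      by (rule set_integrable_subset) auto
    moreover have "set_integrable lborel {0<..<pi} (\<lambda>u. ?f (?g u) * ?g' u) = set_integrable lborel {0<..<pi} (\<lambda>u. exp (- r) / 2 * exp (r * cos u))"
      by (rule set_integrable_cong[OF refl refl]) (intro fg, simp_all only: greaterThanLessThan_iff)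
    ultimately show ?thesis unfolding ei by (simp only:)
  qed
  have sub: "set_integrable lborel (einterval (ereal 0) (ereal (sqrt 2))) ?f \<and>
      (LBINT x=ereal 0..ereal (sqrt 2). ?f x) = (LBINT u=ereal 0..ereal pi. ?f (?g u) * ?g' u)"
  proof (rule interval_integral_substitution)
    show "set_integrable lborel (einterval (ereal 0) (ereal pi)) (\<lambda>u. ?f (?g u) * ?g' u)" by (rule int)
    show "DERIV ?g u :> ?g' u" for u by (auto intro!: derivative_eq_intros)
    show "isCont ?f (?g u)" if "ereal 0 < ereal u" "ereal u < ereal pi" for u
    proof -
      have "sqrt (2 - (?g u)\<^sup>2) \<noteq> 0" using rt[of u] cp[of u] that by simp
      then show ?thesis by (intro continuous_intros) auto
    qed
    show "isCont ?g' u" for u by (intro continuous_intros) auto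
    show "0 \<le> ?f (?g u)" if "ereal 0 < ereal u" "ereal u < ereal pi" for u using rt[of u] cp[of u] that by simp
    show "0 \<le> ?g' u" if "ereal 0 \<le> ereal u" "ereal u \<le> ereal pi" for u
      using that cos_ge_zero[of "u / 2"] by simp
    show "((ereal \<circ> ?g \<circ> real_of_ereal) \<longlongrightarrow> ereal 0) (at_right (ereal 0))"
      using tendsto_at_right_ereal[where g = ?g and a = 0] by simp
    show "((ereal \<circ> ?g \<circ> real_of_ereal) \<longlongrightarrow> ereal (sqrt 2)) (at_left (ereal pi))"
      using tendsto_at_left_ereal[where g = ?g and a = pi] by simp
  qed simp_all
  from conjunct1[OF sub] show "set_integrable lborel {0<..<sqrt 2} ?f" unfolding ei .
  have "(LBINT x:{0<..<sqrt 2}. ?f x) = (LBINT u:{0<..<pi}. ?f (?g u) * ?g' u)"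
    using sub unfolding interval_lebesgue_integral_def ei by simp
  also have "\<dots> = (LBINT u:{0<..<pi}. exp (- r) / 2 * exp (r * cos u))"
    by (rule set_lebesgue_integral_cong) (simp, intro allI impI fg, simp_all only: greaterThanLessThan_iff)
  also have "\<dots> = exp (- r) / 2 * (LBINT u:{0<..<pi}. exp (r * cos u))" by simp
  also have "(LBINT u:{0<..<pi}. exp (r * cos u)) = (LBINT u:{0..pi}. exp (r * cos u))"
    unfolding interval_integral_Icc[OF pi_ge_zero, symmetric] by (simp add: interval_lebesgue_integral_def einterval_iff ei)
  finally show "(LBINT x:{0<..<sqrt 2}. ?f x) = pi * exp (- r) / 2 * bessel_I0 r"
    by (simp add: bessel_I0_def)
qed

section \<open>The two continuations of \<open>K0\<close> to the closed quadrant\<close>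

text \<open>The directions \<open>hankel_p\<close> and \<open>hankel_q\<close> are chosen such that \<open>Re (z p\<^sup>2)\<close> and \<open>Re (- z q\<^sup>2)\<close> are bounded
  below by a multiple of \<open>|z|\<close> on the closed first quadrant. There \<open>bessel_k1\<close> and \<open>bessel_k2\<close> continue
  \<open>K\<^sub>0(z)\<close> and \<open>K\<^sub>0(exp (- \<i> \<pi>) z) = K\<^sub>0(z) + \<i> \<pi> I\<^sub>0(z)\<close>.\<close>
definition hankel_p :: complex where "hankel_p = cis (- pi / 8)"
definition hankel_q :: complex where "hankel_q = cis (3 * pi / 8)"

definition bessel_k1 :: "complex \<Rightarrow> complex" where
  "bessel_k1 z = 2 * exp (- z) * (hankel_p * hankel_int (hankel_p\<^sup>2) (z * hankel_p\<^sup>2))"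

definition bessel_k2 :: "complex \<Rightarrow> complex" where
  "bessel_k2 z = 2 * exp z * (hankel_q * hankel_int (hankel_q\<^sup>2) (- z * hankel_q\<^sup>2))"

lemma cis_square: "(cis a)\<^sup>2 = cis (2 * a)"
  by (simp add: power2_eq_square cis_mult)

lemma hankel_p_square: "hankel_p\<^sup>2 = cis (- pi / 4)"
  by (simp add: hankel_p_def cis_square)

lemma hankel_q_square: "hankel_q\<^sup>2 = cis (3 * pi / 4)"
  by (simp add: hankel_q_def cis_square)

lemma norm_hankel_pq [simp]: "norm hankel_p = 1" "norm hankel_q = 1"
  by (simp_all add: hankel_p_def hankel_q_def)

lemma Re_hankel_pq: "Re hankel_p > 0" "Re hankel_q > 0"
  by (simp_all add: hankel_p_def hankel_q_def cos_gt_zero_pi)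

lemma set_integral_atLeast_greaterThan:
  fixes f :: "real \<Rightarrow> 'a::{banach, second_countable_topology}"
  shows "(LBINT x:{a..}. f x) = (LBINT x:{a<..}. f x)"
  by (rule set_integral_discrete_difference[where X = "{a}"]) auto

lemma bessel_k1_of_real:
  assumes t: "t > 0"
  shows "bessel_k1 (of_real t) = of_real (bessel_K0 t)"
proof -
  have "hankel_p * hankel_int (hankel_p\<^sup>2) (of_real t * hankel_p\<^sup>2) = 1 * hankel_int (1\<^sup>2) (of_real t * 1\<^sup>2)"
  proof (rule hankel_int_rotate)
    show "0 < Re (of_real t * hankel_p\<^sup>2)"
      unfolding hankel_p_square using t by (simp add: cos_gt_zero_pi)
    show "0 \<le> Re (of_real t * hankel_p * 1)"
      using t Re_hankel_pq by simp
  qed (use t Re_hankel_pq in auto)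
  also have "\<dots> = (LBINT x:{0..}. of_real (exp (- (t * x\<^sup>2)) / sqrt (2 + x\<^sup>2)))"
  proof -
    have "csqrt (2 + (of_real x)\<^sup>2) = of_real (sqrt (2 + x\<^sup>2))" for x :: real
      using csqrt_of_real_nonneg[of "2 + x\<^sup>2"] by simp
    then show ?thesis
      unfolding hankel_int_def gauss_transform_def by (simp flip: exp_of_real)
  qed
  also have "\<dots> = of_real (exp t / 2 * bessel_K0 t)"
    unfolding set_integral_complex_of_real set_integral_atLeast_greaterThan K0_sinh_substitution[OF t] ..
  finally have "hankel_p * hankel_int (hankel_p\<^sup>2) (of_real t * hankel_p\<^sup>2) = of_real (exp t / 2 * bessel_K0 t)" .
  note X = this
  have "bessel_k1 (of_real t) = of_real (exp (- t) * exp t * bessel_K0 t)"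
    unfolding bessel_k1_def X by (simp flip: exp_of_real)
  also have "exp (- t) * exp t = 1" by (simp flip: exp_add)
  finally show ?thesis by simp
qed

lemma cnj_hankel_int:
  assumes c: "norm c = 1" "Re c > -1"
  shows "cnj (hankel_int c s) = hankel_int (cnj c) (cnj s)"
proof -
  have *: "cnj (exp (- (s * (of_real x)\<^sup>2)) * (1 / csqrt (2 + c * (of_real x)\<^sup>2)))
      = exp (- (cnj s * (of_real x)\<^sup>2)) * (1 / csqrt (2 + cnj c * (of_real x)\<^sup>2))" for x :: real
    using ray_notin_nonpos_Reals[OF c, of "x\<^sup>2"] by (simp add: exp_cnj cnj_csqrt)
  have "cnj (integral\<^sup>L lborel F) = integral\<^sup>L lborel (\<lambda>x. cnj (F x))" for F :: "real \<Rightarrow> complex"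
    by simp
  then show ?thesis
    unfolding hankel_int_def gauss_transform_def set_lebesgue_integral_def
    by (simp only: complex_cnj_scaleR *)
qed

text \<open>On the imaginary axis conjugation is negation. The conjugate of the integral in
  \<open>bessel_k1\<close> therefore belongs to \<open>-z\<close>, with direction
  \<open>cis (pi / 8)\<close>, and it only remains to rotate that ray to \<open>hankel_q\<close>.
  The product of the two factors becomes a squared modulus.\<close>

lemma bessel_k2_imaginary:
  assumes y: "y > 0"
  shows "bessel_k2 (\<i> * of_real y) = cnj (bessel_k1 (\<i> * of_real y))"
proof -
  have sq: "(cnj hankel_p)\<^sup>2 = cnj (hankel_p\<^sup>2)" by simp
  have "cnj (hankel_p * hankel_int (hankel_p\<^sup>2) (\<i> * of_real y * hankel_p\<^sup>2))
      = cnj hankel_p * hankel_int ((cnj hankel_p)\<^sup>2) (- (\<i> * of_real y) * (cnj hankel_p)\<^sup>2)"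
    using unit_square_Re_gt[of hankel_p] by (simp add: cnj_hankel_int Re_hankel_pq)
  also have "\<dots> = hankel_q * hankel_int (hankel_q\<^sup>2) (- (\<i> * of_real y) * hankel_q\<^sup>2)"
  proof (rule hankel_int_rotate)
    have e: "cnj hankel_p = cis (pi / 8)" by (simp add: hankel_p_def cis_cnj)
    show "0 < Re (- (\<i> * of_real y) * (cnj hankel_p)\<^sup>2)"
      using y unfolding e cis_square by (simp add: sin_gt_zero)
    show "0 < Re (- (\<i> * of_real y) * hankel_q\<^sup>2)"
      using y unfolding hankel_q_square by (simp add: sin_gt_zero)
    have "cnj hankel_p * hankel_q = cis (pi / 2)"
      unfolding e hankel_q_def cis_mult by (rule arg_cong[of _ _ cis]) simp
    then have "- (\<i> * of_real y) * cnj hankel_p * hankel_q = of_real y"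
      by (simp add: mult.assoc complex_eq_iff)
    then show "0 \<le> Re (- (\<i> * of_real y) * cnj hankel_p * hankel_q)" using y by simp
  qed (use Re_hankel_pq in auto)
  finally show ?thesis
    unfolding bessel_k1_def bessel_k2_def by (simp add: exp_cnj)
qed

lemma hankel_kernel_tendsto:
  fixes c :: "nat \<Rightarrow> complex"
  assumes c: "c \<longlonglongrightarrow> -1" "\<And>n. Im (c n) > 0" and x: "x > 0" "x \<noteq> sqrt 2"
  shows "(\<lambda>n. exp (of_real t * c n * (of_real x)\<^sup>2) * (1 / csqrt (2 + c n * (of_real x)\<^sup>2)))
    \<longlonglongrightarrow> of_real (exp (- (t * x\<^sup>2))) * (if x < sqrt 2 then of_real (1 / sqrt (2 - x\<^sup>2)) else - \<i> * of_real (1 / sqrt (x\<^sup>2 - 2)))"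
proof -
  have x2: "x\<^sup>2 \<noteq> 2" using x by (metis abs_of_pos real_sqrt_abs)
  have e: "(\<lambda>n. exp (of_real t * c n * (of_real x)\<^sup>2)) \<longlonglongrightarrow> of_real (exp (- (t * x\<^sup>2)))"
  proof -
    have "(\<lambda>n. exp (of_real t * c n * (of_real x)\<^sup>2)) \<longlonglongrightarrow> exp (of_real t * (-1) * (of_real x)\<^sup>2)"
      by (intro tendsto_intros c)
    also have "exp (of_real t * (-1) * (of_real x)\<^sup>2) = (of_real (exp (- (t * x\<^sup>2))) :: complex)"
      by (simp flip: exp_of_real)
    finally show ?thesis .
  qed
  have w: "(\<lambda>n. 2 + c n * (of_real x)\<^sup>2) \<longlonglongrightarrow> of_real (2 - x\<^sup>2)"
  proof -
    have "(\<lambda>n. 2 + c n * (of_real x)\<^sup>2) \<longlonglongrightarrow> 2 + (-1) * (of_real x)\<^sup>2"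
      by (intro tendsto_intros c)
    then show ?thesis by simp
  qed
  have L: "(\<lambda>n. csqrt (2 + c n * (of_real x)\<^sup>2)) \<longlonglongrightarrow> (if x < sqrt 2 then of_real (sqrt (2 - x\<^sup>2)) else \<i> * of_real (sqrt (x\<^sup>2 - 2)))"
  proof (cases "x < sqrt 2")
    case True
    then have "x\<^sup>2 < (sqrt 2)\<^sup>2" using x by (intro power_strict_mono) auto
    then have p: "2 - x\<^sup>2 > 0" by simp
    have "(\<lambda>n. csqrt (2 + c n * (of_real x)\<^sup>2)) \<longlonglongrightarrow> csqrt (of_real (2 - x\<^sup>2))"
      by (rule isCont_tendsto_compose[OF _ w]) (use p in \<open>auto intro!: continuous_at_csqrt simp: complex_nonpos_Reals_iff\<close>)
    then show ?thesis using True csqrt_of_real_nonneg[of "2 - x\<^sup>2"] p by simp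
  next
    case False
    then have "sqrt 2 < x" using x by simp
    then have "(sqrt 2)\<^sup>2 < x\<^sup>2" using x by (intro power_strict_mono) auto
    then have p: "x\<^sup>2 - 2 > 0" by simp
    \<comment> \<open>The limit lies on the cut of \<open>csqrt\<close>. As the arguments approach
      from the upper half-plane, their root is \<open>\<i>\<close> times the root of the negated
      argument, whose limit is positive, where \<open>csqrt\<close> is continuous.\<close>
    have "csqrt (2 + c n * (of_real x)\<^sup>2) = \<i> * csqrt (- (2 + c n * (of_real x)\<^sup>2))" for n
    proof -
      have "Im (- (2 + c n * (of_real x)\<^sup>2)) < 0"
        using c(2)[of n] x by (simp add: power2_eq_square)
      from csqrt_minus[OF disjI1[OF this]] show ?thesis by (simp only: minus_minus)
    qed
    moreover have "(\<lambda>n. \<i> * csqrt (- (2 + c n * (of_real x)\<^sup>2))) \<longlonglongrightarrow> \<i> * csqrt (- of_real (2 - x\<^sup>2))"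
      by (intro tendsto_mult tendsto_const isCont_tendsto_compose[OF _ tendsto_minus[OF w]])
         (use p in \<open>auto intro!: continuous_at_csqrt simp: complex_nonpos_Reals_iff\<close>)
    moreover have "csqrt (- of_real (2 - x\<^sup>2)) = of_real (sqrt (x\<^sup>2 - 2))"
      using csqrt_of_real_nonneg[of "x\<^sup>2 - 2"] p by simp
    ultimately show ?thesis using False by (simp only: if_False)
  qed
  have eq: "1 / (if x < sqrt 2 then of_real (sqrt (2 - x\<^sup>2)) else \<i> * of_real (sqrt (x\<^sup>2 - 2)))
      = (if x < sqrt 2 then of_real (1 / sqrt (2 - x\<^sup>2)) else - \<i> * of_real (1 / sqrt (x\<^sup>2 - 2)))"
    by (simp add: divide_inverse)
  have nz: "(if x < sqrt 2 then of_real (sqrt (2 - x\<^sup>2)) else \<i> * of_real (sqrt (x\<^sup>2 - 2))) \<noteq> (0 :: complex)"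
    using x2 by simp
  show ?thesis
    using tendsto_mult[OF e tendsto_divide[OF tendsto_const[of 1] L nz]] unfolding eq .
qed

text \<open>The limiting ray runs along the branch cut; the part below the branch point \<open>\<i> sqrt 2\<close> yields \<open>I\<^sub>0\<close>,
  the part above it yields \<open>K\<^sub>0\<close>.\<close>
lemma hankel_int_ray_split:
  fixes t :: real and c :: "nat \<Rightarrow> complex"
  assumes t: "t > 0" and c: "c \<longlonglongrightarrow> -1" "\<And>n. Im (c n) > 0" "\<And>n. norm (c n) = 1" "\<And>n. Re (c n) \<le> - 1 / 2"
  shows "(\<lambda>n. hankel_int (c n) (- of_real t * c n)) \<longlonglongrightarrow>
    of_real (pi * exp (- t) / 2 * bessel_I0 t) - \<i> * of_real (exp (- t) / 2 * bessel_K0 t)"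
proof -
  define D :: "real set" where "D = {0<..<sqrt 2} \<union> {sqrt 2<..}"
  define F where "F n x = exp (of_real t * c n * (of_real x)\<^sup>2) * (1 / csqrt (2 + c n * (of_real x)\<^sup>2))" for n and x :: real
  define L where "L x = of_real (exp (- (t * x\<^sup>2))) * (if x < sqrt 2 then of_real (1 / sqrt (2 - x\<^sup>2)) else - \<i> * of_real (1 / sqrt (x\<^sup>2 - 2)))" for x
  \<comment> \<open>A majorant for all \<open>n\<close> at once: \<open>|c n| = 1\<close> gives
    \<open>norm (2 + c n * x^2) \<ge> |2 - x^2|\<close>, and \<open>Re (c n) \<le> -1/2\<close>
    retains half of the decay rate. The singularity at \<open>sqrt 2\<close> is integrable by the
    substitutions above.\<close>
  define w where "w x = exp (- (t / 2 * x\<^sup>2)) / sqrt \<bar>2 - x\<^sup>2\<bar>" for x :: real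
  have D: "x > 0" "x \<noteq> sqrt 2" if "x \<in> D" for x using that by (auto simp: D_def intro: less_trans[of 0 "sqrt 2"])
  have lt: "x\<^sup>2 < 2" if "x \<in> {0<..<sqrt 2}" for x
  proof -
    have "x\<^sup>2 < (sqrt 2)\<^sup>2" using that by (intro power_strict_mono) auto
    then show ?thesis by simp
  qed
  have gt: "x\<^sup>2 > 2" if "x \<in> {sqrt 2<..}" for x
  proof -
    have "(sqrt 2)\<^sup>2 < x\<^sup>2" using that by (intro power_strict_mono) auto
    then show ?thesis by simp
  qed
  have w_int: "set_integrable lborel D w"
    unfolding D_def
  proof (rule set_integrable_Un)
    have "set_integrable lborel {0<..<sqrt 2} w = set_integrable lborel {0<..<sqrt 2} (\<lambda>x. exp (- (t / 2 * x\<^sup>2)) / sqrt (2 - x\<^sup>2))"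
      by (rule set_integrable_cong[OF refl refl]) (drule lt, simp add: w_def)
    then show "set_integrable lborel {0<..<sqrt 2} w" using I0_sin_substitution(1) by blast
    have "set_integrable lborel {sqrt 2<..} w = set_integrable lborel {sqrt 2<..} (\<lambda>x. exp (- (t / 2 * x\<^sup>2)) / sqrt (x\<^sup>2 - 2))"
      by (rule set_integrable_cong[OF refl refl]) (drule gt, simp add: w_def abs_if)
    then show "set_integrable lborel {sqrt 2<..} w" using K0_cosh_substitution(1)[of "t / 2"] t by simp
  qed auto
  have Dsets: "D \<in> sets borel" by (auto simp: D_def)
  have Lm: "set_borel_measurable lborel D L"
    unfolding set_borel_measurable_def L_def using Dsets by measurable
  have bd: "norm (F n x) \<le> w x" if "x \<in> D" for n x
  proof -
    have "norm (exp (of_real t * c n * (of_real x)\<^sup>2)) = exp (t * Re (c n) * x\<^sup>2)"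
      by (simp add: norm_exp_eq_Re power2_eq_square)
    also have "\<dots> \<le> exp (- (t / 2 * x\<^sup>2))"
    proof -
      have "t * Re (c n) * x\<^sup>2 \<le> t * (- 1 / 2) * x\<^sup>2"
        using t c(4)[of n] by (intro mult_right_mono mult_left_mono) auto
      then show ?thesis by simp
    qed
    finally have 1: "norm (exp (of_real t * c n * (of_real x)\<^sup>2)) \<le> exp (- (t / 2 * x\<^sup>2))" .
    have "\<bar>2 - x\<^sup>2\<bar> > 0" using that lt[of x] gt[of x] by (auto simp: D_def)
    moreover have "\<bar>2 - x\<^sup>2\<bar> \<le> norm (2 + c n * (of_real x)\<^sup>2)"
      using norm_triangle_ineq3[of 2 "- (c n * (of_real x)\<^sup>2)"] c(3)[of n] by (simp add: norm_mult norm_power)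
    ultimately have "1 / sqrt (norm (2 + c n * (of_real x)\<^sup>2)) \<le> 1 / sqrt \<bar>2 - x\<^sup>2\<bar>"
      by (intro frac_le) auto
    then have "norm (1 / csqrt (2 + c n * (of_real x)\<^sup>2)) \<le> 1 / sqrt \<bar>2 - x\<^sup>2\<bar>"
      by (simp only: norm_divide norm_csqrt norm_one)
    from mult_mono[OF 1 this] show ?thesis unfolding F_def norm_mult w_def by simp
  qed
  have c1: "Re (c n) > -1" for n
  proof -
    have "(Re (c n))\<^sup>2 + (Im (c n))\<^sup>2 = 1" using c(3)[of n] by (simp add: cmod_def)
    moreover have "(Im (c n))\<^sup>2 > 0" using c(2)[of n] by simp
    ultimately have "(Re (c n))\<^sup>2 < 1" by linarith
    then have "\<bar>Re (c n)\<bar> < 1" by (simp only: abs_square_less_1)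
    then show ?thesis by simp
  qed
  have Fi: "set_integrable lborel {0..} (F n)" for n
  proof -
    have "Re (- of_real t * c n) > 0" using t c(4)[of n] by (simp add: mult_less_0_iff)
    from hankel_int_integrable[OF c(3) c1 this] show ?thesis unfolding F_def by simp
  qed
  then have FiD: "set_integrable lborel D (F n)" for n
    by (rule set_integrable_subset) (use Dsets in \<open>auto intro!: less_imp_le[OF D(1)]\<close>)
  have "(\<lambda>n. LBINT x:D. F n x) \<longlonglongrightarrow> (LBINT x:D. L x)"
    unfolding set_lebesgue_integral_def
  proof (rule integral_dominated_convergence)
    show "integrable lborel (\<lambda>x. indicator D x *\<^sub>R w x)" using w_int unfolding set_integrable_def .
    show "(\<lambda>x. indicator D x *\<^sub>R L x) \<in> borel_measurable lborel" using Lm unfolding set_borel_measurable_def .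
    show "(\<lambda>x. indicator D x *\<^sub>R F n x) \<in> borel_measurable lborel" for n
      using FiD[of n] unfolding set_integrable_def by (rule borel_measurable_integrable)
    show "AE x in lborel. (\<lambda>n. indicator D x *\<^sub>R F n x) \<longlonglongrightarrow> indicator D x *\<^sub>R L x"
    proof (rule AE_I2)
      fix x
      show "(\<lambda>n. indicator D x *\<^sub>R F n x) \<longlonglongrightarrow> indicator D x *\<^sub>R L x"
      proof (cases "x \<in> D")
        case True
        have "(\<lambda>n. F n x) \<longlonglongrightarrow> L x"
          unfolding F_def L_def by (rule hankel_kernel_tendsto[OF c(1,2) D[OF True]])
        then show ?thesis using True by simp
      qed simp
    qed
    show "AE x in lborel. norm (indicator D x *\<^sub>R F n x) \<le> indicator D x *\<^sub>R w x" for n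
      using bd by (auto simp: indicator_def)
  qed
  moreover have "(LBINT x:D. F n x) = hankel_int (c n) (- of_real t * c n)" for n
  proof -
    have "(LBINT x:D. F n x) = (LBINT x:{0..}. F n x)"
      by (rule set_integral_discrete_difference[where X = "{0, sqrt 2}"])
         (auto simp: D_def intro: less_imp_le[OF less_trans[of 0 "sqrt 2"]])
    also have "\<dots> = hankel_int (c n) (- of_real t * c n)"
      unfolding hankel_int_def gauss_transform_def F_def by simp
    finally show ?thesis .
  qed
  moreover have "(LBINT x:D. L x) = of_real (pi * exp (- t) / 2 * bessel_I0 t) - \<i> * of_real (exp (- t) / 2 * bessel_K0 t)"
  proof -
    have LiD: "set_integrable lborel D L"
    proof (rule set_integrable_bound[OF w_int Lm])
      show "AE x in lborel. x \<in> D \<longrightarrow> norm (L x) \<le> norm (w x)"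
      proof (intro AE_I2 impI)
        fix x assume "x \<in> D"
        have "exp (- (t * x\<^sup>2)) \<le> exp (- (t / 2 * x\<^sup>2))" using t by simp
        moreover have "norm (L x) = exp (- (t * x\<^sup>2)) * (1 / sqrt \<bar>2 - x\<^sup>2\<bar>)"
          using \<open>x \<in> D\<close> lt[of x] gt[of x] by (auto simp: L_def D_def norm_mult abs_if norm_divide)
        ultimately show "norm (L x) \<le> norm (w x)"
          unfolding w_def by (simp add: divide_right_mono)
      qed
    qed
    then have Li: "set_integrable lborel {0<..<sqrt 2} L" "set_integrable lborel {sqrt 2<..} L"
      by (auto intro!: set_integrable_subset[OF LiD] simp: D_def)
    have "(LBINT x:D. L x) = (LBINT x:{0<..<sqrt 2}. L x) + (LBINT x:{sqrt 2<..}. L x)"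
      unfolding D_def by (rule set_integral_Un[OF _ Li]) auto
    also have "(LBINT x:{0<..<sqrt 2}. L x) = (LBINT x:{0<..<sqrt 2}. complex_of_real (exp (- (t * x\<^sup>2)) / sqrt (2 - x\<^sup>2)))"
      by (rule set_lebesgue_integral_cong) (auto simp: L_def)
    also have "\<dots> = of_real (pi * exp (- t) / 2 * bessel_I0 t)"
      unfolding set_integral_complex_of_real I0_sin_substitution(2) ..
    also have "(LBINT x:{sqrt 2<..}. L x) = (LBINT x:{sqrt 2<..}. - \<i> * complex_of_real (exp (- (t * x\<^sup>2)) / sqrt (x\<^sup>2 - 2)))"
      by (rule set_lebesgue_integral_cong) (auto simp: L_def)
    also have "\<dots> = - \<i> * (LBINT x:{sqrt 2<..}. complex_of_real (exp (- (t * x\<^sup>2)) / sqrt (x\<^sup>2 - 2)))"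
      by (rule set_integral_mult_right)
    also have "\<dots> = - \<i> * of_real (exp (- t) / 2 * bessel_K0 t)"
      unfolding set_integral_complex_of_real K0_cosh_substitution(2)[OF t] ..
    finally show ?thesis by simp
  qed
  ultimately show ?thesis by simp
qed

text \<open>The ray of \<open>hankel_q\<close> may be turned towards the imaginary direction without
  changing the value, so the constant equals the limit computed in
  \<open>hankel_int_ray_split\<close>. The factor \<open>cis (pi / 2) = \<i>\<close> of the limiting
  direction moves \<open>K0\<close> to the real part and \<open>I0\<close> to the imaginary
  part.\<close>

lemma bessel_k2_of_real:
  assumes t: "t > 0"
  shows "bessel_k2 (of_real t) = Complex (bessel_K0 t) (pi * bessel_I0 t)"
proof -
  \<comment> \<open>Starts at \<open>3 * pi / 8\<close>, the direction of \<open>hankel_q\<close>,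
    and increases to \<open>pi / 2\<close>. The doubled angles stay between
    \<open>3 * pi / 4\<close> and \<open>pi\<close>, where the cosine is at most
    \<open>-1/2\<close>.\<close>
  define \<beta> where "\<beta> n = pi / 2 - pi / (8 * real (Suc n))" for n
  have \<beta>: "3 * pi / 8 \<le> \<beta> n" "\<beta> n < pi / 2" for n
  proof -
    have "pi / (8 * real (Suc n)) \<le> pi / 8" by (simp add: field_simps)
    then show "3 * pi / 8 \<le> \<beta> n" by (simp add: \<beta>_def)
    show "\<beta> n < pi / 2" by (simp add: \<beta>_def)
  qed
  have \<beta>_lim: "\<beta> \<longlonglongrightarrow> pi / 2" unfolding \<beta>_def by real_asymp
  define c where "c n = cis (2 * \<beta> n)" for n
  have c_lim: "c \<longlonglongrightarrow> -1"
  proof -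
    have "c \<longlonglongrightarrow> cis (2 * (pi / 2))"
      unfolding c_def cis_conv_exp by (intro tendsto_intros \<beta>_lim)
    then show ?thesis by simp
  qed
  have cos_neg: "cos \<theta> \<le> - 1 / 2" if "3 * pi / 4 \<le> \<theta>" "\<theta> \<le> pi" for \<theta>
  proof -
    have "cos \<theta> \<le> cos (2 * pi / 3)"
      using that pi_gt_zero by (intro cos_monotone_0_pi_le) auto
    also have "cos (2 * pi / 3) = - 1 / 2" by (simp add: cos_120)
    finally show ?thesis .
  qed
  have rot: "cis (\<beta> n) * hankel_int (c n) (- of_real t * c n) = hankel_q * hankel_int (hankel_q\<^sup>2) (- of_real t * hankel_q\<^sup>2)" for n
  proof -
    have cc: "c n = (cis (\<beta> n))\<^sup>2" by (simp add: c_def cis_square)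
    show ?thesis unfolding cc
    proof (rule hankel_int_rotate)
      show "0 < Re (cis (\<beta> n))"
        using \<beta>[of n] pi_gt_zero by (simp add: cos_gt_zero_pi)
      show "0 < Re (- of_real t * (cis (\<beta> n))\<^sup>2)"
        using t cos_neg[of "2 * \<beta> n"] \<beta>[of n] by (simp add: cis_square mult_less_0_iff)
      show "0 < Re (- of_real t * hankel_q\<^sup>2)"
        using t cos_neg[of "3 * pi / 4"] pi_gt_zero by (simp add: hankel_q_square mult_less_0_iff)
      have "cis (\<beta> n) * hankel_q = cis (\<beta> n + 3 * pi / 8)" by (simp add: hankel_q_def cis_mult)
      then have e: "- of_real t * cis (\<beta> n) * hankel_q = - of_real t * cis (\<beta> n + 3 * pi / 8)"
        by (simp only: mult.assoc)
      show "0 \<le> Re (- of_real t * cis (\<beta> n) * hankel_q)"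
        unfolding e using t cos_neg[of "\<beta> n + 3 * pi / 8"] \<beta>[of n] by (simp add: mult_le_0_iff)
    qed (use Re_hankel_pq in auto)
  qed
  have "(\<lambda>n. cis (\<beta> n) * hankel_int (c n) (- of_real t * c n)) \<longlonglongrightarrow> cis (pi / 2) *
      (of_real (pi * exp (- t) / 2 * bessel_I0 t) - \<i> * of_real (exp (- t) / 2 * bessel_K0 t))"
  proof (intro tendsto_mult hankel_int_ray_split t c_lim)
    show "(\<lambda>n. cis (\<beta> n)) \<longlonglongrightarrow> cis (pi / 2)"
      unfolding cis_conv_exp by (intro tendsto_intros \<beta>_lim)
    show "0 < Im (c n)" for n
      using \<beta>[of n] pi_gt_zero by (simp add: c_def sin_gt_zero)
    show "Re (c n) \<le> - 1 / 2" for n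
      using cos_neg[of "2 * \<beta> n"] \<beta>[of n] by (simp add: c_def)
  qed (simp add: c_def)
  then have *: "hankel_q * hankel_int (hankel_q\<^sup>2) (- of_real t * hankel_q\<^sup>2) = cis (pi / 2) *
      (of_real (pi * exp (- t) / 2 * bessel_I0 t) - \<i> * of_real (exp (- t) / 2 * bessel_K0 t))"
    unfolding rot by (simp only: LIMSEQ_const_iff)
  have "exp t * exp (- t) = 1" by (simp flip: exp_add)
  then show ?thesis
    unfolding bessel_k2_def * by (simp add: complex_eq_iff exp_of_real mult.assoc[symmetric])
qed

section \<open>Asymptotic expansions\<close>

text \<open>A Poincare expansion in \<open>1/z\<close>, uniform on \<open>S\<close>; the formal
  series need not converge.\<close>

definition asymp_fps :: "complex set \<Rightarrow> (complex \<Rightarrow> complex) \<Rightarrow> complex fps \<Rightarrow> bool" where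
  "asymp_fps S f p \<longleftrightarrow> (\<forall>n. \<exists>C. \<forall>z\<in>S. norm z \<ge> 1 \<longrightarrow>
     norm (f z - (\<Sum>j\<le>n. fps_nth p j / z ^ j)) \<le> C / norm z ^ Suc n)"

text \<open>The index pairs with \<open>i + j \<le> n\<close> make up the truncated product series;
  all others carry at least \<open>Suc n\<close> powers of \<open>w\<close>.\<close>

lemma fps_truncated_product:
  fixes w :: complex
  assumes w: "norm w \<le> 1"
  shows "norm ((\<Sum>i\<le>n. fps_nth p i * w ^ i) * (\<Sum>j\<le>n. fps_nth q j * w ^ j) - (\<Sum>k\<le>n. fps_nth (p * q) k * w ^ k))
    \<le> (\<Sum>i\<le>n. \<Sum>j\<le>n. norm (fps_nth p i * fps_nth q j)) * norm w ^ Suc n"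
proof -
  define g where "g = (\<lambda>(i, j). (fps_nth p i * w ^ i) * (fps_nth q j * w ^ j))"
  define A where "A = {..n} \<times> {..n}"
  define T where "T = {(i, j). i + j \<le> n}"
  have T: "T \<subseteq> A" "finite A" by (auto simp: T_def A_def)
  have "(\<Sum>k\<le>n. fps_nth (p * q) k * w ^ k) = (\<Sum>k\<le>n. \<Sum>i\<le>k. g (i, k - i))"
    unfolding fps_mult_nth sum_distrib_right atLeast0AtMost
    by (intro sum.cong refl) (auto simp: g_def mult_ac simp flip: power_add)
  also have "\<dots> = sum g T"
    unfolding T_def using sum.triangle_reindex_eq[of "\<lambda>i j. g (i, j)" n] by simp
  finally have 1: "(\<Sum>k\<le>n. fps_nth (p * q) k * w ^ k) = sum g T" .
  have "(\<Sum>i\<le>n. fps_nth p i * w ^ i) * (\<Sum>j\<le>n. fps_nth q j * w ^ j) = sum g A"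
    unfolding sum_product A_def sum.cartesian_product by (simp add: g_def)
  then have "norm ((\<Sum>i\<le>n. fps_nth p i * w ^ i) * (\<Sum>j\<le>n. fps_nth q j * w ^ j) - (\<Sum>k\<le>n. fps_nth (p * q) k * w ^ k))
      = norm (sum g (A - T))"
    unfolding 1 using sum_diff[OF T(2,1), of g] by simp
  also have "\<dots> \<le> (\<Sum>(i, j)\<in>A - T. norm (fps_nth p i * fps_nth q j) * norm w ^ Suc n)"
  proof (rule sum_norm_le)
    fix x assume x: "x \<in> A - T"
    obtain i j where ij: "x = (i, j)" by fastforce
    then have "norm w ^ (i + j) \<le> norm w ^ Suc n"
      using x w by (intro power_decreasing) (auto simp: T_def)
    then have "norm (fps_nth p i * fps_nth q j) * norm w ^ (i + j) \<le> norm (fps_nth p i * fps_nth q j) * norm w ^ Suc n"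
      by (intro mult_left_mono) auto
    then show "norm (g x) \<le> (case x of (i, j) \<Rightarrow> norm (fps_nth p i * fps_nth q j) * norm w ^ Suc n)"
      unfolding ij g_def by (simp add: norm_mult norm_power power_add mult_ac)
  qed
  also have "\<dots> \<le> (\<Sum>(i, j)\<in>A. norm (fps_nth p i * fps_nth q j) * norm w ^ Suc n)"
    using T by (intro sum_mono2) auto
  also have "\<dots> = (\<Sum>i\<le>n. \<Sum>j\<le>n. norm (fps_nth p i * fps_nth q j)) * norm w ^ Suc n"
    unfolding A_def by (simp only: sum.cartesian_product sum_distrib_right case_prod_unfold)
  finally show ?thesis .
qed

lemma asymp_fps_mult:
  assumes "asymp_fps S f p" "asymp_fps S g q"
  shows "asymp_fps S (\<lambda>z. f z * g z) (p * q)"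
  unfolding asymp_fps_def
proof
  fix n
  define P where "P z = (\<Sum>j\<le>n. fps_nth p j / z ^ j)" for z
  define Q where "Q z = (\<Sum>j\<le>n. fps_nth q j / z ^ j)" for z
  obtain C D where C: "\<And>z. z \<in> S \<Longrightarrow> norm z \<ge> 1 \<Longrightarrow> norm (f z - P z) \<le> C / norm z ^ Suc n"
    and D: "\<And>z. z \<in> S \<Longrightarrow> norm z \<ge> 1 \<Longrightarrow> norm (g z - Q z) \<le> D / norm z ^ Suc n"
    using assms unfolding asymp_fps_def P_def Q_def by meson
  define KP KQ KK where "KP = (\<Sum>j\<le>n. norm (fps_nth p j))" and "KQ = (\<Sum>j\<le>n. norm (fps_nth q j))"
    and "KK = (\<Sum>i\<le>n. \<Sum>j\<le>n. norm (fps_nth p i * fps_nth q j))"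
  have bound: "norm (\<Sum>j\<le>n. fps_nth r j / z ^ j) \<le> (\<Sum>j\<le>n. norm (fps_nth r j))" if "norm z \<ge> 1" for r :: "complex fps" and z :: complex
  proof (rule sum_norm_le)
    fix j
    have "norm (fps_nth r j) / norm z ^ j \<le> norm (fps_nth r j) / 1"
      using that by (intro divide_left_mono) (auto intro: less_le_trans[OF zero_less_one])
    then show "norm (fps_nth r j / z ^ j) \<le> norm (fps_nth r j)" by (simp add: norm_divide norm_power)
  qed
  show "\<exists>C. \<forall>z\<in>S. norm z \<ge> 1 \<longrightarrow> norm (f z * g z - (\<Sum>j\<le>n. fps_nth (p * q) j / z ^ j)) \<le> C / norm z ^ Suc n"
  proof (intro exI ballI impI)
    fix z assume z: "z \<in> S" "norm z \<ge> 1"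
    define e where "e = 1 / norm z ^ Suc n"
    have "1 / norm z ^ Suc n \<le> 1 / 1" using one_le_power[OF z(2), of "Suc n"] by (intro frac_le) (auto simp del: power_Suc)
    then have e: "0 \<le> e" "e \<le> 1" by (auto simp: e_def simp del: power_Suc)
    have Cz: "norm (f z - P z) \<le> C * e" and Dz: "norm (g z - Q z) \<le> D * e"
      using C[OF z] D[OF z] by (simp_all add: e_def)
    have "1 / norm z \<le> 1 / 1" using z by (intro frac_le) auto
    then have "norm (1 / z) \<le> 1" by (simp add: norm_divide)
    from fps_truncated_product[OF this, where n = n and p = p and q = q]
    have 3: "norm (P z * Q z - (\<Sum>j\<le>n. fps_nth (p * q) j / z ^ j)) \<le> KK * e"
      by (simp add: P_def Q_def KK_def e_def power_divide norm_divide norm_power)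
    \<comment> \<open>Split \<open>f = P + a\<close> and \<open>g = Q + b\<close>: the terms
      \<open>a Q\<close> and \<open>P b\<close> and the truncation defect are of order
      \<open>e\<close>, and in \<open>a b\<close> one of the two factors \<open>e\<close> is dropped
      by \<open>e \<le> 1\<close>.\<close>
    have "norm (f z * g z - (\<Sum>j\<le>n. fps_nth (p * q) j / z ^ j))
      = norm ((f z - P z) * (g z - Q z) + (f z - P z) * Q z + P z * (g z - Q z) + (P z * Q z - (\<Sum>j\<le>n. fps_nth (p * q) j / z ^ j)))"
      by (simp add: algebra_simps)
    also have "\<dots> \<le> norm ((f z - P z) * (g z - Q z)) + norm ((f z - P z) * Q z) + norm (P z * (g z - Q z))
       + norm (P z * Q z - (\<Sum>j\<le>n. fps_nth (p * q) j / z ^ j))"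
      by (intro norm_triangle_mono norm_triangle_ineq order_refl)
    also have "\<dots> \<le> (\<bar>C\<bar> * e) * \<bar>D\<bar> + (\<bar>C\<bar> * e) * KQ + KP * (\<bar>D\<bar> * e) + KK * e"
    proof (intro add_mono 3)
      have C': "norm (f z - P z) \<le> \<bar>C\<bar> * e" and D': "norm (g z - Q z) \<le> \<bar>D\<bar> * e"
        using order_trans[OF Cz mult_right_mono[OF abs_ge_self e(1)]]
          order_trans[OF Dz mult_right_mono[OF abs_ge_self e(1)]] by simp_all
      have D'': "norm (g z - Q z) \<le> \<bar>D\<bar>"
        using D' mult_left_mono[OF e(2), of "\<bar>D\<bar>"] by simp
      show "norm ((f z - P z) * (g z - Q z)) \<le> \<bar>C\<bar> * e * \<bar>D\<bar>"
        unfolding norm_mult using C' D'' e(1) by (intro mult_mono) auto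
      show "norm ((f z - P z) * Q z) \<le> \<bar>C\<bar> * e * KQ"
        unfolding norm_mult using C' bound[OF z(2), of q] e(1) by (intro mult_mono) (auto simp: Q_def KQ_def)
      show "norm (P z * (g z - Q z)) \<le> KP * (\<bar>D\<bar> * e)"
        unfolding norm_mult using D' bound[OF z(2), of p] e(1)
        by (intro mult_mono) (auto simp: P_def KP_def intro: sum_nonneg)
    qed
    also have "\<dots> = (\<bar>C\<bar> * \<bar>D\<bar> + \<bar>C\<bar> * KQ + KP * \<bar>D\<bar> + KK) / norm z ^ Suc n"
      by (simp add: e_def add_divide_distrib)
    finally show "norm (f z * g z - (\<Sum>j\<le>n. fps_nth (p * q) j / z ^ j))
      \<le> (\<bar>C\<bar> * \<bar>D\<bar> + \<bar>C\<bar> * KQ + KP * \<bar>D\<bar> + KK) / norm z ^ Suc n" .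
  qed
qed

section \<open>The product of the two branches on the closed quadrant\<close>

definition quadrant :: "complex set" where
  "quadrant = {z. z \<noteq> 0 \<and> Re z \<ge> 0 \<and> Im z \<ge> 0}"

lemma Re_mult_hankel_p_square: "Re (z * hankel_p\<^sup>2) = (Re z + Im z) / sqrt 2"
  by (simp add: hankel_p_square cos_45 sin_45 field_simps)

text \<open>Multiplication by \<open>hankel_p\<^sup>2 = cis (- pi / 4)\<close> turns the quadrant
  into the sector of half-angle \<open>pi / 4\<close> about the positive axis.\<close>

lemma quadrant_bounds:
  assumes "z \<in> quadrant"
  shows "norm z > 0" "norm z / sqrt 2 \<le> Re (z * hankel_p\<^sup>2)" "Re (z * hankel_p\<^sup>2) > 0"
proof -
  show "norm z > 0" using assms by (simp add: quadrant_def)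
  have "norm z \<le> Re z + Im z" using assms cmod_le[of z] by (simp add: quadrant_def)
  then show le: "norm z / sqrt 2 \<le> Re (z * hankel_p\<^sup>2)"
    unfolding Re_mult_hankel_p_square by (simp add: divide_right_mono)
  have "0 < norm z / sqrt 2" using \<open>norm z > 0\<close> by simp
  with le show "Re (z * hankel_p\<^sup>2) > 0" by linarith
qed

text \<open>Hence \<open>- z * hankel_q\<^sup>2 = z * hankel_p\<^sup>2\<close>: both Hankel
  integrals are evaluated at the same point.\<close>

lemma hankel_q_square_eq: "hankel_q\<^sup>2 = - (hankel_p\<^sup>2)"
proof -
  have "cis pi * cis (- pi / 4) = cis (3 * pi / 4)"
    unfolding cis_mult by (rule arg_cong[of _ _ cis]) simp
  then show ?thesis unfolding hankel_p_square hankel_q_square by simp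
qed

lemma hankel_p_times_q: "hankel_p * hankel_q = \<i> * hankel_p\<^sup>2"
proof -
  have "hankel_p * hankel_q = cis (pi / 4)"
    unfolding hankel_p_def hankel_q_def cis_mult by (rule arg_cong[of _ _ cis]) simp
  moreover have "pi / 2 + - pi / 4 = pi / 4" by simp
  then have "cis (pi / 2) * hankel_p\<^sup>2 = cis (pi / 4)"
    unfolding hankel_p_square cis_mult by (simp only:)
  ultimately show ?thesis by simp
qed

lemma hankel_square_conditions:
  "norm (hankel_p\<^sup>2) = 1" "Re (hankel_p\<^sup>2) > -1" "norm (hankel_q\<^sup>2) = 1" "Re (hankel_q\<^sup>2) > -1"
  using unit_square_Re_gt[of hankel_p] unit_square_Re_gt[of hankel_q] Re_hankel_pq by (auto simp: norm_power)

definition bessel_kk :: "complex \<Rightarrow> complex" where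
  "bessel_kk z = bessel_k1 z * bessel_k2 z"

lemma bessel_kk_eq:
  "bessel_kk z = 4 * (hankel_p * hankel_q) * (hankel_int (hankel_p\<^sup>2) (z * hankel_p\<^sup>2) * hankel_int (hankel_q\<^sup>2) (z * hankel_p\<^sup>2))"
proof -
  have "exp (- z) * exp z = 1" by (simp flip: exp_add)
  moreover have "bessel_kk z = (exp (- z) * exp z) * (4 * (hankel_p * hankel_q) *
     (hankel_int (hankel_p\<^sup>2) (z * hankel_p\<^sup>2) * hankel_int (hankel_q\<^sup>2) (- z * hankel_q\<^sup>2)))"
    unfolding bessel_kk_def bessel_k1_def bessel_k2_def by (simp add: mult_ac)
  ultimately show ?thesis by (simp add: hankel_q_square_eq)
qed

text \<open>Each Hankel integral is normalised by \<open>csqrt s / K\<close> at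
  \<open>s = z * hankel_p\<^sup>2\<close>. In the product, \<open>(csqrt s)\<^sup>2 = s\<close>,
  \<open>K\<^sup>2 = pi / 8\<close> and \<open>hankel_p * hankel_q = \<i> * hankel_p\<^sup>2\<close>
  combine to the prefactor, the unit \<open>hankel_p\<^sup>2\<close> cancelling.\<close>

lemma bessel_kk_expansion:
  obtains h where "asymp_fps quadrant h (Abs_fps (\<lambda>j. bessel_coeff j / 64 ^ j) oo fps_X\<^sup>2)"
    and "\<And>z. z \<in> quadrant \<Longrightarrow> bessel_kk z = \<i> * of_real (pi / 2) / z * h z"
proof -
  define K :: complex where "K = of_real (sqrt pi / 2 / sqrt 2)"
  have K: "K \<noteq> 0" "K\<^sup>2 = of_real (pi / 8)"
    by (simp_all add: K_def power_divide flip: of_real_power)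
  define f where "f c z = hankel_int c (z * hankel_p\<^sup>2) * csqrt (z * hankel_p\<^sup>2) / K" for c z
  \<comment> \<open>Used with \<open>c = hankel_p\<^sup>2\<close>, \<open>d = -1\<close> and with
    \<open>c = hankel_q\<^sup>2\<close>, \<open>d = 1\<close>: the rotation drops out of
    \<open>- c / s\<close>.\<close>
  have as: "asymp_fps quadrant (f c) (hankel_fps d)"
    if c: "norm c = 1" "Re c > -1" and d: "\<And>z. z \<noteq> 0 \<Longrightarrow> - c / (z * hankel_p\<^sup>2) = d / z" for c d
    unfolding asymp_fps_def
  proof
    fix n
    obtain B where B: "\<And>s. Re s > 0 \<Longrightarrow> norm (hankel_int c s -
      K / csqrt s * (\<Sum>j\<le>n. (-1) ^ j * hankel_coeff j * (c / s) ^ j)) \<le> B / (sqrt (Re s) * Re s ^ Suc n)"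
      using hankel_int_expansion[OF c, of n] unfolding K_def by blast
    have B0: "B \<ge> 0"
      using order_trans[OF norm_ge_zero B[of 1]] by simp
    show "\<exists>C. \<forall>z\<in>quadrant. norm z \<ge> 1 \<longrightarrow> norm (f c z - (\<Sum>j\<le>n. fps_nth (hankel_fps d) j / z ^ j)) \<le> C / norm z ^ Suc n"
    proof (intro exI ballI impI)
      fix z assume z: "z \<in> quadrant"
      define s where "s = z * hankel_p\<^sup>2"
      note q = quadrant_bounds[OF z, folded s_def]
      have s: "norm s = norm z" by (simp add: s_def norm_mult norm_power)
      then have s0: "s \<noteq> 0" "z \<noteq> 0" using q by auto
      have "(\<Sum>j\<le>n. fps_nth (hankel_fps d) j / z ^ j) = (\<Sum>j\<le>n. (-1) ^ j * hankel_coeff j * (c / s) ^ j)"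
      proof (rule sum.cong[OF refl])
        fix j
        have "(-1) ^ j * (c / s) ^ j = (- c / s) ^ j" by (simp flip: power_mult_distrib)
        also have "\<dots> = (d / z) ^ j" using d[OF s0(2)] by (simp add: s_def)
        finally have "hankel_coeff j * ((-1) ^ j * (c / s) ^ j) = hankel_coeff j * (d / z) ^ j" by simp
        then show "fps_nth (hankel_fps d) j / z ^ j = (-1) ^ j * hankel_coeff j * (c / s) ^ j"
          by (simp add: hankel_fps_def power_divide mult.assoc mult.left_commute[of "(-1) ^ j"] mult.commute[of "d ^ j"])
      qed
      then have "f c z - (\<Sum>j\<le>n. fps_nth (hankel_fps d) j / z ^ j) = csqrt s / K * (hankel_int c s -
          K / csqrt s * (\<Sum>j\<le>n. (-1) ^ j * hankel_coeff j * (c / s) ^ j))"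
        using K(1) s0 by (simp add: f_def s_def[symmetric] field_simps)
      then have "norm (f c z - (\<Sum>j\<le>n. fps_nth (hankel_fps d) j / z ^ j)) = sqrt (norm z) / norm K * norm (hankel_int c s -
          K / csqrt s * (\<Sum>j\<le>n. (-1) ^ j * hankel_coeff j * (c / s) ^ j))"
        by (simp only: norm_mult norm_divide norm_csqrt s)
      also have "\<dots> \<le> sqrt (norm z) / norm K * (B / (sqrt (norm z / sqrt 2) * (norm z / sqrt 2) ^ Suc n))"
      proof (intro mult_left_mono order_trans[OF B[OF q(3)]] divide_left_mono B0)
        show "sqrt (norm z / sqrt 2) * (norm z / sqrt 2) ^ Suc n \<le> sqrt (Re s) * Re s ^ Suc n"
          using q by (intro mult_mono power_mono) auto
        show "0 < sqrt (Re s) * Re s ^ Suc n * (sqrt (norm z / sqrt 2) * (norm z / sqrt 2) ^ Suc n)"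
          using q by (intro mult_pos_pos) auto
      qed auto
      also have "\<dots> = (1 / norm K * B * sqrt (sqrt 2) * sqrt 2 ^ Suc n) / norm z ^ Suc n"
        using q(1) by (simp add: real_sqrt_divide power_divide field_simps)
      finally show "norm (f c z - (\<Sum>j\<le>n. fps_nth (hankel_fps d) j / z ^ j))
         \<le> (1 / norm K * B * sqrt (sqrt 2) * sqrt 2 ^ Suc n) / norm z ^ Suc n" .
    qed
  qed
  have p0: "hankel_p\<^sup>2 \<noteq> 0" using hankel_square_conditions(1) by auto
  have "asymp_fps quadrant (\<lambda>z. f (hankel_p\<^sup>2) z * f (hankel_q\<^sup>2) z) (hankel_fps (-1) * hankel_fps 1)"
    by (intro asymp_fps_mult as hankel_square_conditions) (use p0 in \<open>simp_all add: hankel_q_square_eq\<close>)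
  moreover have "bessel_kk z = \<i> * of_real (pi / 2) / z * (f (hankel_p\<^sup>2) z * f (hankel_q\<^sup>2) z)" if "z \<in> quadrant" for z
  proof -
    define s where "s = z * hankel_p\<^sup>2"
    have z0: "z \<noteq> 0" using that by (simp add: quadrant_def)
    have "f (hankel_p\<^sup>2) z * f (hankel_q\<^sup>2) z = hankel_int (hankel_p\<^sup>2) s * hankel_int (hankel_q\<^sup>2) s * (csqrt s)\<^sup>2 / K\<^sup>2"
      by (simp add: f_def s_def power2_eq_square mult_ac)
    also have "\<dots> = hankel_int (hankel_p\<^sup>2) s * hankel_int (hankel_q\<^sup>2) s * s * of_real (8 / pi)"
      unfolding K(2) by simp
    finally have "\<i> * of_real (pi / 2) / z * (f (hankel_p\<^sup>2) z * f (hankel_q\<^sup>2) z) =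
       4 * (\<i> * hankel_p\<^sup>2) * (hankel_int (hankel_p\<^sup>2) s * hankel_int (hankel_q\<^sup>2) s)"
      using z0 by (simp add: s_def)
    then show ?thesis unfolding bessel_kk_eq hankel_p_times_q s_def by simp
  qed
  ultimately show ?thesis
    using that unfolding hankel_fps_product by blast
qed

text \<open>Crude near 0, where the growth is only logarithmic, but sufficient: the fourth power is
  \<open>O(|z|^-2)\<close> and meets at least three powers of \<open>z\<close>.\<close>

lemma bessel_kk_bound: "\<exists>C. \<forall>z\<in>quadrant. norm (bessel_kk z) \<le> C / sqrt (norm z)"
proof -
  obtain A B where A: "\<And>s. Re s > 0 \<Longrightarrow> norm (hankel_int (hankel_p\<^sup>2) s) \<le> A / sqrt (sqrt (Re s))"
    and B: "\<And>s. Re s > 0 \<Longrightarrow> norm (hankel_int (hankel_q\<^sup>2) s) \<le> B / sqrt (sqrt (Re s))"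
    using hankel_int_bound_small[OF hankel_square_conditions(1,2)] hankel_int_bound_small[OF hankel_square_conditions(3,4)] by blast
  have AB: "A \<ge> 0" "B \<ge> 0"
    using order_trans[OF norm_ge_zero A[of 1]] order_trans[OF norm_ge_zero B[of 1]] by simp_all
  have "norm (bessel_kk z) \<le> (4 * A * B * sqrt (sqrt 2)) / sqrt (norm z)" if "z \<in> quadrant" for z
  proof -
    note q = quadrant_bounds[OF that]
    have "norm (bessel_kk z) = 4 * (norm (hankel_int (hankel_p\<^sup>2) (z * hankel_p\<^sup>2)) * norm (hankel_int (hankel_q\<^sup>2) (z * hankel_p\<^sup>2)))"
      unfolding bessel_kk_eq by (simp add: norm_mult)
    also have "\<dots> \<le> 4 * (A / sqrt (sqrt (Re (z * hankel_p\<^sup>2))) * (B / sqrt (sqrt (Re (z * hankel_p\<^sup>2)))))"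
      using A[OF q(3)] B[OF q(3)] AB q(3) by (intro mult_left_mono mult_mono) auto
    also have "\<dots> = 4 * A * B / sqrt (Re (z * hankel_p\<^sup>2))"
      using q(3) by (simp add: field_simps)
    also have "\<dots> \<le> 4 * A * B / sqrt (norm z / sqrt 2)"
      using q AB by (intro divide_left_mono mult_pos_pos) auto
    also have "\<dots> = (4 * A * B * sqrt (sqrt 2)) / sqrt (norm z)"
      by (simp add: real_sqrt_divide)
    finally show ?thesis .
  qed
  then show ?thesis by blast
qed

section \<open>The contour argument\<close>

lemma fps_nth_power_scaled:
  "fps_nth (Abs_fps (\<lambda>j. of_real (c ^ j * a j)) ^ k) i = (of_real (c ^ i * fps_nth (Abs_fps a ^ k) i) :: 'a::real_normed_field)"
proof (induction k arbitrary: i)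
  case (Suc k)
  show ?case
    unfolding power_Suc fps_mult_nth Suc.IH sum_distrib_left of_real_sum
    by (intro sum.cong refl) (simp add: algebra_simps flip: of_real_mult power_add)
qed simp

lemma sum_atMost_double:
  fixes f :: "nat \<Rightarrow> 'a::comm_monoid_add"
  assumes "\<And>k. odd k \<Longrightarrow> f k = 0"
  shows "(\<Sum>j\<le>2 * N. f j) = (\<Sum>i\<le>N. f (2 * i))"
  by (induction N) (simp_all add: assms)

text \<open>\<open>bessel_fps\<close> is a series in \<open>1/(2z)^2\<close>; the factor
  \<open>(1/4)^i\<close> passes to the variable \<open>1/z^2\<close>.\<close>

definition expansion_coeff :: "nat \<Rightarrow> real" where
  "expansion_coeff i = (1 / 4) ^ i * fps_nth (bessel_fps ^ 4) i"

definition moment_integrand :: "nat \<Rightarrow> complex \<Rightarrow> complex" where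
  "moment_integrand N z = bessel_kk z ^ 4 * z ^ (2 * N + 3)"

text \<open>The expansion of the integrand down to the term \<open>1/z\<close>, which is the summand
  \<open>i = N\<close>.\<close>

definition moment_principal :: "nat \<Rightarrow> complex \<Rightarrow> complex" where
  "moment_principal N z = of_real ((pi / 2) ^ 4) * (\<Sum>i\<le>N. of_real (expansion_coeff i) * z ^ (2 * (N - i)) / z)"

text \<open>The fourth power of the series is cut at order \<open>2 * N\<close>; its error
  \<open>O(|z|^(-2N-1))\<close> is multiplied by \<open>|z|^(2N-1)\<close>. The constant
  \<open>(pi / 2)^4\<close> has no phase because \<open>\<i>^4 = 1\<close>.\<close>

lemma moment_integrand_expansion:
  "\<exists>C. \<forall>z\<in>quadrant. norm z \<ge> 1 \<longrightarrow> norm (moment_integrand N z - moment_principal N z) \<le> C / (norm z)\<^sup>2"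
proof -
  define g :: "complex fps" where "g = Abs_fps (\<lambda>j. bessel_coeff j / 64 ^ j)"
  obtain h where h: "asymp_fps quadrant h (g oo fps_X\<^sup>2)"
    and kk: "\<And>z. z \<in> quadrant \<Longrightarrow> bessel_kk z = \<i> * of_real (pi / 2) / z * h z"
    using bessel_kk_expansion unfolding g_def by blast
  have h2: "asymp_fps quadrant (\<lambda>z. h z * h z) ((g oo fps_X\<^sup>2) * (g oo fps_X\<^sup>2))"
    by (rule asymp_fps_mult[OF h h])
  have "(g oo fps_X\<^sup>2) * (g oo fps_X\<^sup>2) * ((g oo fps_X\<^sup>2) * (g oo fps_X\<^sup>2)) = (g oo fps_X\<^sup>2) ^ 4"
    by (simp add: eval_nat_numeral)
  also have "\<dots> = g ^ 4 oo fps_X\<^sup>2"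
    by (rule fps_compose_power) simp
  finally have h4: "asymp_fps quadrant (\<lambda>z. h z * h z * (h z * h z)) (g ^ 4 oo fps_X\<^sup>2)"
    using asymp_fps_mult[OF h2 h2] by simp
  have g4: "fps_nth (g ^ 4) i = of_real (expansion_coeff i)" for i
  proof -
    have "g = Abs_fps (\<lambda>j. of_real ((1 / 4) ^ j * (bessel_coeff j / 16 ^ j)))"
      unfolding g_def
    proof (rule arg_cong[of _ _ Abs_fps], rule ext)
      fix j
      have "(64 :: complex) ^ j = 4 ^ j * 16 ^ j" by (simp flip: power_mult_distrib)
      then show "bessel_coeff j / 64 ^ j = (of_real ((1 / 4) ^ j * (bessel_coeff j / 16 ^ j)) :: complex)"
        by (simp add: bessel_coeff_def power_divide)
    qed
    then show ?thesis
      unfolding expansion_coeff_def bessel_fps_def by (simp only: fps_nth_power_scaled)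
  qed
  define \<kappa> where "\<kappa> = (pi / 2) ^ 4"
  have \<kappa>: "\<kappa> \<ge> 0" by (simp add: \<kappa>_def)
  obtain C where C: "\<And>z. z \<in> quadrant \<Longrightarrow> norm z \<ge> 1 \<Longrightarrow>
      norm (h z * h z * (h z * h z) - (\<Sum>j\<le>2 * N. fps_nth (g ^ 4 oo fps_X\<^sup>2) j / z ^ j)) \<le> C / norm z ^ Suc (2 * N)"
    using h4 unfolding asymp_fps_def by meson
  have "norm (moment_integrand N z - moment_principal N z) \<le> (\<kappa> * C) / (norm z)\<^sup>2"
    if z: "z \<in> quadrant" "norm z \<ge> 1" for z
  proof -
    have z0: "z \<noteq> 0" using z by auto
    have "(\<Sum>j\<le>2 * N. fps_nth (g ^ 4 oo fps_X\<^sup>2) j / z ^ j) = (\<Sum>i\<le>N. of_real (expansion_coeff i) / z ^ (2 * i))"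
      by (subst sum_atMost_double) (simp_all add: fps_nth_compose_X2 g4)
    then have *: "norm (h z * h z * (h z * h z) - (\<Sum>i\<le>N. of_real (expansion_coeff i) / z ^ (2 * i))) \<le> C / norm z ^ Suc (2 * N)"
      using C[OF z] by simp
    have "moment_integrand N z = of_real \<kappa> * (z ^ (2 * N) / z) * (h z * h z * (h z * h z))"
    proof -
      have e1: "(\<i> * of_real (pi / 2) / z * h z) ^ 4 = of_real \<kappa> / z ^ 4 * (h z * h z * (h z * h z))"
      proof -
        have "\<i> ^ 4 = 1" and "h z ^ 4 = h z * h z * (h z * h z)"
          by (simp_all add: eval_nat_numeral)
        then show ?thesis
          by (simp only: \<kappa>_def power_mult_distrib power_divide of_real_power) (simp add: power_divide)
      qed
      have e2: "z ^ (2 * N + 3) / z ^ 4 = z ^ (2 * N) / z"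
        using z0 by (simp add: power_add eval_nat_numeral)
      have "moment_integrand N z = of_real \<kappa> * (z ^ (2 * N + 3) / z ^ 4) * (h z * h z * (h z * h z))"
        unfolding moment_integrand_def kk[OF z(1)] e1 by simp
      then show ?thesis unfolding e2 .
    qed
    moreover have "moment_principal N z = of_real \<kappa> * (z ^ (2 * N) / z) * (\<Sum>i\<le>N. of_real (expansion_coeff i) / z ^ (2 * i))"
    proof -
      have "of_real (expansion_coeff i) * z ^ (2 * (N - i)) / z = z ^ (2 * N) / z * (of_real (expansion_coeff i) / z ^ (2 * i))" if "i \<le> N" for i
      proof -
        have "2 * N = 2 * (N - i) + 2 * i" using that by simp
        then have "z ^ (2 * N) = z ^ (2 * (N - i)) * z ^ (2 * i)" by (metis power_add)
        then show ?thesis using z0 by simp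
      qed
      then show ?thesis unfolding moment_principal_def \<kappa>_def sum_distrib_left mult.assoc
        by (intro sum.cong refl) simp
    qed
    ultimately have "moment_integrand N z - moment_principal N z = of_real \<kappa> * (z ^ (2 * N) / z) *
        (h z * h z * (h z * h z) - (\<Sum>i\<le>N. of_real (expansion_coeff i) / z ^ (2 * i)))"
      by (simp only: right_diff_distrib)
    then have "norm (moment_integrand N z - moment_principal N z) = \<kappa> * (norm z ^ (2 * N) / norm z) *
        norm (h z * h z * (h z * h z) - (\<Sum>i\<le>N. of_real (expansion_coeff i) / z ^ (2 * i)))"
      using \<kappa> by (simp only: norm_mult norm_divide norm_power norm_of_real abs_of_nonneg)
    also have "\<dots> \<le> \<kappa> * (norm z ^ (2 * N) / norm z) * (C / norm z ^ Suc (2 * N))"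
      using \<kappa> by (intro mult_left_mono *) auto
    also have "\<dots> = (\<kappa> * C) / (norm z)\<^sup>2"
      using z0 by (simp add: power2_eq_square)
    finally show ?thesis .
  qed
  then show ?thesis by blast
qed

text \<open>The half-plane \<open>Re z + Im z > 0\<close>: open, convex, and containing both
  half-axes in its interior, so the integrand has a primitive there and Cauchy's theorem reduces to
  differences of that primitive.\<close>

definition hankel_halfplane :: "complex set" where
  "hankel_halfplane = {z. Re (z * hankel_p\<^sup>2) > 0}"

lemma hankel_halfplane_eq: "hankel_halfplane = {z. inner (Complex 1 1) z > 0}"
  unfolding hankel_halfplane_def Re_mult_hankel_p_square
  by (auto simp: inner_complex_def zero_less_divide_iff)

lemma hankel_halfplane: "open hankel_halfplane" "convex hankel_halfplane" "quadrant \<subseteq> hankel_halfplane"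
proof -
  show "open hankel_halfplane" "convex hankel_halfplane"
    unfolding hankel_halfplane_eq by (rule open_halfspace_gt, rule convex_halfspace_gt)
  show "quadrant \<subseteq> hankel_halfplane"
    unfolding hankel_halfplane_def using quadrant_bounds(3) by blast
qed

lemma bessel_kk_holomorphic: "bessel_kk holomorphic_on hankel_halfplane"
proof -
  have *: "(\<lambda>z. hankel_int c (z * hankel_p\<^sup>2)) holomorphic_on hankel_halfplane" if "norm c = 1" "Re c > -1" for c
  proof -
    have "(\<lambda>z. z * hankel_p\<^sup>2) holomorphic_on hankel_halfplane" by (intro holomorphic_intros)
    from holomorphic_on_compose_gen[OF this hankel_int_holomorphic[OF that]] show ?thesis
      unfolding o_def hankel_halfplane_def by blast
  qed
  then show ?thesis
    unfolding bessel_kk_eq[abs_def] by (intro holomorphic_intros * hankel_square_conditions)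
qed

lemma moment_integrand_holomorphic: "moment_integrand N holomorphic_on hankel_halfplane"
  unfolding moment_integrand_def[abs_def] by (intro holomorphic_intros bessel_kk_holomorphic)

lemma of_real_in_quadrant: "t > 0 \<Longrightarrow> of_real t \<in> quadrant" "t > 0 \<Longrightarrow> \<i> * of_real t \<in> quadrant"
  by (auto simp: quadrant_def)

lemma Im_moment_integrand:
  assumes t: "t > 0"
  shows "Im (moment_integrand N (of_real t)) =
    - 4 * pi * (((pi * bessel_I0 t)\<^sup>2 - (bessel_K0 t)\<^sup>2) * bessel_I0 t * bessel_K0 t ^ 5 * t ^ (2 * N + 3))"
proof -
  define a b where "a = bessel_K0 t" and "b = pi * bessel_I0 t"
  have "moment_integrand N (of_real t) = of_real (a ^ 4 * t ^ (2 * N + 3)) * (Complex a b) ^ 4"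
    unfolding moment_integrand_def bessel_kk_def bessel_k1_of_real[OF t] bessel_k2_of_real[OF t]
    by (simp add: a_def b_def power_mult_distrib)
  also have "Im \<dots> = a ^ 4 * t ^ (2 * N + 3) * Im ((Complex a b) ^ 4)"
    by (simp only: Im_complex_of_real Re_complex_of_real times_complex.sel)
  also have "Im ((Complex a b) ^ 4) = 4 * a * b * (a\<^sup>2 - b\<^sup>2)"
    by (simp add: eval_nat_numeral algebra_simps)
  also have "a ^ 4 * t ^ (2 * N + 3) * (4 * a * b * (a\<^sup>2 - b\<^sup>2)) = - 4 * (b\<^sup>2 - a\<^sup>2) * b * a ^ 5 * t ^ (2 * N + 3)"
    by (simp add: eval_nat_numeral algebra_simps)
  finally show ?thesis by (simp add: a_def b_def algebra_simps)
qed

text \<open>The extra \<open>\<i>\<close> is \<open>dz/dy\<close> on the axis.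
  \<open>bessel_kk\<close> is a squared modulus there, and \<open>\<i>\<close> times
  \<open>\<i> ^ (2 * N + 3)\<close> is a sign.\<close>

lemma moment_integrand_imaginary:
  assumes y: "y > 0"
  shows "Im (\<i> * moment_integrand N (\<i> * of_real y)) = 0"
proof -
  have "bessel_kk (\<i> * of_real y) = of_real ((norm (bessel_k1 (\<i> * of_real y)))\<^sup>2)"
    unfolding bessel_kk_def bessel_k2_imaginary[OF y] by (rule complex_norm_square[symmetric])
  moreover have "\<i> * (\<i> * of_real y) ^ (2 * N + 3) = of_real ((-1) ^ N * y ^ (2 * N + 3))"
  proof -
    have "\<i> * (\<i> * of_real y) ^ (2 * N + 3) = (\<i> * \<i> ^ (2 * N + 3)) * of_real (y ^ (2 * N + 3))"
      by (simp only: power_mult_distrib of_real_power mult.assoc)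
    also have "\<i> * \<i> ^ (2 * N + 3) = (\<i>\<^sup>2) ^ (N + 2)"
      unfolding power_mult[symmetric] power_Suc[symmetric] by (rule arg_cong[of _ _ "(^) \<i>"]) simp
    also have "\<dots> = of_real ((-1) ^ N)" by simp
    finally show ?thesis by simp
  qed
  ultimately have "\<i> * moment_integrand N (\<i> * of_real y) =
      of_real (((norm (bessel_k1 (\<i> * of_real y)))\<^sup>2) ^ 4 * ((-1) ^ N * y ^ (2 * N + 3)))"
    unfolding moment_integrand_def by (simp only: of_real_power of_real_mult) (simp add: mult_ac)
  then show ?thesis by (simp only: Im_complex_of_real)
qed

text \<open>The quarter circle is replaced by its chord, on which the modulus is still comparable to
  \<open>R\<close>.\<close>

lemma closed_segment_quadrant:
  assumes "R > 0" "z \<in> closed_segment (of_real R) (\<i> * of_real R)"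
  shows "z \<in> quadrant" "norm z \<le> R" "R / sqrt 2 \<le> norm z"
proof -
  obtain u where u: "0 \<le> u" "u \<le> 1" "z = (1 - u) *\<^sub>R of_real R + u *\<^sub>R (\<i> * of_real R)"
    using assms(2) by (auto simp: closed_segment_def)
  then have ri: "Re z = (1 - u) * R" "Im z = u * R" by simp_all
  have nn: "Re z \<ge> 0" "Im z \<ge> 0" "Re z + Im z = R"
    unfolding ri using u(1,2) assms(1) by (simp_all add: left_diff_distrib)
  then show q: "z \<in> quadrant" using assms(1) by (auto simp: quadrant_def)
  show "norm z \<le> R" using cmod_le[of z] nn by simp
  have "R / sqrt 2 = Re (z * hankel_p\<^sup>2)" unfolding Re_mult_hankel_p_square nn(3) ..
  also have "\<dots> \<le> norm (z * hankel_p\<^sup>2)" by (rule complex_Re_le_cmod)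
  finally show "R / sqrt 2 \<le> norm z" by (simp add: norm_mult norm_power)
qed

lemma segment_difference_bound:
  assumes R: "R > 0" and F: "\<And>z. z \<in> quadrant \<Longrightarrow> (F has_field_derivative f z) (at z)"
    and B: "\<And>z. z \<in> closed_segment (of_real R) (\<i> * of_real R) \<Longrightarrow> norm (f z) \<le> B"
  shows "norm (F (\<i> * of_real R) - F (of_real R)) \<le> 2 * B * R"
proof -
  have "norm (F (\<i> * of_real R) - F (of_real R)) \<le> B * norm (\<i> * of_real R - of_real R)"
    by (rule field_differentiable_bound[OF convex_closed_segment[of "of_real R" "\<i> * of_real R"], where f' = f])
       (use closed_segment_quadrant(1)[OF R] F B in \<open>auto intro: has_field_derivative_at_within\<close>)
  also have "\<dots> \<le> B * (2 * R)"
    using norm_triangle_ineq4[of "\<i> * of_real R" "of_real R"] R order_trans[OF norm_ge_zero B[of "of_real R"]]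
    by (intro mult_left_mono) (auto simp: norm_mult)
  finally show ?thesis by (simp add: mult_ac)
qed

section \<open>Integrability on the positive real axis\<close>

lemma set_integrable_power_times_exp:
  "set_integrable lborel {0<..} (\<lambda>x::real. x ^ k * exp (- x))"
proof (rule set_integrable_subset[of lborel "{0..}"])
  have "integrable lborel (\<lambda>x::real. x ^ k * exp (- x) * indicator {0..} x)"
  proof (rule integrableI_nn_integral_finite)
    show "(\<integral>\<^sup>+x. ennreal (x ^ k * exp (- x) * indicator {0..} x) \<partial>lborel) = ennreal (real (fact k))"
    proof -
      have "(\<integral>\<^sup>+x. ennreal (x ^ k * exp (- x) * indicator {0..} x) \<partial>lborel)
          = (\<integral>\<^sup>+x. ennreal (x ^ k * exp (- x)) * indicator {0..} x \<partial>lborel)"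
        by (intro nn_integral_cong) (simp split: split_indicator)
      then show ?thesis unfolding nn_intergal_power_times_exp_Ici by simp
    qed
  qed (auto simp: indicator_def)
  then show "set_integrable lborel {0..} (\<lambda>x::real. x ^ k * exp (- x))"
    by (simp add: set_integrable_def mult.commute)
qed auto

lemma norm_k1_bound: "\<exists>A. \<forall>t>0. (norm (bessel_k1 (of_real t)))\<^sup>2 \<le> A * exp (- t) / sqrt t"
proof -
  obtain A where A: "\<And>s. Re s > 0 \<Longrightarrow> norm (hankel_int (hankel_p\<^sup>2) s) \<le> A / sqrt (sqrt (Re s))"
    using hankel_int_bound_small[OF hankel_square_conditions(1,2)] by blast
  have A0: "A \<ge> 0" using order_trans[OF norm_ge_zero A[of 1]] by simp
  have "(norm (bessel_k1 (of_real t)))\<^sup>2 \<le> (4 * A\<^sup>2 * sqrt (sqrt 2)) * exp (- t) / sqrt t" if t: "t > 0" for t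
  proof -
    define r where "r = Re (of_real t * hankel_p\<^sup>2)"
    have r: "r = t / sqrt 2" unfolding r_def Re_mult_hankel_p_square by simp
    then have r0: "r > 0" using t by simp
    have "norm (bessel_k1 (of_real t)) = 2 * exp (- t) * norm (hankel_int (hankel_p\<^sup>2) (of_real t * hankel_p\<^sup>2))"
      by (simp add: bessel_k1_def norm_mult norm_exp_eq_Re)
    also have "\<dots> \<le> 2 * exp (- t) * (A / sqrt (sqrt r))"
      using A[of "of_real t * hankel_p\<^sup>2"] r0 unfolding r_def by (intro mult_left_mono) auto
    finally have "(norm (bessel_k1 (of_real t)))\<^sup>2 \<le> (2 * exp (- t) * (A / sqrt (sqrt r)))\<^sup>2"
      by (intro power_mono) auto
    also have "\<dots> = 4 * A\<^sup>2 * (exp (- t))\<^sup>2 / sqrt r"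
      using r0 by (simp add: power_mult_distrib power_divide)
    also have "\<dots> \<le> 4 * A\<^sup>2 * exp (- t) / sqrt r"
    proof -
      have "(exp (- t))\<^sup>2 \<le> exp (- t)"
        using t mult_left_le[of "exp (- t)" "exp (- t)"] by (simp add: power2_eq_square)
      then show ?thesis using r0 by (intro divide_right_mono mult_left_mono) auto
    qed
    also have "\<dots> = (4 * A\<^sup>2 * sqrt (sqrt 2)) * exp (- t) / sqrt t"
      unfolding r by (simp add: real_sqrt_divide mult_ac)
    finally show ?thesis .
  qed
  then show ?thesis by blast
qed

lemma moment_integrand_continuous: "continuous_on {0<..} (\<lambda>t. Im (moment_integrand N (of_real t)))"
  using hankel_halfplane(3) of_real_in_quadrant(1)
  by (intro continuous_intros continuous_on_compose2[OF holomorphic_on_imp_continuous_on[OF moment_integrand_holomorphic]]) auto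

text \<open>Only the imaginary part is claimed integrable, as the real part has no exponential
  decay. The imaginary part contains \<open>K0\<close> to the fifth power and three factors bounded
  by \<open>bessel_k2\<close>: three pairs form \<open>bessel_kk ^ 3\<close>, and the remaining
  \<open>K0^2\<close> supplies \<open>exp (- t)\<close>. The square roots in the bounds cost
  \<open>t^2\<close> in total.\<close>

lemma moment_integrable:
  "set_integrable lborel {0<..} (\<lambda>t. Im (moment_integrand N (of_real t)))"
proof -
  obtain A where A: "\<And>t. t > 0 \<Longrightarrow> (norm (bessel_k1 (of_real t)))\<^sup>2 \<le> A * exp (- t) / sqrt t"
    using norm_k1_bound by blast
  obtain C where C: "\<And>z. z \<in> quadrant \<Longrightarrow> norm (bessel_kk z) \<le> C / sqrt (norm z)"
    using bessel_kk_bound by blast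
  have bd: "norm (Im (moment_integrand N (of_real t))) \<le> norm (8 * C ^ 3 * A * (t ^ (2 * N + 1) * exp (- t)))" if t: "t > 0" for t
  proof -
    define a b where "a = bessel_K0 t" and "b = pi * bessel_I0 t"
    have k1: "\<bar>a\<bar> = norm (bessel_k1 (of_real t))" unfolding bessel_k1_of_real[OF t] a_def by simp
    have k2: "\<bar>a\<bar> \<le> norm (bessel_k2 (of_real t))" "\<bar>b\<bar> \<le> norm (bessel_k2 (of_real t))"
      unfolding bessel_k2_of_real[OF t] a_def b_def
      using abs_Re_le_cmod[of "Complex (bessel_K0 t) (pi * bessel_I0 t)"] abs_Im_le_cmod[of "Complex (bessel_K0 t) (pi * bessel_I0 t)"] by auto
    define m where "m = norm (bessel_k2 (of_real t))"
    have "Im (moment_integrand N (of_real t)) = - (4 * ((b\<^sup>2 - a\<^sup>2) * b * a ^ 5 * t ^ (2 * N + 3)))"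
      unfolding Im_moment_integrand[OF t] a_def b_def by (simp add: algebra_simps)
    then have "norm (Im (moment_integrand N (of_real t))) = 4 * \<bar>b\<^sup>2 - a\<^sup>2\<bar> * \<bar>b\<bar> * \<bar>a\<bar> ^ 5 * t ^ (2 * N + 3)"
      using t by (simp add: abs_mult power_abs mult_ac)
    also have "\<dots> \<le> 4 * (2 * m\<^sup>2) * m * \<bar>a\<bar> ^ 5 * t ^ (2 * N + 3)"
    proof -
      have "a\<^sup>2 \<le> m\<^sup>2" "b\<^sup>2 \<le> m\<^sup>2"
        using power_mono[OF k2(1), of 2] power_mono[OF k2(2), of 2] by (simp_all add: m_def)
      then have "\<bar>b\<^sup>2 - a\<^sup>2\<bar> \<le> 2 * m\<^sup>2" using zero_le_power2[of a] zero_le_power2[of b] by linarith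
      then show ?thesis using k2(2) t by (intro mult_right_mono mult_mono) (auto simp: m_def)
    qed
    also have "\<dots> = 8 * (\<bar>a\<bar> * m) ^ 3 * \<bar>a\<bar>\<^sup>2 * t ^ (2 * N + 3)"
      by (simp add: eval_nat_numeral mult_ac)
    also have "\<bar>a\<bar> * m = norm (bessel_kk (of_real t))"
      by (simp add: k1 m_def bessel_kk_def norm_mult)
    also have "8 * norm (bessel_kk (of_real t)) ^ 3 * \<bar>a\<bar>\<^sup>2 * t ^ (2 * N + 3)
       \<le> 8 * (C / sqrt t) ^ 3 * (A * exp (- t) / sqrt t) * t ^ (2 * N + 3)"
    proof (intro mult_right_mono mult_mono mult_left_mono power_mono)
      show "norm (bessel_kk (of_real t)) \<le> C / sqrt t" using C[OF of_real_in_quadrant(1)[OF t]] t by simp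
      then have "0 \<le> C / sqrt t" using norm_ge_zero order_trans by blast
      then show "0 \<le> 8 * (C / sqrt t) ^ 3" by simp
      show "\<bar>a\<bar>\<^sup>2 \<le> A * exp (- t) / sqrt t" unfolding k1 by (rule A[OF t])
    qed (use t in auto)
    also have "\<dots> = 8 * C ^ 3 * A * exp (- t) * (t ^ (2 * N + 3) / (sqrt t) ^ 4)"
      by (simp add: power_divide eval_nat_numeral mult_ac)
    also have "(sqrt t) ^ 4 = t\<^sup>2" using t by (simp add: power4_eq_xxxx power2_eq_square mult.assoc)
    also have "t ^ (2 * N + 3) / t\<^sup>2 = t ^ (2 * N + 1)"
      using t by (simp add: power_add eval_nat_numeral)
    finally show ?thesis by (simp add: mult_ac)
  qed
  show ?thesis
  proof (rule set_integrable_bound)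
    show "set_integrable lborel {0<..} (\<lambda>t. 8 * C ^ 3 * A * (t ^ (2 * N + 1) * exp (- t)))"
      by (intro set_integrable_mult_right set_integrable_power_times_exp)
    show "set_borel_measurable lborel {0<..} (\<lambda>t. Im (moment_integrand N (of_real t)))"
      using borel_measurable_continuous_on_indicator[OF _ moment_integrand_continuous, of N]
      by (simp add: set_borel_measurable_def)
  qed (use bd in auto)
qed

section \<open>Evaluation of the moment integral by primitives\<close>

definition moment_primitive :: "nat \<Rightarrow> complex \<Rightarrow> complex" where
  "moment_primitive N z = of_real ((pi / 2) ^ 4) *
    ((\<Sum>i<N. of_real (expansion_coeff i / (2 * real (N - i))) * z ^ (2 * (N - i))) + of_real (expansion_coeff N) * Ln z)"

lemma moment_primitive_deriv:
  assumes z: "z \<in> quadrant"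
  shows "(moment_primitive N has_field_derivative moment_principal N z) (at z)"
proof -
  have z0: "z \<noteq> 0" "z \<notin> \<real>\<^sub>\<le>\<^sub>0"
    using z by (auto simp: quadrant_def complex_nonpos_Reals_iff complex_eq_iff)
  have 1: "((\<lambda>z. of_real (expansion_coeff i / (2 * real (N - i))) * z ^ (2 * (N - i))) has_field_derivative
      of_real (expansion_coeff i) * z ^ (2 * (N - i)) / z) (at z)" if "i \<in> {..<N}" for i
  proof -
    define m where "m = N - i"
    have m: "m > 0" using that by (simp add: m_def)
    then have zm: "z ^ (2 * m) = z ^ (2 * m - 1) * z" by (metis Suc_pred' mult_pos_pos pos2 power_Suc2 minus_nat.simps One_nat_def diff_Suc_1)
    have "((\<lambda>z. of_real (expansion_coeff i / (2 * real m)) * z ^ (2 * m)) has_field_derivative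
      of_real (expansion_coeff i / (2 * real m)) * (of_nat (2 * m) * z ^ (2 * m - 1))) (at z)"
      by (auto intro!: derivative_eq_intros)
    also have "of_real (expansion_coeff i / (2 * real m)) * (of_nat (2 * m) * z ^ (2 * m - 1)) = of_real (expansion_coeff i) * z ^ (2 * m) / z"
      using m z0 unfolding zm by simp
    finally show ?thesis unfolding m_def .
  qed
  have 2: "((\<lambda>z. of_real (expansion_coeff N) * Ln z) has_field_derivative of_real (expansion_coeff N) * z ^ (2 * (N - N)) / z) (at z)"
    using z0 by (auto intro!: derivative_eq_intros simp: divide_inverse)
  have "((\<lambda>z. of_real ((pi / 2) ^ 4) *
    ((\<Sum>i<N. of_real (expansion_coeff i / (2 * real (N - i))) * z ^ (2 * (N - i))) + of_real (expansion_coeff N) * Ln z))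
    has_field_derivative of_real ((pi / 2) ^ 4) * ((\<Sum>i<N. of_real (expansion_coeff i) * z ^ (2 * (N - i)) / z) +
      of_real (expansion_coeff N) * z ^ (2 * (N - N)) / z)) (at z)"
    by (intro DERIV_cmult DERIV_add DERIV_sum 1 2)
  then show ?thesis
    unfolding moment_primitive_def[abs_def] moment_principal_def lessThan_Suc_atMost[symmetric] sum.lessThan_Suc .
qed

lemma Im_moment_primitive_difference:
  assumes R: "R > 0"
  shows "Im (moment_primitive N (\<i> * of_real R) - moment_primitive N (of_real R)) = (pi / 2) ^ 4 * (expansion_coeff N * (pi / 2))"
proof -
  have 1: "(\<i> * of_real R) ^ (2 * m) = of_real ((-1) ^ m * R ^ (2 * m))" for m
  proof -
    have "\<i> ^ (2 * m) = (-1) ^ m" by (simp add: power_mult)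
    then show ?thesis by (simp add: power_mult_distrib)
  qed
  have "Ln (\<i> * of_real R) = of_real (ln R) + \<i> * of_real (pi / 2)"
    using Ln_times_of_real[OF R, of \<i>] Ln_of_real[OF R] by (simp add: mult.commute)
  then have 2: "Im (Ln (\<i> * of_real R)) = pi / 2" by simp
  have 3: "Im (Ln (of_real R)) = 0" using R by simp
  have "Im (moment_primitive N (\<i> * of_real R)) = (pi / 2) ^ 4 * (expansion_coeff N * (pi / 2))"
    unfolding moment_primitive_def 1 of_real_mult[symmetric] of_real_sum[symmetric]
    by (simp only: times_complex.sel plus_complex.sel Im_complex_of_real Re_complex_of_real 2) simp
  moreover have "Im (moment_primitive N (of_real R)) = 0"
    unfolding moment_primitive_def of_real_power[symmetric] of_real_mult[symmetric] of_real_sum[symmetric]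
    by (simp only: times_complex.sel plus_complex.sel Im_complex_of_real Re_complex_of_real 3) simp
  ultimately show ?thesis by simp
qed

lemma moment_integral:
  "(LBINT t:{0<..}. Im (moment_integrand N (of_real t))) = - ((pi / 2) ^ 4 * (expansion_coeff N * (pi / 2)))"
proof -
  obtain \<Phi> where \<Phi>H: "\<And>z. z \<in> hankel_halfplane \<Longrightarrow> (\<Phi> has_field_derivative moment_integrand N z) (at z within hankel_halfplane)"
    using holomorphic_convex_primitive'[OF hankel_halfplane(2,1) moment_integrand_holomorphic] by blast
  have \<Phi>: "(\<Phi> has_field_derivative moment_integrand N z) (at z)" if "z \<in> quadrant" for z
    using \<Phi>H[of z] that hankel_halfplane by (metis at_within_open subsetD)
  \<comment> \<open>The chord contribution at radius \<open>R\<close>. \<open>Im \<Phi>\<close> is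
    constant on the imaginary axis, so the integral over \<open>[a, b]\<close> is
    \<open>D a - D b\<close>, and only the limits of \<open>D\<close> at 0 and infinity are
    needed.\<close>
  define D where "D R = Im (\<Phi> (\<i> * of_real R) - \<Phi> (of_real R))" for R
  have real_part: "(LBINT t:{a..b}. Im (moment_integrand N (of_real t))) = Im (\<Phi> (of_real b)) - Im (\<Phi> (of_real a))"
    if ab: "0 < a" "a \<le> b" for a b
    unfolding set_lebesgue_integral_def
  proof (rule integral_FTC_Icc[OF ab(2)])
    fix t assume t: "a \<le> t" "t \<le> b"
    have "(complex_of_real has_vector_derivative 1) (at t within {a..b})"
      by (auto intro!: derivative_eq_intros)
    from field_vector_diff_chain_within[OF this has_field_derivative_at_within[OF \<Phi>[OF of_real_in_quadrant(1)]]] t ab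
    have "((\<lambda>t. \<Phi> (of_real t)) has_vector_derivative moment_integrand N (of_real t)) (at t within {a..b})"
      by (simp add: o_def)
    from bounded_linear.has_vector_derivative[OF bounded_linear_Im this]
    show "((\<lambda>t. Im (\<Phi> (of_real t))) has_vector_derivative Im (moment_integrand N (of_real t))) (at t within {a..b})"
      by simp
  next
    show "continuous_on {a..b} (\<lambda>t. Im (moment_integrand N (of_real t)))"
      by (rule continuous_on_subset[OF moment_integrand_continuous]) (use ab in auto)
  qed
  have "\<exists>c. \<forall>y\<in>{0<..}. Im (\<Phi> (\<i> * of_real y)) = c"
  proof (rule has_field_derivative_zero_constant)
    fix y :: real assume y: "y \<in> {0<..}"
    have "((\<lambda>y. \<i> * complex_of_real y) has_vector_derivative \<i>) (at y within {0<..})"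
      by (auto intro!: derivative_eq_intros)
    from field_vector_diff_chain_within[OF this has_field_derivative_at_within[OF \<Phi>[OF of_real_in_quadrant(2)]]] y
    have "((\<lambda>y. \<Phi> (\<i> * of_real y)) has_vector_derivative \<i> * moment_integrand N (\<i> * of_real y)) (at y within {0<..})"
      by (simp add: o_def)
    from bounded_linear.has_vector_derivative[OF bounded_linear_Im this]
    show "((\<lambda>y. Im (\<Phi> (\<i> * of_real y))) has_field_derivative 0) (at y within {0<..})"
      using moment_integrand_imaginary[of y N] y by (simp add: has_real_derivative_iff_has_vector_derivative)
  qed (rule convex_real_interval)
  then obtain c where c: "\<And>y. y > 0 \<Longrightarrow> Im (\<Phi> (\<i> * of_real y)) = c" by auto
  have D_diff: "(LBINT t:{a..b}. Im (moment_integrand N (of_real t))) = D a - D b" if "0 < a" "a \<le> b" for a b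
    using real_part[OF that] c[of a] c[of b] that by (simp add: D_def)
  let ?a = "\<lambda>n. 1 / real (Suc n)" and ?b = "\<lambda>n. real (Suc n)"
  have small: "(\<lambda>n. D (?a n)) \<longlonglongrightarrow> 0"
  proof -
    obtain C where C: "\<And>z. z \<in> quadrant \<Longrightarrow> norm (bessel_kk z) \<le> C / sqrt (norm z)"
      using bessel_kk_bound by blast
    have bd: "\<bar>D r\<bar> \<le> 2 * C ^ 4 * r" if r: "0 < r" "r \<le> 1" for r
    proof -
      have "norm (moment_integrand N z) \<le> C ^ 4" if z: "z \<in> closed_segment (of_real r) (\<i> * of_real r)" for z
      proof -
        note q = closed_segment_quadrant[OF r(1) z]
        have n0: "norm z > 0" using q(1) by (simp add: quadrant_def)
        have n1: "norm z \<le> 1" using q(2) r by simp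
        have "norm (moment_integrand N z) = norm (bessel_kk z) ^ 4 * norm z ^ (2 * N + 3)"
          by (simp add: moment_integrand_def norm_mult norm_power)
        \<comment> \<open>As \<open>norm z \<le> 1\<close>, the exponent \<open>2 * N + 3\<close>
          may be lowered to 2, just enough to cancel the fourth power of the root.\<close>
        also have "\<dots> \<le> (C / sqrt (norm z)) ^ 4 * norm z ^ 2"
          using n0 n1 C[OF q(1)] by (intro mult_mono power_mono power_decreasing) auto
        also have "\<dots> = C ^ 4 * ((norm z)\<^sup>2 / sqrt (norm z) ^ 4)" by (simp add: power_divide)
        also have "sqrt (norm z) ^ 4 = (norm z)\<^sup>2" using n0 by (simp add: power4_eq_xxxx power2_eq_square mult.assoc)
        finally show ?thesis using n0 by simp
      qed
      from segment_difference_bound[OF r(1) \<Phi> this] show ?thesis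
        unfolding D_def using abs_Im_le_cmod order_trans by blast
    qed
    have "norm (D (?a n)) \<le> 2 * C ^ 4 * ?a n" for n
      unfolding real_norm_def by (rule bd) simp_all
    then have "\<forall>\<^sub>F n in sequentially. norm (D (?a n)) \<le> 2 * C ^ 4 * ?a n"
      by (rule always_eventually[OF allI])
    moreover have "(\<lambda>n. 2 * C ^ 4 * ?a n) \<longlonglongrightarrow> 0" by real_asymp
    ultimately show ?thesis by (rule Lim_null_comparison)
  qed
  have large: "(\<lambda>n. D (?b n)) \<longlonglongrightarrow> (pi / 2) ^ 4 * (expansion_coeff N * (pi / 2))"
  proof -
    obtain C where C: "\<And>z. z \<in> quadrant \<Longrightarrow> norm z \<ge> 1 \<Longrightarrow> norm (moment_integrand N z - moment_principal N z) \<le> C / (norm z)\<^sup>2"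
      using moment_integrand_expansion by blast
    \<comment> \<open>\<open>R \<ge> 2\<close> keeps the chord at distance
      \<open>R / sqrt 2 \<ge> 1\<close> from 0, where the expansion applies.\<close>
    have bdR: "\<bar>D R - (pi / 2) ^ 4 * (expansion_coeff N * (pi / 2))\<bar> \<le> 4 * \<bar>C\<bar> / R" if R: "R \<ge> 2" for R
    proof -
      have R0: "R > 0" using R by simp
      \<comment> \<open>Subtracting the explicit primitive removes the growing terms, whose
        imaginary parts are known exactly. What remains has derivative \<open>O(R^-2)\<close> on a
        chord of length at most \<open>2 * R\<close>.\<close>
      define \<Psi> where "\<Psi> z = \<Phi> z - moment_primitive N z" for z
      have bd: "norm (moment_integrand N z - moment_principal N z) \<le> \<bar>C\<bar> / (R\<^sup>2 / 2)" if z: "z \<in> closed_segment (of_real R) (\<i> * of_real R)" for z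
      proof -
        note q = closed_segment_quadrant[OF R0 z]
        have "sqrt 2 \<le> 2" by (rule real_le_lsqrt) auto
        then have "1 \<le> R / sqrt 2" using R by (simp add: le_divide_eq)
        then have n1: "norm z \<ge> 1" using q(3) by linarith
        have "R\<^sup>2 / 2 = (R / sqrt 2)\<^sup>2" by (simp add: power_divide)
        also have "\<dots> \<le> (norm z)\<^sup>2" using q(3) R0 by (intro power_mono) auto
        finally have "\<bar>C\<bar> / (norm z)\<^sup>2 \<le> \<bar>C\<bar> / (R\<^sup>2 / 2)"
          using R0 by (intro frac_le) auto
        moreover have "C / (norm z)\<^sup>2 \<le> \<bar>C\<bar> / (norm z)\<^sup>2" by (intro divide_right_mono) auto
        ultimately show ?thesis using C[OF q(1) n1] by linarith
      qed
      have \<Psi>: "(\<Psi> has_field_derivative moment_integrand N z - moment_principal N z) (at z)" if "z \<in> quadrant" for z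
        unfolding \<Psi>_def[abs_def] by (intro DERIV_diff \<Phi> moment_primitive_deriv that)
      have "norm (\<Psi> (\<i> * of_real R) - \<Psi> (of_real R)) \<le> 2 * (\<bar>C\<bar> / (R\<^sup>2 / 2)) * R"
        by (rule segment_difference_bound[OF R0 \<Psi> bd])
      moreover have "D R - (pi / 2) ^ 4 * (expansion_coeff N * (pi / 2)) = Im (\<Psi> (\<i> * of_real R) - \<Psi> (of_real R))"
        unfolding Im_moment_primitive_difference[OF R0, of N, symmetric] by (simp add: D_def \<Psi>_def)
      moreover have "2 * (\<bar>C\<bar> / (R\<^sup>2 / 2)) * R = 4 * \<bar>C\<bar> / R"
        using R0 by (simp add: power2_eq_square)
      ultimately show ?thesis using abs_Im_le_cmod[of "\<Psi> (\<i> * of_real R) - \<Psi> (of_real R)"] by linarith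
    qed
    have "\<forall>\<^sub>F n in sequentially. norm (D (?b n) - (pi / 2) ^ 4 * (expansion_coeff N * (pi / 2))) \<le> 4 * \<bar>C\<bar> / ?b n"
      using eventually_ge_at_top[of 1]
    proof eventually_elim
      case (elim n)
      then show ?case unfolding real_norm_def by (intro bdR) simp
    qed
    moreover have "(\<lambda>n. 4 * \<bar>C\<bar> / ?b n) \<longlonglongrightarrow> 0" by real_asymp
    ultimately have "(\<lambda>n. D (?b n) - (pi / 2) ^ 4 * (expansion_coeff N * (pi / 2))) \<longlonglongrightarrow> 0" by (rule Lim_null_comparison)
    then show ?thesis by (simp only: LIM_zero_iff)
  qed
  have un: "(\<Union>n. {?a n..?b n}) = {0<..}"
  proof (intro set_eqI iffI)
    fix x :: real assume "x \<in> {0<..}"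
    then have x: "x > 0" by simp
    obtain n where n: "max x (1 / x) \<le> real n" using real_arch_simple by blast
    then have "x \<le> ?b n" "1 / x \<le> ?b n" by auto
    then have "?a n \<le> x" using x by (simp add: field_simps)
    then show "x \<in> (\<Union>n. {?a n..?b n})" using \<open>x \<le> ?b n\<close> by auto
  next
    fix x :: real assume "x \<in> (\<Union>n. {?a n..?b n})"
    then obtain n where "?a n \<le> x" by auto
    moreover have "0 < ?a n" by simp
    ultimately show "x \<in> {0<..}" unfolding greaterThan_iff by linarith
  qed
  have "(\<lambda>n. LBINT t:{?a n..?b n}. Im (moment_integrand N (of_real t))) \<longlonglongrightarrow>
      (LBINT t:(\<Union>n. {?a n..?b n}). Im (moment_integrand N (of_real t)))"
  proof (rule set_integral_cont_up)
    show "incseq (\<lambda>n. {?a n..?b n})"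
      unfolding incseq_def by (auto simp: frac_le intro: order_trans[rotated])
    show "set_integrable lborel (\<Union>n. {?a n..?b n}) (\<lambda>t. Im (moment_integrand N (of_real t)))"
      unfolding un by (rule moment_integrable)
  qed auto
  moreover have "(LBINT t:{?a n..?b n}. Im (moment_integrand N (of_real t))) = D (?a n) - D (?b n)" for n
  proof (rule D_diff)
    have "1 / real (Suc n) \<le> 1" by simp
    also have "1 \<le> real (Suc n)" by simp
    finally show "?a n \<le> ?b n" .
  qed simp
  ultimately have "(\<lambda>n. D (?a n) - D (?b n)) \<longlonglongrightarrow> (LBINT t:{0<..}. Im (moment_integrand N (of_real t)))"
    unfolding un by simp
  from LIMSEQ_unique[OF this tendsto_diff[OF small large]] show ?thesis by simp
qed

section \<open>\<open>A(n)\<close> as a coefficient and as a triple sum\<close>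

lemma bessel_A_eq: "bessel_A (N + 2) = fps_nth (bessel_fps ^ 4) N"
proof -
  define g where "g t = ((pi * bessel_I0 t)\<^sup>2 - (bessel_K0 t)\<^sup>2) * bessel_I0 t * bessel_K0 t ^ 5" for t
  have "(LBINT t:{0<..}. g t * (2 * t) ^ (2 * (N + 2) - 1))
      = (LBINT t:{0<..}. (- (2 ^ (2 * N + 3)) / (4 * pi)) * Im (moment_integrand N (of_real t)))"
  proof (rule set_lebesgue_integral_cong)
    show "\<forall>t. t \<in> {0<..} \<longrightarrow> g t * (2 * t) ^ (2 * (N + 2) - 1) = (- (2 ^ (2 * N + 3)) / (4 * pi)) * Im (moment_integrand N (of_real t))"
    proof (intro allI impI)
      fix t :: real assume "t \<in> {0<..}"
      then have t: "t > 0" by simp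
      have "2 * (N + 2) - 1 = 2 * N + 3" by simp
      then show "g t * (2 * t) ^ (2 * (N + 2) - 1) = (- (2 ^ (2 * N + 3)) / (4 * pi)) * Im (moment_integrand N (of_real t))"
        unfolding Im_moment_integrand[OF t] g_def by (simp only: power_mult_distrib) simp
    qed
  qed simp
  also have "\<dots> = 2 ^ (2 * N + 3) / (4 * pi) * ((pi / 2) ^ 4 * (expansion_coeff N * (pi / 2)))"
    unfolding set_integral_mult_right moment_integral by simp
  finally have "bessel_A (N + 2) = (2 / pi) ^ 4 * (2 ^ (2 * N + 3) / (4 * pi) * ((pi / 2) ^ 4 * (expansion_coeff N * (pi / 2))))"
    unfolding bessel_A_def g_def by simp
  \<comment> \<open>\<open>2 ^ (2 * N + 3)\<close>, divided by \<open>4 * pi\<close> and multiplied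
    by the quarter turn \<open>pi / 2\<close>, leaves \<open>4 ^ N\<close>, which cancels the
    \<open>(1/4)^N\<close> of \<open>expansion_coeff\<close>.\<close>
  also have "\<dots> = ((2 / pi) ^ 4 * (pi / 2) ^ 4) * (2 ^ (2 * N) * expansion_coeff N)"
    by (simp add: power_add)
  also have "(2 / pi) ^ 4 * (pi / 2) ^ 4 = 1" by (simp flip: power_mult_distrib)
  also have "(2 :: real) ^ (2 * N) * expansion_coeff N = (4 * (1 / 4)) ^ N * fps_nth (bessel_fps ^ 4) N"
    unfolding expansion_coeff_def by (simp only: power_mult power_mult_distrib) simp
  finally show ?thesis by simp
qed

text \<open>The triple sum is the Cauchy product of four equal series, and the scaling
  \<open>1 / 16 ^ j\<close> collects to \<open>1 / 2 ^ (4 * N)\<close>.\<close>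

lemma fps_nth_bessel_power4:
  "fps_nth (bessel_fps ^ 4) N = 1 / 2 ^ (4 * N) *
    (\<Sum>m\<le>N. \<Sum>l\<le>m. \<Sum>k\<le>l. bessel_coeff (N - m) * bessel_coeff (m - l) * bessel_coeff (l - k) * bessel_coeff k)"
proof -
  define f :: "real fps" where "f = Abs_fps bessel_coeff"
  have "bessel_fps = Abs_fps (\<lambda>j. of_real ((1 / 16) ^ j * bessel_coeff j))"
    by (simp add: bessel_fps_def power_divide)
  then have 1: "fps_nth (bessel_fps ^ 4) N = (1 / 16) ^ N * fps_nth (f ^ 4) N"
    unfolding f_def using fps_nth_power_scaled[of "1 / 16" bessel_coeff 4 N, where 'a = real] by simp
  have conv: "fps_nth (p * f) n = (\<Sum>i\<le>n. bessel_coeff (n - i) * fps_nth p i)" for p n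
    unfolding fps_mult_nth atLeast0AtMost by (simp add: f_def mult.commute)
  have "f ^ 4 = f * f * f * f" by (simp add: eval_nat_numeral)
  then have "fps_nth (f ^ 4) N = (\<Sum>m\<le>N. bessel_coeff (N - m) * (\<Sum>l\<le>m. bessel_coeff (m - l) * (\<Sum>k\<le>l. bessel_coeff (l - k) * bessel_coeff k)))"
    by (simp only: conv) (simp add: f_def)
  also have "\<dots> = (\<Sum>m\<le>N. \<Sum>l\<le>m. \<Sum>k\<le>l. bessel_coeff (N - m) * bessel_coeff (m - l) * bessel_coeff (l - k) * bessel_coeff k)"
    by (simp only: sum_distrib_left mult.assoc)
  finally have 2: "fps_nth (f ^ 4) N = \<dots>" .
  have "(2 :: real) ^ (4 * N) = 16 ^ N" by (simp add: power_mult)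
  then show ?thesis unfolding 1 2 by (simp add: power_divide)
qed

theorem theorem3p4:
  shows "(\<forall>n::nat. n > 1 \<longrightarrow> bessel_A n \<in> \<int> \<and> bessel_A n > 0) \<and>
    (\<forall>n::nat. n \<ge> 1 \<longrightarrow>
      bessel_A (n + 1) =
        1 / 2 ^ (4 * (n - 1)) *
        (\<Sum>m = 1..n. \<Sum>l = 1..m. \<Sum>k = 1..l.
           (fact (2 * n - 2 * m)) ^ 3 / (fact (n - m)) ^ 4 *
           ((fact (2 * m - 2 * l)) ^ 3 / (fact (m - l)) ^ 4) *
           ((fact (2 * l - 2 * k)) ^ 3 / (fact (l - k)) ^ 4) *
           ((fact (2 * k - 2)) ^ 3 / (fact (k - 1)) ^ 4)))"
proof (intro conjI allI impI)
  fix n :: nat assume "n > 1"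
  then obtain N where n: "n = N + 2" by (metis Suc_1 Suc_leI add.commute le_Suc_ex)
  show "bessel_A n \<in> \<int>" unfolding n bessel_A_eq by (rule bessel_fps_power4_nth_Ints)
  have pos: "(0 :: real) < bessel_coeff j" for j by (simp add: bessel_coeff_def)
  show "bessel_A n > 0"
    unfolding n bessel_A_eq fps_nth_bessel_power4
    by (intro mult_pos_pos sum_pos pos) auto
next
  fix n :: nat assume "n \<ge> 1"
  then obtain N where n: "n = Suc N" by (metis Suc_le_D One_nat_def)
  \<comment> \<open>Each summation index is lowered by 1. The differences of consecutive indices do
    not change, so only the innermost factor needs its own rule, \<open>coeff1\<close>.\<close>
  have shift: "(\<Sum>i = 1..Suc j. h i) = (\<Sum>i\<le>j. h (Suc i))" for h :: "nat \<Rightarrow> real" and j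
    by (metis One_nat_def atLeast0AtMost sum.shift_bounds_cl_Suc_ivl)
  have coeff: "(fact (2 * i - 2 * j)) ^ 3 / (fact (i - j)) ^ 4 = (bessel_coeff (i - j) :: real)" for i j
    by (simp add: bessel_coeff_def right_diff_distrib')
  have coeff1: "(fact (2 * Suc k - 2)) ^ 3 / (fact (Suc k - 1)) ^ 4 = (bessel_coeff k :: real)" for k
    by (simp add: bessel_coeff_def)
  show "bessel_A (n + 1) =
        1 / 2 ^ (4 * (n - 1)) *
        (\<Sum>m = 1..n. \<Sum>l = 1..m. \<Sum>k = 1..l.
           (fact (2 * n - 2 * m)) ^ 3 / (fact (n - m)) ^ 4 *
           ((fact (2 * m - 2 * l)) ^ 3 / (fact (m - l)) ^ 4) *
           ((fact (2 * l - 2 * k)) ^ 3 / (fact (l - k)) ^ 4) *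
           ((fact (2 * k - 2)) ^ 3 / (fact (k - 1)) ^ 4))"
    using bessel_A_eq[of N] unfolding n shift coeff coeff1 fps_nth_bessel_power4 by simp
qed

end
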